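(* There is an algorithm which, given an $n$-vertex, $m$-edge unit disk graph $G$ together with a unit disk representation of it, runs in time $O(n\cdot m)$ and outputs a subcoloring of $G$ with at most $3\chi_s(G)$ colors.
   Context: A unit disk graph is the intersection graph of a finite family of closed disks of diameter $1$ in the plane; a unit disk representation lists such disks. A subcoloring of $G$ is a partition of $V(G)$ into color classes each inducing a disjoint union of cliques (no induced path on three vertices); $\chi_s(G)$ is the minimum number of colors of a subcoloring. *)

theory Defs
  imports "HOL-Analysis.Analysis" "HOL-Library.Disjoint_Sets"
begin

section \<open>Unit disk graphs\<close>

text \<open>A finite simple graph is given by its vertex set and its set of edges, an edge being a
  two-element set of vertices. Distinct vertices may be represented by the same disk.\<close>

definition intersection_edges :: "'v set \<Rightarrow> ('v \<Rightarrow> 'p set) \<Rightarrow> 'v set set" where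
  "intersection_edges V D = {{u, v} | u v. u \<in> V \<and> v \<in> V \<and> u \<noteq> v \<and> D u \<inter> D v \<noteq> {}}"

definition unit_disk_representation ::
    "'v set \<Rightarrow> 'v set set \<Rightarrow> ('v \<Rightarrow> real \<times> real) \<Rightarrow> bool" where
  "unit_disk_representation V E center \<longleftrightarrow>
     finite V \<and> E = intersection_edges V (\<lambda>v. cball (center v) (1 / 2))"


section \<open>Subcolorings\<close>

definition clique_edges :: "'v set \<Rightarrow> 'v set set" where
  "clique_edges K = {{u, v} | u v. u \<in> K \<and> v \<in> K \<and> u \<noteq> v}"

definition disjoint_union_of_cliques :: "'v set \<Rightarrow> 'v set set \<Rightarrow> bool" where
  "disjoint_union_of_cliques V E \<longleftrightarrow> (\<exists>Q. partition_on V Q \<and> E = (\<Union>K\<in>Q. clique_edges K))"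

definition induced_edges :: "'v set set \<Rightarrow> 'v set \<Rightarrow> 'v set set" where
  "induced_edges E S = {e \<in> E. e \<subseteq> S}"

definition subcoloring :: "'v set \<Rightarrow> 'v set set \<Rightarrow> 'v set set \<Rightarrow> bool" where
  "subcoloring V E P \<longleftrightarrow>
     partition_on V P \<and> (\<forall>A\<in>P. disjoint_union_of_cliques A (induced_edges E A))"

definition subchromatic_number :: "'v set \<Rightarrow> 'v set set \<Rightarrow> nat" where
  "subchromatic_number V E = (LEAST k. \<exists>P. subcoloring V E P \<and> card P = k)"

definition color_classes :: "'v set \<Rightarrow> ('v \<Rightarrow> nat) \<Rightarrow> 'v set set" where
  "color_classes V f = (\<lambda>c. {v \<in> V. f v = c}) ` f ` V"


section \<open>A real random access machine\<close>

text \<open>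
  Programs operate on named, zero-initialised, randomly accessible arrays of natural numbers and of
  real numbers; a program mentions only finitely many names, and a scalar variable is cell 0 of an
  array. Natural number arithmetic is restricted to addition and truncated subtraction. Real
  arithmetic is exact; there is no rounding operation, no conversion from reals to natural numbers,
  and the only literals are integers. Division by zero yields zero.

  Running time is the uniform-cost measure: every operation, array access, comparison and
  control-flow step costs one unit.
\<close>

type_synonym name = string

record state =
  nats :: "name \<Rightarrow> nat \<Rightarrow> nat"
  reals :: "name \<Rightarrow> nat \<Rightarrow> real"

datatype nexp = NLit nat | NGet name nexp | NAdd nexp nexp | NSub nexp nexp

datatype rexp = RLit int | RGet name nexp | RAdd rexp rexp | RSub rexp rexp
  | RMul rexp rexp | RDiv rexp rexp

datatype bexp = NLess nexp nexp | RLess rexp rexp | BNot bexp | BAnd bexp bexp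

datatype com = Skip | NSet name nexp nexp | RSet name nexp rexp | Seq com com
  | Cond bexp com com | While bexp com

primrec nval :: "nexp \<Rightarrow> state \<Rightarrow> nat" where
  "nval (NLit k) s = k"
| "nval (NGet a i) s = nats s a (nval i s)"
| "nval (NAdd e f) s = nval e s + nval f s"
| "nval (NSub e f) s = nval e s - nval f s"

primrec rval :: "rexp \<Rightarrow> state \<Rightarrow> real" where
  "rval (RLit k) s = of_int k"
| "rval (RGet a i) s = reals s a (nval i s)"
| "rval (RAdd e f) s = rval e s + rval f s"
| "rval (RSub e f) s = rval e s - rval f s"
| "rval (RMul e f) s = rval e s * rval f s"
| "rval (RDiv e f) s = rval e s / rval f s"

primrec bval :: "bexp \<Rightarrow> state \<Rightarrow> bool" where
  "bval (NLess e f) s \<longleftrightarrow> nval e s < nval f s"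
| "bval (RLess e f) s \<longleftrightarrow> rval e s < rval f s"
| "bval (BNot b) s \<longleftrightarrow> \<not> bval b s"
| "bval (BAnd b d) s \<longleftrightarrow> bval b s \<and> bval d s"

primrec ncost :: "nexp \<Rightarrow> nat" where
  "ncost (NLit k) = 1"
| "ncost (NGet a i) = 1 + ncost i"
| "ncost (NAdd e f) = 1 + ncost e + ncost f"
| "ncost (NSub e f) = 1 + ncost e + ncost f"

primrec rcost :: "rexp \<Rightarrow> nat" where
  "rcost (RLit k) = 1"
| "rcost (RGet a i) = 1 + ncost i"
| "rcost (RAdd e f) = 1 + rcost e + rcost f"
| "rcost (RSub e f) = 1 + rcost e + rcost f"
| "rcost (RMul e f) = 1 + rcost e + rcost f"
| "rcost (RDiv e f) = 1 + rcost e + rcost f"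

primrec bcost :: "bexp \<Rightarrow> nat" where
  "bcost (NLess e f) = 1 + ncost e + ncost f"
| "bcost (RLess e f) = 1 + rcost e + rcost f"
| "bcost (BNot b) = 1 + bcost b"
| "bcost (BAnd b d) = 1 + bcost b + bcost d"

definition nat_update :: "name \<Rightarrow> nat \<Rightarrow> nat \<Rightarrow> state \<Rightarrow> state" where
  "nat_update a i k s = s\<lparr>nats := (nats s)(a := (nats s a)(i := k))\<rparr>"

definition real_update :: "name \<Rightarrow> nat \<Rightarrow> real \<Rightarrow> state \<Rightarrow> state" where
  "real_update a i r s = s\<lparr>reals := (reals s)(a := (reals s a)(i := r))\<rparr>"

text \<open>\<open>exec c s t s'\<close>: started in \<open>s\<close>, program \<open>c\<close> halts in \<open>s'\<close> after \<open>t\<close> units of time.\<close>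

inductive exec :: "com \<Rightarrow> state \<Rightarrow> nat \<Rightarrow> state \<Rightarrow> bool" where
  Skip: "exec Skip s 1 s"
| NSet: "exec (NSet a i e) s (1 + ncost i + ncost e) (nat_update a (nval i s) (nval e s) s)"
| RSet: "exec (RSet a i e) s (1 + ncost i + rcost e) (real_update a (nval i s) (rval e s) s)"
| Seq: "exec c s t s' \<Longrightarrow> exec d s' t' s'' \<Longrightarrow> exec (Seq c d) s (t + t') s''"
| Cond_True: "bval b s \<Longrightarrow> exec c s t s' \<Longrightarrow> exec (Cond b c d) s (1 + bcost b + t) s'"
| Cond_False: "\<not> bval b s \<Longrightarrow> exec d s t s' \<Longrightarrow> exec (Cond b c d) s (1 + bcost b + t) s'"
| While_False: "\<not> bval b s \<Longrightarrow> exec (While b c) s (1 + bcost b) s"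
| While_True: "bval b s \<Longrightarrow> exec c s t s' \<Longrightarrow> exec (While b c) s' t' s'' \<Longrightarrow>
    exec (While b c) s (1 + bcost b + t + t') s''"


section \<open>Input and output conventions\<close>

text \<open>The graph is presented as a list of its edges, each listed once, in arbitrary order and with
  its endpoints in arbitrary order.\<close>

definition edge_enumeration :: "'v set set \<Rightarrow> ('v \<times> 'v) list \<Rightarrow> bool" where
  "edge_enumeration E es \<longleftrightarrow>
     distinct (map (\<lambda>(u, v). {u, v}) es) \<and> set (map (\<lambda>(u, v). {u, v}) es) = E"

definition input_state :: "nat \<Rightarrow> (nat \<times> nat) list \<Rightarrow> (nat \<Rightarrow> real \<times> real) \<Rightarrow> state" where
  "input_state n es center =
     \<lparr>nats = (\<lambda>a i.
        if a = ''n'' \<and> i = 0 then n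
        else if a = ''m'' \<and> i = 0 then length es
        else if a = ''src'' \<and> i < length es then fst (es ! i)
        else if a = ''dst'' \<and> i < length es then snd (es ! i)
        else 0),
      reals = (\<lambda>a i.
        if a = ''x'' \<and> i < n then fst (center i)
        else if a = ''y'' \<and> i < n then snd (center i)
        else 0)\<rparr>"

definition output_coloring :: "state \<Rightarrow> nat \<Rightarrow> nat" where
  "output_coloring s = nats s ''color''"


section \<open>Basic facts\<close>

inductive_cases exec_SkipE: "exec Skip s t s'"
inductive_cases exec_NSetE: "exec (NSet a i e) s t s'"
inductive_cases exec_RSetE: "exec (RSet a i e) s t s'"
inductive_cases exec_SeqE: "exec (Seq c d) s t s'"
inductive_cases exec_CondE: "exec (Cond b c d) s t s'"
inductive_cases exec_WhileE: "exec (While b c) s t s'"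

lemma exec_deterministic:
  "exec c s t s' \<Longrightarrow> exec c s u s'' \<Longrightarrow> t = u \<and> s' = s''"
proof (induction arbitrary: u s'' rule: exec.induct)
  case (Skip s)
  then show ?case by (elim exec_SkipE) simp
next
  case (NSet a i e s)
  then show ?case by (elim exec_NSetE) simp
next
  case (RSet a i e s)
  then show ?case by (elim exec_RSetE) simp
next
  case (Seq c s t s' d t' s2)
  from Seq.prems obtain v r v' where "u = v + v'" "exec c s v r" "exec d r v' s''"
    by (elim exec_SeqE) simp
  then show ?case using Seq.IH(1)[of v r] Seq.IH(2)[of v' s''] by simp
next
  case (Cond_True b s c t s' d)
  from Cond_True.prems Cond_True.hyps(1) obtain v
    where "u = 1 + bcost b + v" "exec c s v s''"
    by (elim exec_CondE) simp_all
  then show ?case using Cond_True.IH[of v s''] by simp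
next
  case (Cond_False b s d t s' c)
  from Cond_False.prems Cond_False.hyps(1) obtain v
    where "u = 1 + bcost b + v" "exec d s v s''"
    by (elim exec_CondE) simp_all
  then show ?case using Cond_False.IH[of v s''] by simp
next
  case (While_False b s c)
  show ?case by (rule exec_WhileE[OF While_False.prems]) (use While_False.hyps in simp_all)
next
  case (While_True b s c t s' t' s2)
  show ?case
  proof (rule exec_WhileE[OF While_True.prems])
    assume "\<not> bval b s"
    then show ?thesis using While_True.hyps(1) by simp
  next
    fix v r v'
    assume "u = Suc (bcost b + v + v')" "exec c s v r" "exec (While b c) r v' s''"
    then show ?thesis using While_True.IH(1)[of v r] While_True.IH(2)[of v' s''] by simp
  qed
qed

lemma clique_edges_iff: "{u, v} \<in> clique_edges K \<longleftrightarrow> u \<in> K \<and> v \<in> K \<and> u \<noteq> v"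
  by (auto simp: clique_edges_def doubleton_eq_iff)

lemma disjoint_union_of_cliques_iff_no_induced_P3:
  assumes "\<And>e. e \<in> E \<Longrightarrow> \<exists>u v. e = {u, v} \<and> u \<in> V \<and> v \<in> V \<and> u \<noteq> v"
  shows "disjoint_union_of_cliques V E \<longleftrightarrow>
    (\<nexists>a b c. a \<noteq> c \<and> {a, b} \<in> E \<and> {b, c} \<in> E \<and> {a, c} \<notin> E)"
proof
  assume "disjoint_union_of_cliques V E"
  then obtain Q where Q: "partition_on V Q" "E = (\<Union>K\<in>Q. clique_edges K)"
    unfolding disjoint_union_of_cliques_def by blast
  have "{a, c} \<in> E" if ac: "a \<noteq> c" and ab: "{a, b} \<in> E" and bc: "{b, c} \<in> E" for a b c
  proof -
    obtain K where K: "K \<in> Q" "a \<in> K" "b \<in> K" using ab Q(2) by (auto simp: clique_edges_iff)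
    obtain L where L: "L \<in> Q" "b \<in> L" "c \<in> L" using bc Q(2) by (auto simp: clique_edges_iff)
    have "K = L" using Q(1) K L unfolding partition_on_def disjoint_def by blast
    then show ?thesis using K L ac Q(2) by (auto simp: clique_edges_iff)
  qed
  then show "\<nexists>a b c. a \<noteq> c \<and> {a, b} \<in> E \<and> {b, c} \<in> E \<and> {a, c} \<notin> E" by blast
next
  assume no: "\<nexists>a b c. a \<noteq> c \<and> {a, b} \<in> E \<and> {b, c} \<in> E \<and> {a, c} \<notin> E"
  define R where "R = {(u, v). u \<in> V \<and> v \<in> V \<and> (u = v \<or> {u, v} \<in> E)}"
  have tr: "{u, w} \<in> E" if "{u, v} \<in> E" "{v, w} \<in> E" "u \<noteq> w" for u v w
    using no that by blast
  have R: "equiv V R"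
  proof (rule equivI)
    show "R \<subseteq> V \<times> V" by (auto simp: R_def)
    show "refl_on V R" by (auto simp: refl_on_def R_def)
    show "sym R" by (auto simp: sym_def R_def insert_commute)
    show "trans R"
    proof (rule transI)
      fix x y z assume "(x, y) \<in> R" "(y, z) \<in> R"
      then show "(x, z) \<in> R" using tr[of x y z] by (auto simp: R_def)
    qed
  qed
  have "E = (\<Union>K\<in>V // R. clique_edges K)"
  proof (intro equalityI subsetI)
    fix e assume e: "e \<in> E"
    then obtain u v where uv: "e = {u, v}" "u \<in> V" "v \<in> V" "u \<noteq> v" using assms by blast
    have "e \<in> clique_edges (R `` {u})"
      unfolding uv(1) clique_edges_iff using uv e by (auto simp: R_def)
    then show "e \<in> (\<Union>K\<in>V // R. clique_edges K)" using uv(2) by (auto simp: quotient_def)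
  next
    fix e assume "e \<in> (\<Union>K\<in>V // R. clique_edges K)"
    then obtain K u v where K: "K \<in> V // R" "e = {u, v}" "u \<in> K" "v \<in> K" "u \<noteq> v"
      by (auto simp: clique_edges_def)
    have "(u, v) \<in> R" using R K(1,3,4) in_quotient_imp_in_rel[of V R K u v] by blast
    then show "e \<in> E" using K by (auto simp: R_def)
  qed
  moreover have "partition_on V (V // R)" using R by (rule partition_on_quotient)
  ultimately show "disjoint_union_of_cliques V E" unfolding disjoint_union_of_cliques_def by blast
qed

lemma unit_disk_representation_edge_iff:
  assumes "unit_disk_representation V E center"
  shows "{u, v} \<in> E \<longleftrightarrow> u \<in> V \<and> v \<in> V \<and> u \<noteq> v \<and> dist (center u) (center v) \<le> 1"
proof -
  have meet: "cball x (1/2) \<inter> cball y (1/2) \<noteq> {} \<longleftrightarrow> dist x y \<le> 1" for x y :: "real \<times> real"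
  proof
    assume "cball x (1/2) \<inter> cball y (1/2) \<noteq> {}"
    then obtain z where "dist x z \<le> 1/2" "dist y z \<le> 1/2" by auto
    then show "dist x y \<le> 1" using dist_triangle2[of x y z] by simp
  next
    assume "dist x y \<le> 1"
    then have "midpoint x y \<in> cball x (1/2) \<inter> cball y (1/2)" by (simp add: dist_midpoint)
    then show "cball x (1/2) \<inter> cball y (1/2) \<noteq> {}" by blast
  qed
  have "E = intersection_edges V (\<lambda>v. cball (center v) (1 / 2))"
    using assms by (simp add: unit_disk_representation_def)
  then have "{u, v} \<in> E \<longleftrightarrow> u \<in> V \<and> v \<in> V \<and> u \<noteq> v \<and>
      cball (center u) (1/2) \<inter> cball (center v) (1/2) \<noteq> {}"
    by (auto simp: intersection_edges_def doubleton_eq_iff)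
  then show ?thesis by (simp only: meet)
qed

lemma subchromatic_number_attained:
  fixes E :: "'v set set"
  assumes "\<And>e. e \<in> E \<Longrightarrow> \<exists>u v. e = {u, v} \<and> u \<noteq> v"
  shows "\<exists>P. subcoloring V E P \<and> card P = subchromatic_number V E"
proof -
  let ?P = "(\<lambda>v. {v}) ` V"
  have "partition_on V ?P" by (auto simp: partition_on_def disjoint_def)
  moreover have "disjoint_union_of_cliques {v} (induced_edges E {v})" for v
  proof -
    have "induced_edges E {v} = {}"
    proof (rule ccontr)
      assume "induced_edges E {v} \<noteq> {}"
      then obtain e where "e \<in> E" "e \<subseteq> {v}" by (auto simp: induced_edges_def)
      then show False using assms[of e] by auto
    qed
    moreover have "partition_on {v} {{v}}" by (auto simp: partition_on_def)
    moreover have "clique_edges {v} = {}" by (auto simp: clique_edges_def)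
    ultimately show ?thesis unfolding disjoint_union_of_cliques_def by auto
  qed
  ultimately have "\<exists>k P. subcoloring V E P \<and> card P = k" by (auto simp: subcoloring_def)
  then show ?thesis unfolding subchromatic_number_def by (rule LeastI_ex)
qed

lemma edge_enumeration_length: "edge_enumeration E es \<Longrightarrow> length es = card E"
  unfolding edge_enumeration_def by (metis distinct_card length_map)

end

theory Submission
  imports Defs
begin

text \<open>
  Cut the plane into bricks of width 2 and height 3/2, consecutive rows being shifted by half a brick.
  The bricks can be 3-coloured such that different bricks of the same colour are more than 1 apart,
  so subcolouring every brick with \<open>k\<close> colours gives a subcolouring with \<open>3 k\<close> colours. A brick has
  twelve square cells of side 1/2, each of which is a clique. In a subcolouring by two colours all
  vertices of the same cell and colour lie in the same clique, so once it is guessed, for each colour,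
  which cells share a clique (constantly many guesses), the existence of a 2-subcolouring of the
  brick is a 2-SAT instance with one variable per vertex. Hence either a graph is a disjoint union of cliques,
  or its bricks yield 6 colours, or it needs at least 3 colours, and then the 9 colours obtained from the cells modulo
  3 in both directions suffice.

  The machine cannot round, so the cells are found by counting from a reference vertex of the
  connected component, whose diameter is below \<open>n\<close>. As cells are cliques, the number of pairs of
  non-isolated vertices in a common brick is \<open>O(m)\<close>, which bounds the cost of 2-SAT by limited
  backtracking by \<open>O(n m)\<close>.
\<close>

section \<open>Time-bounded total correctness\<close>

text \<open>The ratio 3 asks for precision only where it is cheap: one colour for optimum 1, six for
  optimum 2, and from optimum 3 on any nine colours will do. So the only hard question is whether a
  brick has a 2-subcolouring, and one brick without it certifies optimum at least 3 for the whole
  graph.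

  The obstacle is that being free of induced paths is a condition on triples. A guess prescribes,
  for each cell and colour, a representative of its clique, and adjacency inside a colour class has
  to coincide with equality of representatives. This is a condition on pairs, hence a set of clauses
  with two literals. The guesses are written into the program as literals.

  Backtracking never goes deep. A successful propagation leaves a partial assignment that constrains
  nothing outside itself, and a failed one uses only consequences of its own start value. Each
  attempt costs \<open>n\<close> times the size of the brick, and summing over the vertices counts
  pairs in common bricks.

  Both placing and solving a vertex may cost order \<open>n\<close>, and n * n can exceed n * m.
  Therefore both are confined to the at most 2 m endpoints of edges.\<close>

definition runs :: "com \<Rightarrow> state \<Rightarrow> nat \<Rightarrow> (state \<Rightarrow> bool) \<Rightarrow> bool" where
  "runs c s T Q \<longleftrightarrow> (\<exists>t s'. exec c s t s' \<and> t \<le> T \<and> Q s')"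

text \<open>Together with the syntactic set \<open>writes\<close> this lets invariants mention only
  what a loop changes; everything else is recovered from the program text.\<close>

definition frame :: "name set \<Rightarrow> state \<Rightarrow> state \<Rightarrow> bool" where
  "frame M s s' \<longleftrightarrow> (\<forall>a. a \<notin> M \<longrightarrow> nats s' a = nats s a \<and> reals s' a = reals s a)"

primrec writes :: "com \<Rightarrow> name set" where
  "writes Skip = {}"
| "writes (NSet a i e) = {a}"
| "writes (RSet a i e) = {a}"
| "writes (Seq c d) = writes c \<union> writes d"
| "writes (Cond b c d) = writes c \<union> writes d"
| "writes (While b c) = writes c"

primrec loop_free :: "com \<Rightarrow> bool" where
  "loop_free Skip \<longleftrightarrow> True"
| "loop_free (NSet a i e) \<longleftrightarrow> True"
| "loop_free (RSet a i e) \<longleftrightarrow> True"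
| "loop_free (Seq c d) \<longleftrightarrow> loop_free c \<and> loop_free d"
| "loop_free (Cond b c d) \<longleftrightarrow> loop_free c \<and> loop_free d"
| "loop_free (While b c) \<longleftrightarrow> False"

text \<open>The values on loops are irrelevant.\<close>

primrec effect :: "com \<Rightarrow> state \<Rightarrow> state" where
  "effect Skip s = s"
| "effect (NSet a i e) s = nat_update a (nval i s) (nval e s) s"
| "effect (RSet a i e) s = real_update a (nval i s) (rval e s) s"
| "effect (Seq c d) s = effect d (effect c s)"
| "effect (Cond b c d) s = (if bval b s then effect c s else effect d s)"
| "effect (While b c) s = s"

primrec max_cost :: "com \<Rightarrow> nat" where
  "max_cost Skip = 1"
| "max_cost (NSet a i e) = 1 + ncost i + ncost e"
| "max_cost (RSet a i e) = 1 + ncost i + rcost e"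
| "max_cost (Seq c d) = max_cost c + max_cost d"
| "max_cost (Cond b c d) = 1 + bcost b + max (max_cost c) (max_cost d)"
| "max_cost (While b c) = 0"

lemma nats_nat_update: "nats (nat_update a i k s) b = (if b = a then (nats s a)(i := k) else nats s b)"
  and reals_nat_update: "reals (nat_update a i k s) = reals s"
  and nats_real_update: "nats (real_update a i r s) = nats s"
  and reals_real_update:
    "reals (real_update a i r s) b = (if b = a then (reals s a)(i := r) else reals s b)"
  by (simp_all add: nat_update_def real_update_def)

lemmas update_simps = nats_nat_update reals_nat_update nats_real_update reals_real_update

lemma frame_refl: "frame M s s"
  and frame_trans: "frame M s s' \<Longrightarrow> frame M s' s'' \<Longrightarrow> frame M s s''"
  and frame_mono: "frame M s s' \<Longrightarrow> M \<subseteq> M' \<Longrightarrow> frame M' s s'"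
  and frame_nats: "frame M s s' \<Longrightarrow> a \<notin> M \<Longrightarrow> nats s' a = nats s a"
  and frame_reals: "frame M s s' \<Longrightarrow> a \<notin> M \<Longrightarrow> reals s' a = reals s a"
  by (auto simp: frame_def)

lemma exec_frame: "exec c s t s' \<Longrightarrow> frame (writes c) s s'"
  by (induction rule: exec.induct) (auto simp: frame_def update_simps)

lemma runs_conseq:
  assumes "runs c s T Q" "T \<le> T'" "\<And>s'. frame (writes c) s s' \<Longrightarrow> Q s' \<Longrightarrow> Q' s'"
  shows "runs c s T' Q'"
  using assms exec_frame unfolding runs_def by (meson le_trans)

lemma runs_loop_free:
  assumes "loop_free c"
  shows "runs c s (max_cost c) (\<lambda>s'. s' = effect c s)"
proof -
  have "\<exists>t. exec c s t (effect c s) \<and> t \<le> max_cost c" using assms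
  proof (induction c arbitrary: s)
    case (Seq c d)
    then obtain t t' where "exec c s t (effect c s)" "t \<le> max_cost c"
        "exec d (effect c s) t' (effect d (effect c s))" "t' \<le> max_cost d"
      by (metis loop_free.simps(4))
    then show ?case using exec.Seq[of c s t _ d t'] by (intro exI[of _ "t + t'"]) auto
  next
    case (Cond b c d)
    have "\<exists>t. exec c s t (effect c s) \<and> t \<le> max_cost c" "\<exists>t. exec d s t (effect d s) \<and> t \<le> max_cost d"
      using Cond by auto
    then obtain t t' where t: "exec c s t (effect c s)" "t \<le> max_cost c"
        "exec d s t' (effect d s)" "t' \<le> max_cost d"
      by blast
    show ?case
    proof (cases "bval b s")
      case True
      then show ?thesis using exec.Cond_True[OF True t(1), of d] t(2)
        by (intro exI[of _ "1 + bcost b + t"]) auto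
    next
      case False
      then show ?thesis using exec.Cond_False[OF False t(3), of c] t(4)
        by (intro exI[of _ "1 + bcost b + t'"]) auto
    qed
  next
    case Skip
    show ?case using exec.Skip by (intro exI[of _ 1]) simp
  next
    case (NSet a i e)
    show ?case using exec.NSet[of a i e s] by (intro exI[of _ "1 + ncost i + ncost e"]) simp
  next
    case (RSet a i e)
    show ?case using exec.RSet[of a i e s] by (intro exI[of _ "1 + ncost i + rcost e"]) simp
  qed simp
  then show ?thesis unfolding runs_def by blast
qed

lemma runs_loop_freeI:
  assumes "loop_free c" "Q (effect c s)" "max_cost c \<le> T"
  shows "runs c s T Q"
  by (rule runs_conseq[OF runs_loop_free[OF assms(1)] assms(3)]) (simp add: assms(2))

lemma runs_Seq:
  assumes "runs c s T Q" "\<And>s'. frame (writes c) s s' \<Longrightarrow> Q s' \<Longrightarrow> runs d s' T' Q'"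
  shows "runs (Seq c d) s (T + T') Q'"
proof -
  obtain t s' where 1: "exec c s t s'" "t \<le> T" "Q s'" using assms(1) unfolding runs_def by blast
  then obtain t' s'' where "exec d s' t' s''" "t' \<le> T'" "Q' s''"
    using assms(2) exec_frame unfolding runs_def by blast
  with 1 show ?thesis unfolding runs_def by (meson add_mono exec.Seq)
qed

lemma runs_Seq_loop_free:
  assumes "loop_free c" "runs d (effect c s) T Q"
  shows "runs (Seq c d) s (max_cost c + T) Q"
  by (rule runs_Seq[OF runs_loop_free[OF assms(1)]]) (use assms(2) in simp)

lemma runs_Cond:
  assumes "bval b s \<Longrightarrow> runs c s T Q" "\<not> bval b s \<Longrightarrow> runs d s T Q"
  shows "runs (Cond b c d) s (1 + bcost b + T) Q"
proof (cases "bval b s")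
  case True
  then obtain t s' where "exec c s t s'" "t \<le> T" "Q s'" using assms(1) unfolding runs_def by blast
  with True show ?thesis unfolding runs_def by (meson add_left_mono exec.Cond_True)
next
  case False
  then obtain t s' where "exec d s t s'" "t \<le> T" "Q s'" using assms(2) unfolding runs_def by blast
  with False show ?thesis unfolding runs_def by (meson add_left_mono exec.Cond_False)
qed

text \<open>\<open>h\<close> counts finished rounds, and the budget \<open>T h\<close> may depend on
  it: later costs are sums over block sizes, which a uniform bound per round would lose. The bound
  \<open>h \<le> N\<close> provides termination, by induction on \<open>N - k\<close>.\<close>

lemma runs_While:
  assumes init: "I 0 s"
    and step: "\<And>h s'. frame (writes c) s s' \<Longrightarrow> I h s' \<Longrightarrow> bval b s' \<Longrightarrow> runs c s' (T h) (I (Suc h))"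
    and bound: "\<And>h s'. frame (writes c) s s' \<Longrightarrow> I h s' \<Longrightarrow> h \<le> N"
  shows "runs (While b c) s (1 + bcost b + (\<Sum>h<N. 1 + bcost b + T h))
    (\<lambda>s'. (\<exists>h. I h s') \<and> \<not> bval b s')"
proof -
  have "runs (While b c) s' (1 + bcost b + (\<Sum>h=k..<N. 1 + bcost b + T h))
      (\<lambda>s'. (\<exists>h. I h s') \<and> \<not> bval b s')"
    if "frame (writes c) s s'" "I k s'" for k s'
    using that
  proof (induction "N - k" arbitrary: k s' rule: less_induct)
    case less
    show ?case
    proof (cases "bval b s'")
      case False
      then have "exec (While b c) s' (1 + bcost b) s'" by (rule exec.While_False)
      then show ?thesis using False less.prems unfolding runs_def by (intro exI[of _ "1 + bcost b"]) auto
    next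
      case True
      obtain t r where r: "exec c s' t r" "t \<le> T k" "I (Suc k) r"
        using step[OF less.prems True] unfolding runs_def by blast
      have fr: "frame (writes c) s r" using less.prems(1) exec_frame[OF r(1)] by (rule frame_trans)
      have k: "k < N" using bound[OF fr r(3)] by simp
      then have "N - Suc k < N - k" by simp
      from less.hyps[OF this fr r(3)] obtain t' r' where r': "exec (While b c) r t' r'"
          "t' \<le> 1 + bcost b + (\<Sum>h=Suc k..<N. 1 + bcost b + T h)" "\<exists>h. I h r'" "\<not> bval b r'"
        unfolding runs_def by blast
      have "exec (While b c) s' (1 + bcost b + t + t') r'"
        using True r(1) r'(1) by (rule exec.While_True)
      moreover have "1 + bcost b + t + t' \<le> 1 + bcost b + (\<Sum>h=k..<N. 1 + bcost b + T h)"
        using r(2) r'(2) k by (simp add: sum.atLeast_Suc_lessThan)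
      ultimately show ?thesis using r'(3,4) unfolding runs_def by blast
    qed
  qed
  from this[OF frame_refl init] show ?thesis by (simp add: atLeast0LessThan)
qed

abbreviation scalar :: "name \<Rightarrow> nexp" where
  "scalar a \<equiv> NGet a (NLit 0)"

abbreviation set_scalar :: "name \<Rightarrow> nexp \<Rightarrow> com" where
  "set_scalar a e \<equiv> NSet a (NLit 0) e"

definition For :: "name \<Rightarrow> name \<Rightarrow> com \<Rightarrow> com" where
  "For i b c = Seq (set_scalar i (NLit 0))
     (While (NLess (scalar i) (scalar b)) (Seq c (set_scalar i (NAdd (scalar i) (NLit 1)))))"

lemma writes_For [simp]: "writes (For i b c) = insert i (writes c)"
  by (auto simp: For_def)

text \<open>The 9 units are 3 for the initial assignment and 6 for the last, failing test; a round
  adds 6 for its test and 6 for the increment. The premise \<open>stable\<close> lets the counter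
  move after the body has re-established the invariant.\<close>

lemma runs_For:
  assumes names: "i \<notin> writes c" "b \<notin> writes c" "i \<noteq> b" and N: "nats s b 0 = N"
    and init: "I 0 s"
    and step: "\<And>k s'. k < N \<Longrightarrow> frame (insert i (writes c)) s s' \<Longrightarrow> nats s' i 0 = k \<Longrightarrow> I k s' \<Longrightarrow>
      runs c s' (T k) (I (Suc k))"
    and stable: "\<And>k s' s''. frame {i} s' s'' \<Longrightarrow> I k s' \<Longrightarrow> I k s''"
  shows "runs (For i b c) s (9 + (\<Sum>k<N. 12 + T k)) (I N)"
proof -
  let ?b = "NLess (scalar i) (scalar b)" and ?inc = "set_scalar i (NAdd (scalar i) (NLit 1))"
  define s0 where "s0 = nat_update i 0 0 s"
  have fr0: "frame {i} s s0" by (auto simp: s0_def frame_def update_simps)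
  have "runs (While ?b (Seq c ?inc)) s0 (1 + bcost ?b + (\<Sum>k<N. 1 + bcost ?b + (T k + max_cost ?inc)))
      (\<lambda>s'. (\<exists>h. h \<le> N \<and> nats s' i 0 = h \<and> I h s') \<and> \<not> bval ?b s')"
  proof (rule runs_While[where I = "\<lambda>h s'. h \<le> N \<and> nats s' i 0 = h \<and> I h s'"])
    show "0 \<le> N \<and> nats s0 i 0 = 0 \<and> I 0 s0"
      using stable[OF fr0 init] by (simp add: s0_def update_simps)
  next
    fix h s' assume fr: "frame (writes (Seq c ?inc)) s0 s'" and inv: "h \<le> N \<and> nats s' i 0 = h \<and> I h s'"
      and b: "bval ?b s'"
    have fr': "frame (insert i (writes c)) s s'"
      using frame_mono[OF fr0, of "insert i (writes c)"] frame_mono[OF fr, of "insert i (writes c)"]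
      by (auto intro: frame_trans)
    have "nats s' b 0 = N" using fr' names N by (auto simp: frame_def)
    then have h: "h < N" using b inv by simp
    show "runs (Seq c ?inc) s' (T h + max_cost ?inc) (\<lambda>s'. Suc h \<le> N \<and> nats s' i 0 = Suc h \<and> I (Suc h) s')"
    proof (rule runs_Seq[OF step[OF h fr']])
      show "nats s' i 0 = h" "I h s'" using inv by auto
      fix s'' assume s'': "frame (writes c) s' s''" "I (Suc h) s''"
      have "nats s'' i 0 = h" using s''(1) names inv by (auto simp: frame_def)
      moreover have "I (Suc h) (nat_update i 0 (Suc h) s'')"
        using s''(2) by (rule stable[rotated]) (auto simp: frame_def update_simps)
      ultimately show "runs ?inc s'' (max_cost ?inc) (\<lambda>s'. Suc h \<le> N \<and> nats s' i 0 = Suc h \<and> I (Suc h) s')"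
        using h by (intro runs_loop_freeI) (auto simp: update_simps)
    qed
  qed simp
  then have loop: "runs (While ?b (Seq c ?inc)) s0 (6 + (\<Sum>k<N. 12 + T k))
      (\<lambda>s'. (\<exists>h. h \<le> N \<and> nats s' i 0 = h \<and> I h s') \<and> \<not> bval ?b s')"
    by (rule runs_conseq) (auto intro: sum_mono)
  have "runs (For i b c) s (max_cost (set_scalar i (NLit 0)) + (6 + (\<Sum>k<N. 12 + T k))) (I N)"
    unfolding For_def
  proof (rule runs_Seq_loop_free)
    show "runs (While ?b (Seq c ?inc)) (effect (set_scalar i (NLit 0)) s) (6 + (\<Sum>k<N. 12 + T k)) (I N)"
    proof (rule runs_conseq)
      show "runs (While ?b (Seq c ?inc)) (effect (set_scalar i (NLit 0)) s) (6 + (\<Sum>k<N. 12 + T k))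
        (\<lambda>s'. (\<exists>h. h \<le> N \<and> nats s' i 0 = h \<and> I h s') \<and> \<not> bval ?b s')"
        using loop by (simp add: s0_def)
      fix s' assume fr: "frame (writes (While ?b (Seq c ?inc))) (effect (set_scalar i (NLit 0)) s) s'"
        and Q: "(\<exists>h. h \<le> N \<and> nats s' i 0 = h \<and> I h s') \<and> \<not> bval ?b s'"
      have "nats s' b 0 = N" using fr names N by (auto simp: frame_def update_simps)
      then show "I N s'" using Q by (metis bval.simps(1) le_neq_implies_less nval.simps(1,2))
    qed simp
  qed simp
  then show ?thesis by (rule runs_conseq) auto
qed

section \<open>Subcolorings and bricks\<close>

definition clustered :: "('a \<Rightarrow> 'a \<Rightarrow> bool) \<Rightarrow> 'a set \<Rightarrow> ('a \<Rightarrow> nat) \<Rightarrow> bool" where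
  "clustered A V f \<longleftrightarrow> (\<forall>a\<in>V. \<forall>b\<in>V. \<forall>c\<in>V. f a = f b \<longrightarrow> f b = f c \<longrightarrow> A a b \<longrightarrow> A b c \<longrightarrow> A a c)"

lemma clusteredD:
  "clustered A V f \<Longrightarrow> a \<in> V \<Longrightarrow> b \<in> V \<Longrightarrow> c \<in> V \<Longrightarrow> f a = f b \<Longrightarrow> f b = f c \<Longrightarrow> A a b \<Longrightarrow> A b c \<Longrightarrow> A a c"
  unfolding clustered_def by blast

definition near :: "('v \<Rightarrow> real \<times> real) \<Rightarrow> 'v \<Rightarrow> 'v \<Rightarrow> bool" where
  "near center u w \<longleftrightarrow> dist (center u) (center w) \<le> 1"

lemma near_refl: "near center u u"
  and near_sym: "near center u w \<longleftrightarrow> near center w u"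
  by (simp_all add: near_def dist_commute)

text \<open>Squared distances make adjacency testable on a machine without square roots.\<close>

lemma near_iff: "near center u w \<longleftrightarrow>
    (fst (center u) - fst (center w))\<^sup>2 + (snd (center u) - snd (center w))\<^sup>2 \<le> 1"
  by (simp add: near_def dist_prod_def dist_real_def)

lemma edge_iff_near:
  assumes "unit_disk_representation V E center"
  shows "{u, v} \<in> E \<longleftrightarrow> u \<in> V \<and> v \<in> V \<and> u \<noteq> v \<and> near center u v"
  using unit_disk_representation_edge_iff[OF assms] by (simp add: near_def)

lemma edge_doubleton:
  assumes "unit_disk_representation V E center" "e \<in> E"
  obtains u v where "e = {u, v}" "u \<in> V" "v \<in> V" "u \<noteq> v"
  using assms by (auto simp: unit_disk_representation_def intersection_edges_def)

text \<open>Absence of an induced path on three vertices is transitivity of adjacency; passing to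
  the reflexive relation \<open>near\<close> absorbs the distinctness conditions.\<close>

lemma induced_cliques_iff:
  assumes rep: "unit_disk_representation V E center" and "S \<subseteq> V"
  shows "disjoint_union_of_cliques S (induced_edges E S) \<longleftrightarrow>
    (\<forall>a\<in>S. \<forall>b\<in>S. \<forall>c\<in>S. near center a b \<longrightarrow> near center b c \<longrightarrow> near center a c)"
proof -
  have mem: "{u, v} \<in> induced_edges E S \<longleftrightarrow> u \<in> S \<and> v \<in> S \<and> u \<noteq> v \<and> near center u v" for u v
    using edge_iff_near[OF rep] assms(2) by (auto simp: induced_edges_def)
  have "\<exists>u v. e = {u, v} \<and> u \<in> S \<and> v \<in> S \<and> u \<noteq> v" if "e \<in> induced_edges E S" for e
  proof -
    have e: "e \<in> E" "e \<subseteq> S" using that by (auto simp: induced_edges_def)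
    from rep e(1) obtain u v where "e = {u, v}" "u \<noteq> v" by (rule edge_doubleton)
    then show ?thesis using e(2) by blast
  qed
  then have "disjoint_union_of_cliques S (induced_edges E S) \<longleftrightarrow>
    (\<nexists>a b c. a \<noteq> c \<and> {a, b} \<in> induced_edges E S \<and> {b, c} \<in> induced_edges E S \<and>
      {a, c} \<notin> induced_edges E S)"
    by (rule disjoint_union_of_cliques_iff_no_induced_P3)
  also have "\<dots> \<longleftrightarrow> (\<forall>a\<in>S. \<forall>b\<in>S. \<forall>c\<in>S. near center a b \<longrightarrow> near center b c \<longrightarrow> near center a c)"
    unfolding mem by (auto simp: near_refl) (metis near_refl)+
  finally show ?thesis .
qed

lemma subcoloring_color_classes:
  assumes rep: "unit_disk_representation V E center" and "clustered (near center) V f"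
  shows "subcoloring V E (color_classes V f)"
proof -
  have "partition_on V (color_classes V f)"
    by (auto simp: partition_on_def disjoint_def color_classes_def)
  moreover have "disjoint_union_of_cliques S (induced_edges E S)" if S_mem: "S \<in> color_classes V f" for S
  proof -
    obtain k where S: "S = {v \<in> V. f v = k}" using S_mem unfolding color_classes_def by blast
    then have "S \<subseteq> V" by auto
    then show ?thesis
    proof (subst induced_cliques_iff[OF rep], simp, intro ballI impI)
      fix a b c assume "a \<in> S" "b \<in> S" "c \<in> S" "near center a b" "near center b c"
      then show "near center a c" using clusteredD[OF assms(2), of a b c] by (simp add: S)
    qed
  qed
  ultimately show ?thesis by (simp add: subcoloring_def)
qed

lemma card_color_classes_le:
  assumes "f ` V \<subseteq> {..<k}"
  shows "card (color_classes V f) \<le> k"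
proof -
  have "card (color_classes V f) \<le> card (f ` V)" unfolding color_classes_def
    by (rule card_image_le) (use assms finite_subset in blast)
  also have "\<dots> \<le> card {..<k}" using assms by (intro card_mono) auto
  finally show ?thesis by simp
qed

text \<open>The classes of an optimal partition are numbered. Every lower bound on the subchromatic
  number is extracted from such an \<open>f\<close>.\<close>

lemma optimal_coloring:
  assumes rep: "unit_disk_representation V E center"
  obtains f where "clustered (near center) V f" "f ` V \<subseteq> {..<subchromatic_number V E}"
proof -
  have "\<exists>P. subcoloring V E P \<and> card P = subchromatic_number V E"
    by (rule subchromatic_number_attained) (metis edge_doubleton[OF rep])
  then obtain P where P: "partition_on V P" "card P = subchromatic_number V E"
      "\<And>S. S \<in> P \<Longrightarrow> disjoint_union_of_cliques S (induced_edges E S)"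
    by (auto simp: subcoloring_def)
  have "finite V" using rep by (simp add: unit_disk_representation_def)
  then have "finite P" using P(1) by (rule finite_elements)
  then obtain i where i: "bij_betw i P {..<card P}"
    using ex_bij_betw_finite_nat[of P] by (auto simp: atLeast0LessThan)
  define cls where "cls v = (THE S. S \<in> P \<and> v \<in> S)" for v
  have cls: "cls v \<in> P \<and> v \<in> cls v" if "v \<in> V" for v
    unfolding cls_def
  proof (rule theI')
    have "\<exists>S. S \<in> P \<and> v \<in> S" using that partition_onD1[OF P(1)] by blast
    moreover have "S = S'" if "S \<in> P \<and> v \<in> S" "S' \<in> P \<and> v \<in> S'" for S S'
      using that disjointD[OF partition_onD2[OF P(1)], of S S'] by blast
    ultimately show "\<exists>!S. S \<in> P \<and> v \<in> S" by blast
  qed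
  show ?thesis
  proof
    show "(i \<circ> cls) ` V \<subseteq> {..<subchromatic_number V E}"
      using i cls P(2) by (auto simp: bij_betw_def)
    show "clustered (near center) V (i \<circ> cls)" unfolding clustered_def
    proof (intro ballI impI)
      fix a b c assume V: "a \<in> V" "b \<in> V" "c \<in> V"
        and eq: "(i \<circ> cls) a = (i \<circ> cls) b" "(i \<circ> cls) b = (i \<circ> cls) c"
        and near: "near center a b" "near center b c"
      have "cls a = cls b" "cls b = cls c"
        using eq cls V bij_betw_imp_inj_on[OF i] by (metis comp_apply inj_onD)+
      moreover have "cls a \<subseteq> V" using cls[OF V(1)] P(1) by (auto simp: partition_on_def)
      ultimately show "near center a c"
        using induced_cliques_iff[OF rep, of "cls a"] P(3)[of "cls a"] cls V near by metis
    qed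
  qed
qed

text \<open>Here \<open>a\<close> and \<open>b\<close> are the doubled coordinates of a point, so cells have unit side. Brick \<open>Q\<close> of row \<open>R\<close>
  has 4 by 3 cells, odd rows are shifted by two cells, \<open>(lx, ly)\<close> is the cell inside the brick and \<open>p\<close>
  the colour of the brick.\<close>

definition brick_position ::
    "real \<Rightarrow> real \<Rightarrow> nat \<Rightarrow> nat \<Rightarrow> nat \<Rightarrow> nat \<Rightarrow> nat \<Rightarrow> bool" where
  "brick_position a b R ly Q lx p \<longleftrightarrow> ly < 3 \<and> lx < 4 \<and>
     real (3 * R + ly) \<le> b \<and> b < real (3 * R + ly) + 1 \<and>
     real (4 * Q + lx) \<le> a + 2 * real (R mod 2) \<and> a + 2 * real (R mod 2) < real (4 * Q + lx) + 1 \<and>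
     p = (Q + R mod 2) mod 3"

section \<open>Distances between bricks and between cells\<close>

lemma brick_position_same_cell:
  assumes "brick_position a b R ly Q lx p" "brick_position a' b' R ly Q lx p'"
  shows "\<bar>a - a'\<bar> < 1" "\<bar>b - b'\<bar> < 1"
  using assms unfolding brick_position_def by linarith+

text \<open>Numbers at most 2 apart have integer parts at most 2 apart, since cells exclude their
  upper ends. The column of a cell is \<open>4 * Q + lx - 2 * (R mod 2)\<close>; the subtracted
  shifts are moved across the inequality because these are natural numbers.\<close>

lemma brick_position_rounded:
  assumes "brick_position a b R ly Q lx p" "brick_position a' b' R' ly' Q' lx' p'"
    and "\<bar>a - a'\<bar> \<le> 2" "\<bar>b - b'\<bar> \<le> 2"
  shows "3 * R + ly \<le> 3 * R' + ly' + 2" "4 * Q + lx + 2 * (R' mod 2) \<le> 4 * Q' + lx' + 2 * (R mod 2) + 2"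
proof -
  have "real (3 * R + ly) < real (3 * R' + ly' + 3)"
    using assms unfolding brick_position_def by simp linarith
  then show "3 * R + ly \<le> 3 * R' + ly' + 2" by linarith
  have "real (4 * Q + lx + 2 * (R' mod 2)) < real (4 * Q' + lx' + 2 * (R mod 2) + 3)"
    using assms unfolding brick_position_def by simp linarith
  then show "4 * Q + lx + 2 * (R' mod 2) \<le> 4 * Q' + lx' + 2 * (R mod 2) + 2" by linarith
qed

text \<open>Let \<open>e\<close> and \<open>e'\<close> be the row parities. Vertical closeness makes
  the rows equal or adjacent. Equal colours give Q - Q' = e' - e + 3 t, so the columns differ by 6
  (e' - e + 2 t) + (lx - lx'). This is at most 2 in absolute value and lx - lx' is at most 3, so the
  multiple of 6 vanishes; by parity t = 0 and e = e'.\<close>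

lemma brick_position_same_palette:
  assumes pos: "brick_position a b R ly Q lx p" "brick_position a' b' R' ly' Q' lx' p"
    and close: "\<bar>a - a'\<bar> \<le> 2" "\<bar>b - b'\<bar> \<le> 2"
  shows "R = R' \<and> Q = Q'"
proof -
  note le = brick_position_rounded[OF pos close]
  have "\<bar>a' - a\<bar> \<le> 2" "\<bar>b' - b\<bar> \<le> 2" using close by linarith+
  note ge = brick_position_rounded[OF pos(2,1) this]
  have l: "ly < 3" "ly' < 3" "lx < 4" "lx' < 4" "(Q + R mod 2) mod 3 = (Q' + R' mod 2) mod 3"
    using pos by (auto simp: brick_position_def)
  have R: "R \<le> R' + 1" "R' \<le> R + 1" using le(1) ge(1) l by linarith+
  define e e' where "e = R mod 2" and "e' = R' mod 2"
  have "R = R' \<or> R = Suc R' \<or> R' = Suc R" using R by linarith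
  then have e: "e = e' \<and> R = R' \<or> e + e' = 1" unfolding e_def e'_def mod_2_eq_odd by auto
  have "e < 2" "e' < 2" by (auto simp: e_def e'_def)
  then have e01: "int e = 0 \<or> int e = 1" "int e' = 0 \<or> int e' = 1" by auto
  have "int (Q + e) mod 3 = int (Q' + e') mod 3"
    using arg_cong[OF l(5), of int] unfolding e_def e'_def by (simp add: zmod_int)
  then obtain t where t: "int Q + int e = int Q' + int e' + 3 * t"
    by (metis mod_eqE of_nat_add)
  have b: "4 * int Q + int lx + 2 * int e' \<le> 4 * int Q' + int lx' + 2 * int e + 2"
    "4 * int Q' + int lx' + 2 * int e \<le> 4 * int Q + int lx + 2 * int e' + 2"
    using le(2) ge(2) unfolding e_def[symmetric] e'_def[symmetric] by linarith+
  have lx: "int lx < 4" "int lx' < 4" "0 \<le> int lx" "0 \<le> int lx'" using l by auto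
  have "t = 0" using e01
  proof (elim disjE)
    assume "int e = 0" "int e' = 0" then show ?thesis using t b lx by linarith
  next
    assume "int e = 0" "int e' = 1" then show ?thesis using t b lx by linarith
  next
    assume "int e = 1" "int e' = 0" then show ?thesis using t b lx by linarith
  next
    assume "int e = 1" "int e' = 1" then show ?thesis using t b lx by linarith
  qed
  then have "Q = Q' \<and> e = e'" using e01 t b lx by linarith
  with e show ?thesis by (elim disjE conjE) (simp_all, presburger)
qed

text \<open>Modulo 3 both 4 and -2 are 1, so \<open>p + lx\<close> is congruent to the column 4 Q +
  lx - 2 (R mod 2). Thus \<open>eq\<close> says that the columns agree modulo 3, and being at most 2
  apart they coincide. Rows behave in the same way, with \<open>ly\<close> as the residue of 3 R +
  ly.\<close>

lemma brick_position_same_fallback: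
  assumes pos: "brick_position a b R ly Q lx p" "brick_position a' b' R' ly Q' lx' p'"
    and close: "\<bar>a - a'\<bar> \<le> 2" "\<bar>b - b'\<bar> \<le> 2" and eq: "(p + lx) mod 3 = (p' + lx') mod 3"
  shows "R = R' \<and> Q = Q' \<and> lx = lx'"
proof -
  note le = brick_position_rounded[OF pos close]
  have "\<bar>a' - a\<bar> \<le> 2" "\<bar>b' - b\<bar> \<le> 2" using close by linarith+
  note ge = brick_position_rounded[OF pos(2,1) this]
  have l: "lx < 4" "lx' < 4" "p = (Q + R mod 2) mod 3" "p' = (Q' + R' mod 2) mod 3"
    using pos by (auto simp: brick_position_def)
  have R: "R = R'" using le(1) ge(1) by linarith
  define e where "e = R mod 2"
  have "4 * Q + lx \<le> 4 * Q' + lx' + 2" "4 * Q' + lx' \<le> 4 * Q + lx + 2" using le(2) ge(2) R by simp_all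
  moreover have "(Q + e + lx) mod 3 = (Q' + e + lx') mod 3"
    using eq unfolding l(3,4) R[symmetric] e_def[symmetric] by (simp add: mod_add_left_eq)
  then have "int (Q + e + lx) mod 3 = int (Q' + e + lx') mod 3"
    by (metis of_nat_mod of_nat_numeral)
  then obtain t where "int Q + int e + int lx = int Q' + int e + int lx' + 3 * t"
    by (metis mod_eqE of_nat_add)
  then have t: "4 * int Q + int lx = 4 * int Q' + int lx' + 3 * (int Q - int Q' + t)" by simp
  moreover define d where "d = int Q - int Q' + t"
  ultimately have "d = 0" unfolding d_def[symmetric] by linarith
  then have "4 * Q + lx = 4 * Q' + lx'" using t by (simp add: d_def)
  then have "Q = Q' \<and> lx = lx'" using l(1,2) by presburger
  with R show ?thesis by simp
qed

section \<open>Two-colouring a brick\<close>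

text \<open>\<open>X c u w\<close> is read as the clause that \<open>u\<close> and \<open>w\<close>
  do not both receive colour \<open>c\<close>. When \<open>X\<close> stays inside blocks, this looks
  only at the block of \<open>v\<close>, so a colouring of the whole graph can be inserted for
  \<open>\<tau>\<close>.\<close>

definition assigns ::
    "nat \<Rightarrow> (nat \<Rightarrow> nat \<Rightarrow> bool) \<Rightarrow> (nat \<Rightarrow> nat \<Rightarrow> nat \<Rightarrow> bool) \<Rightarrow> nat \<Rightarrow> (nat \<Rightarrow> nat) \<Rightarrow> bool" where
  "assigns n B X v \<tau> \<longleftrightarrow> (\<forall>u<n. B v u \<longrightarrow> \<tau> u \<in> {1, 2}) \<and>
     (\<forall>u<n. \<forall>w<n. B v u \<longrightarrow> X (\<tau> u) u w \<longrightarrow> \<tau> w \<noteq> \<tau> u)"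

text \<open>0 stands for unassigned. All clauses of an assigned vertex have been propagated, so it
  constrains no unassigned vertex; this is why such an assignment can be kept for good.\<close>

definition closed_assignment :: "nat \<Rightarrow> (nat \<Rightarrow> nat \<Rightarrow> nat \<Rightarrow> bool) \<Rightarrow> (nat \<Rightarrow> nat) \<Rightarrow> bool" where
  "closed_assignment n X f \<longleftrightarrow> (\<forall>u<n. f u \<le> 2) \<and>
     (\<forall>u<n. \<forall>w<n. f u \<noteq> 0 \<longrightarrow> X (f u) u w \<longrightarrow> f w = 3 - f u)"

lemma closed_assignmentD:
  "closed_assignment n X f \<Longrightarrow> u < n \<Longrightarrow> f u \<le> 2"
  "closed_assignment n X f \<Longrightarrow> u < n \<Longrightarrow> w < n \<Longrightarrow> f u \<noteq> 0 \<Longrightarrow> X (f u) u w \<Longrightarrow> f w = 3 - f u"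
  unfolding closed_assignment_def by blast+

text \<open>Invariant of unit propagation from \<open>v\<close> with value \<open>c\<close>, starting from the closed partial
  assignment \<open>f0\<close>: \<open>q\<close> is the queue of length \<open>l\<close>, its first \<open>h\<close> entries are processed, and the
  next one has been compared with all vertices below \<open>j\<close>.\<close>

definition propagation ::
    "nat \<Rightarrow> (nat \<Rightarrow> nat \<Rightarrow> bool) \<Rightarrow> (nat \<Rightarrow> nat \<Rightarrow> nat \<Rightarrow> bool) \<Rightarrow> (nat \<Rightarrow> nat) \<Rightarrow> nat \<Rightarrow> nat \<Rightarrow> nat \<Rightarrow> nat \<Rightarrow>
     (nat \<Rightarrow> nat) \<Rightarrow> (nat \<Rightarrow> nat) \<Rightarrow> nat \<Rightarrow> nat \<Rightarrow> bool" where
  "propagation n B X f0 v c h j f q l conf \<longleftrightarrow>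
     h \<le> l \<and> 0 < l \<and> q 0 = v \<and> f v = c \<and> inj_on q {..<l} \<and>
     (\<forall>i<l. q i < n \<and> B v (q i) \<and> f0 (q i) = 0 \<and> f (q i) \<in> {1, 2}) \<and>
     (\<forall>u. u \<notin> q ` {..<l} \<longrightarrow> f u = f0 u) \<and>
     (\<forall>\<tau>. assigns n B X v \<tau> \<longrightarrow> \<tau> v = c \<longrightarrow> (\<forall>i<l. \<tau> (q i) = f (q i)) \<and> conf = 0) \<and>
     (conf = 0 \<longrightarrow> (\<forall>i<l. \<forall>w<n. i < h \<or> i = h \<and> w < j \<longrightarrow> X (f (q i)) (q i) w \<longrightarrow>
        f w = 3 - f (q i)))"

lemma propagationI:
  assumes "h \<le> l" "0 < l" "q 0 = v" "f v = c" "inj_on q {..<l}"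
    and "\<And>i. i < l \<Longrightarrow> q i < n \<and> B v (q i) \<and> f0 (q i) = 0 \<and> f (q i) \<in> {1, 2}"
    and "\<And>u. u \<notin> q ` {..<l} \<Longrightarrow> f u = f0 u"
    and "\<And>\<tau>. assigns n B X v \<tau> \<Longrightarrow> \<tau> v = c \<Longrightarrow> (\<forall>i<l. \<tau> (q i) = f (q i)) \<and> conf = 0"
    and "\<And>i w. conf = 0 \<Longrightarrow> i < l \<Longrightarrow> w < n \<Longrightarrow> i < h \<or> i = h \<and> w < j \<Longrightarrow>
      X (f (q i)) (q i) w \<Longrightarrow> f w = 3 - f (q i)"
  shows "propagation n B X f0 v c h j f q l conf"
proof -
  have "\<forall>i<l. q i < n \<and> B v (q i) \<and> f0 (q i) = 0 \<and> f (q i) \<in> {1, 2}"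
    by (intro allI impI) (rule assms(6))
  moreover have "\<forall>u. u \<notin> q ` {..<l} \<longrightarrow> f u = f0 u" by (intro allI impI) (rule assms(7))
  moreover have "\<forall>\<tau>. assigns n B X v \<tau> \<longrightarrow> \<tau> v = c \<longrightarrow> (\<forall>i<l. \<tau> (q i) = f (q i)) \<and> conf = 0"
    by (intro allI impI) (rule assms(8))
  moreover have "conf = 0 \<longrightarrow> (\<forall>i<l. \<forall>w<n. i < h \<or> i = h \<and> w < j \<longrightarrow> X (f (q i)) (q i) w \<longrightarrow>
      f w = 3 - f (q i))"
    by (intro allI impI) (rule assms(9))
  ultimately show ?thesis unfolding propagation_def using assms(1-5) by (intro conjI)
qed

lemma propagationD:
  assumes "propagation n B X f0 v c h j f q l conf"
  shows "h \<le> l" "0 < l" "q 0 = v" "f v = c" "inj_on q {..<l}"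
    and "\<And>i. i < l \<Longrightarrow> q i < n \<and> B v (q i) \<and> f0 (q i) = 0 \<and> f (q i) \<in> {1, 2}"
    and "\<And>u. u \<notin> q ` {..<l} \<Longrightarrow> f u = f0 u"
    and "\<And>\<tau>. assigns n B X v \<tau> \<Longrightarrow> \<tau> v = c \<Longrightarrow> (\<forall>i<l. \<tau> (q i) = f (q i)) \<and> conf = 0"
    and "\<And>i w. conf = 0 \<Longrightarrow> i < l \<Longrightarrow> w < n \<Longrightarrow> i < h \<or> i = h \<and> w < j \<Longrightarrow>
      X (f (q i)) (q i) w \<Longrightarrow> f w = 3 - f (q i)"
proof -
  note inv = assms[unfolded propagation_def]
  show "h \<le> l" "0 < l" "q 0 = v" "f v = c" "inj_on q {..<l}" using inv by simp_all
  have "\<forall>i<l. q i < n \<and> B v (q i) \<and> f0 (q i) = 0 \<and> f (q i) \<in> {1, 2}"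
    using inv by (elim conjE)
  then show "q i < n \<and> B v (q i) \<and> f0 (q i) = 0 \<and> f (q i) \<in> {1, 2}" if "i < l" for i
    using that by simp
  have "\<forall>u. u \<notin> q ` {..<l} \<longrightarrow> f u = f0 u" using inv by (elim conjE)
  then show "f u = f0 u" if "u \<notin> q ` {..<l}" for u using that by simp
  have "\<forall>\<tau>. assigns n B X v \<tau> \<longrightarrow> \<tau> v = c \<longrightarrow> (\<forall>i<l. \<tau> (q i) = f (q i)) \<and> conf = 0"
    using inv by (elim conjE)
  then show "(\<forall>i<l. \<tau> (q i) = f (q i)) \<and> conf = 0" if "assigns n B X v \<tau>" "\<tau> v = c" for \<tau>
    using that by blast
  have "conf = 0 \<longrightarrow> (\<forall>i<l. \<forall>w<n. i < h \<or> i = h \<and> w < j \<longrightarrow> X (f (q i)) (q i) w \<longrightarrow>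
      f w = 3 - f (q i))"
    using inv by (elim conjE)
  then show "f w = 3 - f (q i)" if "conf = 0" "i < l" "w < n" "i < h \<or> i = h \<and> w < j" "X (f (q i)) (q i) w" for i w
    using that by (elim allE[of _ i] allE[of _ w] impE)
qed

section \<open>Unit propagation for clauses on pairs\<close>

locale conflict_relation =
  fixes n :: nat and B :: "nat \<Rightarrow> nat \<Rightarrow> bool" and X :: "nat \<Rightarrow> nat \<Rightarrow> nat \<Rightarrow> bool"
  assumes B_refl: "B u u" and B_sym: "B u w \<Longrightarrow> B w u" and B_trans: "B u w \<Longrightarrow> B w z \<Longrightarrow> B u z"
    and X_B: "X c u w \<Longrightarrow> B u w" and X_sym: "X c u w \<Longrightarrow> X c w u"
begin

lemma assigns_cong: "B v u \<Longrightarrow> assigns n B X v \<tau> \<longleftrightarrow> assigns n B X u \<tau>"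
proof -
  assume "B v u"
  then have "B v z \<longleftrightarrow> B u z" for z using B_sym B_trans by blast
  then show ?thesis by (simp add: assigns_def)
qed

lemma propagation_init:
  assumes "v < n" "f0 v = 0" "c \<in> {1, 2}"
  shows "propagation n B X f0 v c 0 0 (f0(v := c)) (q(0 := v)) 1 0"
proof -
  have "inj_on (q(0 := v)) {..<1}" "(q(0 := v)) ` {..<1} = {v}" by (auto simp: inj_on_def)
  then show ?thesis using assms by (intro propagationI) (simp_all add: B_refl)
qed

text \<open>The delicate case is a violated clause. It has to refute the start value
  \<open>c\<close> itself, without blaming the earlier choices in \<open>f0\<close>. This works
  because both of its ends lie in the queue, so both values are consequences of
  \<open>c\<close>.\<close>

lemma propagation_step:
  assumes inv: "propagation n B X f0 v c h j f q l conf" and h: "h < l" and j: "j < n"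
    and f0: "closed_assignment n X f0"
  shows "\<not> X (f (q h)) (q h) j \<Longrightarrow> propagation n B X f0 v c h (Suc j) f q l conf"
    and "X (f (q h)) (q h) j \<Longrightarrow> f j = f (q h) \<Longrightarrow> propagation n B X f0 v c h (Suc j) f q l 1"
    and "X (f (q h)) (q h) j \<Longrightarrow> f j \<noteq> f (q h) \<Longrightarrow> f j \<noteq> 0 \<Longrightarrow>
      propagation n B X f0 v c h (Suc j) f q l conf"
    and "X (f (q h)) (q h) j \<Longrightarrow> f j = 0 \<Longrightarrow>
      propagation n B X f0 v c h (Suc j) (f(j := 3 - f (q h))) (q(l := j)) (Suc l) conf"
proof -
  let ?u = "q h"
  note hl = propagationD(1-4)[OF inv] and inj = propagationD(5)[OF inv] and mem = propagationD(6)[OF inv]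
    and out = propagationD(7)[OF inv] and forced = propagationD(8)[OF inv]
    and finished = propagationD(9)[OF inv]
  note u = mem[OF h]
  show "propagation n B X f0 v c h (Suc j) f q l conf" if "\<not> X (f ?u) ?u j"
  proof (rule propagationI)
    fix i w assume "conf = 0" "i < l" "w < n" "i < h \<or> i = h \<and> w < Suc j" "X (f (q i)) (q i) w"
    moreover from this that have "i < h \<or> i = h \<and> w < j" by (auto simp: less_Suc_eq)
    ultimately show "f w = 3 - f (q i)" by (intro finished)
  qed (fact hl inj mem out forced)+
  have f_le: "f w \<in> {0, 1, 2}" if "w < n" for w
  proof (cases "w \<in> q ` {..<l}")
    case False
    then show ?thesis using out closed_assignmentD(1)[OF f0 that] by auto
  qed (use mem in auto)
  show "propagation n B X f0 v c h (Suc j) f q l conf"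
    if "X (f ?u) ?u j" "f j \<noteq> f ?u" "f j \<noteq> 0"
  proof -
    have fj: "f j = 3 - f ?u" using that u f_le[OF j] by auto
    show ?thesis
    proof (rule propagationI)
      fix i w assume *: "conf = 0" "i < l" "w < n" "i < h \<or> i = h \<and> w < Suc j" "X (f (q i)) (q i) w"
      show "f w = 3 - f (q i)"
      proof (cases "i = h \<and> w = j")
        case False
        then have "i < h \<or> i = h \<and> w < j" using *(4) by auto
        then show ?thesis using * by (intro finished)
      qed (use fj in simp)
    qed (fact hl inj mem out forced)+
  qed
  show "propagation n B X f0 v c h (Suc j) f q l 1" if X: "X (f ?u) ?u j" and eq: "f j = f ?u"
  proof -
    \<comment> \<open>If \<open>j\<close> carried an old value, closedness of \<open>f0\<close> and
      symmetry of the clauses would have assigned \<open>q h\<close> as well, but queued vertices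
      are unassigned in \<open>f0\<close>.\<close>
    have "j \<in> q ` {..<l}"
    proof (rule ccontr)
      assume "j \<notin> q ` {..<l}"
      then have fj: "f0 j = f j" using out by simp
      then have "f0 ?u = 3 - f0 j"
        using closed_assignmentD(2)[OF f0 j, of ?u] X_sym[OF X] eq u by auto
      then show False using fj eq u by auto
    qed
    then obtain i where i: "i < l" "j = q i" by auto
    have False if "assigns n B X v \<tau>" "\<tau> v = c" for \<tau>
    proof -
      have "\<tau> ?u = f ?u" "\<tau> j = f j" using forced[OF that] h i by auto
      then show False using that(1) X eq u j unfolding assigns_def by metis
    qed
    then have no: "(\<forall>i<l. \<tau> (q i) = f (q i)) \<and> 1 = (0::nat)" if "assigns n B X v \<tau>" "\<tau> v = c" for \<tau>
      using that by blast
    show ?thesis by (rule propagationI) (fact hl inj mem out no | simp)+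
  qed
  show "propagation n B X f0 v c h (Suc j) (f(j := 3 - f ?u)) (q(l := j)) (Suc l) conf"
    if X: "X (f ?u) ?u j" and fj: "f j = 0"
  proof -
    have jq: "j \<notin> q ` {..<l}" using fj mem by fastforce
    then have ne: "q i \<noteq> j" if "i < l" for i using that by auto
    have f0j: "f0 j = 0" using out[OF jq] fj by simp
    have Bj: "B v j" using B_trans X_B[OF X] u by blast
    have vj: "v \<noteq> j" using ne[OF hl(2)] hl(3) by simp
    have forced': "(\<forall>i<Suc l. \<tau> ((q(l := j)) i) = (f(j := 3 - f ?u)) ((q(l := j)) i)) \<and> conf = 0"
      if "assigns n B X v \<tau>" "\<tau> v = c" for \<tau>
    proof -
      have "\<tau> ?u = f ?u" using forced[OF that] h by auto
      then have "\<tau> j \<noteq> f ?u" using that(1) X u j unfolding assigns_def by metis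
      moreover have "\<tau> j \<in> {1, 2}" using that(1) j Bj unfolding assigns_def by blast
      ultimately have "\<tau> j = 3 - f ?u" using u by auto
      then show ?thesis using forced[OF that] ne by (auto simp: less_Suc_eq)
    qed
    have finished': "(f(j := 3 - f ?u)) w = 3 - (f(j := 3 - f ?u)) ((q(l := j)) i)"
      if "conf = 0" "i < Suc l" "w < n" "i < h \<or> i = h \<and> w < Suc j"
        "X ((f(j := 3 - f ?u)) ((q(l := j)) i)) ((q(l := j)) i) w" for i w
    proof -
      have i: "i < l" using that(4) h by auto
      then have X': "X (f (q i)) (q i) w" using that(5) ne[OF i] by simp
      have "f w = 3 - f (q i)" if "w \<noteq> j"
        using finished[OF \<open>conf = 0\<close> i \<open>w < n\<close> _ X'] that \<open>i < h \<or> i = h \<and> w < Suc j\<close>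
        by (auto simp: less_Suc_eq)
      \<comment> \<open>An entry before \<open>h\<close> has been compared with every vertex, so a
        clause between it and \<open>j\<close> would already have given \<open>j\<close> a nonzero
        value.\<close>
      moreover have "i = h" if "w = j"
      proof (rule ccontr)
        assume "i \<noteq> h"
        then have "i < h" using \<open>i < h \<or> i = h \<and> w < Suc j\<close> by simp
        then have "f j = 3 - f (q i)" using finished[OF \<open>conf = 0\<close> i \<open>w < n\<close> _ X'] that by simp
        then show False using fj mem[OF i] by auto
      qed
      ultimately show ?thesis using i ne[OF i] by auto
    qed
    have 1: "inj_on (q(l := j)) {..<Suc l}"
      using inj jq by (auto simp: inj_on_def less_Suc_eq)
    have 2: "(q(l := j)) i < n \<and> B v ((q(l := j)) i) \<and> f0 ((q(l := j)) i) = 0 \<and>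
        (f(j := 3 - f ?u)) ((q(l := j)) i) \<in> {1, 2}" if "i < Suc l" for i
    proof (cases "i = l")
      case True
      then show ?thesis using j Bj f0j u by auto
    next
      case False
      then have "i < l" using that by simp
      then show ?thesis using mem[of i] ne[of i] by simp
    qed
    have 3: "(f(j := 3 - f ?u)) z = f0 z" if "z \<notin> (q(l := j)) ` {..<Suc l}" for z
    proof -
      have "z \<noteq> j" "z \<notin> q ` {..<l}" using that by (auto simp: image_iff)
      then show ?thesis using out by simp
    qed
    have 4: "(q(l := j)) 0 = v" "(f(j := 3 - f ?u)) v = c" using hl vj by auto
    have 5: "h \<le> Suc l" "0 < Suc l" using hl by auto
    show ?thesis by (rule propagationI) (fact 1 2 3 4 5 forced' finished')+
  qed
qed

lemma propagation_next:
  assumes "propagation n B X f0 v c h n f q l conf" "h < l"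
  shows "propagation n B X f0 v c (Suc h) 0 f q l conf"
proof -
  have "f w = 3 - f (q i)"
    if "conf = 0" "i < l" "w < n" "i < Suc h \<or> i = Suc h \<and> w < 0" "X (f (q i)) (q i) w" for i w
  proof -
    have "i < h \<or> i = h \<and> w < n" using that by auto
    then show ?thesis using that by (intro propagationD(9)[OF assms(1)])
  qed
  moreover have "Suc h \<le> l" using assms(2) by simp
  ultimately show ?thesis using propagationD(2-8)[OF assms(1)] by (intro propagationI)
qed

text \<open>Only vertices unassigned in \<open>f0\<close> enter the queue, so old values survive. An
  old clause cannot reach into the queue, since closedness of \<open>f0\<close> has assigned both of
  its ends.\<close>

lemma propagation_final:
  assumes inv: "propagation n B X f0 v c l 0 f q l 0" and f0: "closed_assignment n X f0"
  shows "closed_assignment n X f" "f v = c" "\<And>u. f0 u \<noteq> 0 \<Longrightarrow> f u = f0 u"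
proof -
  note mem = propagationD(6)[OF inv] and out = propagationD(7)[OF inv]
  have finished: "f w = 3 - f (q i)" if "i < l" "w < n" "X (f (q i)) (q i) w" for i w
    using propagationD(9)[OF inv _ that(1,2) _ that(3)] that(1) by simp
  show "f v = c" by (rule propagationD(4)[OF inv])
  show keep: "f u = f0 u" if "f0 u \<noteq> 0" for u using that out[of u] mem by force
  show "closed_assignment n X f" unfolding closed_assignment_def
  proof (intro conjI allI impI)
    fix u assume u: "u < n"
    show "f u \<le> 2"
    proof (cases "u \<in> q ` {..<l}")
      case True
      then obtain i where "i < l" "u = q i" by blast
      then show ?thesis using mem[of i] by auto
    qed (use out[of u] closed_assignmentD(1)[OF f0 u] in simp)
    fix w assume w: "w < n" and fu: "f u \<noteq> 0" and X: "X (f u) u w"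
    show "f w = 3 - f u"
    proof (cases "u \<in> q ` {..<l}")
      case True
      then obtain i where "i < l" "u = q i" by blast
      then show ?thesis using finished[OF _ w, of i] X by simp
    next
      case False
      then have fu0: "f u = f0 u" by (rule out)
      then have "f0 w = 3 - f0 u" using closed_assignmentD(2)[OF f0 u w] fu X by simp
      moreover have "3 - f0 u \<noteq> 0" using closed_assignmentD(1)[OF f0 u] by simp
      ultimately show ?thesis using keep fu0 by metis
    qed
  qed
qed

text \<open>The queue is free of repetitions and stays in the block of \<open>v\<close>. With one
  pass over all vertices per entry, propagation costs \<open>n\<close> times the block size.\<close>

lemma propagation_length:
  assumes "propagation n B X f0 v c h j f q l conf"
  shows "l \<le> card {u. u < n \<and> B v u}"
proof -
  have "card (q ` {..<l}) = l" using propagationD(5)[OF assms] by (simp add: card_image)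
  moreover have "q ` {..<l} \<subseteq> {u. u < n \<and> B v u}" using propagationD(6)[OF assms] by blast
  ultimately show ?thesis by (metis card_mono finite_Collect_conjI finite_Collect_less_nat)
qed

text \<open>\<open>\<tau>\<close> is not assumed to agree with \<open>f0\<close>. Hence a vertex
  that fails with both colours refutes its whole block, and no earlier choice has to be
  revised.\<close>

lemma propagation_conflict:
  assumes "propagation n B X f0 v c h j f q l conf" "conf \<noteq> 0" "assigns n B X v \<tau>"
  shows "\<tau> v \<noteq> c"
  using propagationD(8)[OF assms(1,3)] assms(2) by blast

lemma propagation_undo:
  assumes "propagation n B X f0 v c h j f q l conf"
  shows "(\<lambda>u. if u \<in> q ` {..<l} then 0 else f u) = f0"
proof
  fix u
  have "\<forall>i<l. f0 (q i) = 0" "u \<notin> q ` {..<l} \<longrightarrow> f u = f0 u" using propagationD(6,7)[OF assms] by blast+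
  then show "(if u \<in> q ` {..<l} then 0 else f u) = f0 u" by auto
qed

end

text \<open>If \<open>u\<close> and \<open>w\<close> both had colour \<open>c\<close>, a correct
  guess \<open>g\<close> would give their cells the same representative exactly when they are
  adjacent. Where this fails, the pair must not share colour \<open>c\<close>.\<close>

definition mismatch ::
    "('v \<Rightarrow> 'v \<Rightarrow> bool) \<Rightarrow> ('v \<Rightarrow> 'v \<Rightarrow> bool) \<Rightarrow> ('v \<Rightarrow> nat) \<Rightarrow> (nat \<Rightarrow> nat) \<Rightarrow> nat \<Rightarrow> 'v \<Rightarrow> 'v \<Rightarrow> bool" where
  "mismatch A B cell g c u w \<longleftrightarrow> B u w \<and> (g (cell u + c) = g (cell w + c)) \<noteq> A u w"

text \<open>\<open>g\<close> maps a cell (coded by a multiple of 3) and a colour to the least cell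
  whose vertices of that colour lie in the same clique.\<close>

lemma guess_exists:
  fixes A B :: "nat \<Rightarrow> nat \<Rightarrow> bool" and cell \<tau> :: "nat \<Rightarrow> nat"
  assumes A: "\<And>u. A u u" "\<And>u w. A u w \<Longrightarrow> A w u"
    and B: "\<And>u. B u u" "\<And>u w. B u w \<Longrightarrow> B w u" "\<And>u w z. B u w \<Longrightarrow> B w z \<Longrightarrow> B u z"
    and cell: "\<And>u. B v u \<Longrightarrow> u < n \<Longrightarrow> cell u < 36 \<and> 3 dvd cell u"
    and clique: "\<And>u w. B v u \<Longrightarrow> B v w \<Longrightarrow> u < n \<Longrightarrow> w < n \<Longrightarrow> cell u = cell w \<Longrightarrow> A u w"
    and \<tau>: "clustered A {..<n} \<tau>" "\<And>u. u < n \<Longrightarrow> \<tau> u \<in> {1, 2}"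
  obtains gs where "length gs = 36" "set gs \<subseteq> {..<36}"
    "\<And>g. (\<forall>i<36. g i = gs ! i) \<Longrightarrow> assigns n B (mismatch A B cell g) v \<tau>"
proof -
  define P where "P k c l \<longleftrightarrow> (\<exists>u w. u < n \<and> w < n \<and> B v u \<and> B v w \<and> \<tau> u = c \<and> \<tau> w = c \<and>
    cell u = k \<and> cell w = l \<and> A u w)" for k c l
  \<comment> \<open>An index splits into its residue modulo 3, the colour, and the multiple of 3
    below it, the cell. The default 0 keeps the table below 36 where a cell has no vertex of that
    colour.\<close>
  define G where "G i = (if \<exists>l. P (i - i mod 3) (i mod 3) l then LEAST l. P (i - i mod 3) (i mod 3) l else 0)" for i
  have tr: "A a c" if "A a b" "A b c" "\<tau> a = \<tau> b" "\<tau> b = \<tau> c" "a < n" "b < n" "c < n" for a b c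
    using clusteredD[OF \<tau>(1), of a b c] that by simp
  \<comment> \<open>Any vertex can replace the witness of its own cell and colour: the same cell
    gives adjacency, the same colour gives transitivity.\<close>
  have P_iff: "P (cell u) (\<tau> u) l \<longleftrightarrow> (\<exists>w<n. B v w \<and> \<tau> w = \<tau> u \<and> cell w = l \<and> A u w)"
    if u: "u < n" "B v u" for u l
  proof
    assume "P (cell u) (\<tau> u) l"
    then obtain u' w where *: "u' < n" "w < n" "B v u'" "B v w" "\<tau> u' = \<tau> u" "\<tau> w = \<tau> u"
        "cell u' = cell u" "cell w = l" "A u' w"
      unfolding P_def by auto
    have "A u u'" using clique u * by metis
    then have "A u w" using tr[of u u' w] * u by simp
    then show "\<exists>w<n. B v w \<and> \<tau> w = \<tau> u \<and> cell w = l \<and> A u w" using * by blast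
  qed (use u in \<open>auto simp: P_def\<close>)
  have G_eq: "G (cell u + \<tau> u) = (LEAST l. P (cell u) (\<tau> u) l)" and P_cell: "P (cell u) (\<tau> u) (cell u)"
    if u: "u < n" "B v u" for u
  proof -
    show P: "P (cell u) (\<tau> u) (cell u)" using P_iff[OF u] u A(1) by blast
    have "3 dvd cell u" "\<tau> u < 3" using \<tau>(2)[OF u(1)] cell[OF u(2,1)] by auto
    then have "(cell u + \<tau> u) mod 3 = \<tau> u" by presburger
    moreover have "cell u + \<tau> u - \<tau> u = cell u" by simp
    moreover have "\<exists>l. P (cell u) (\<tau> u) l" using P by blast
    ultimately show "G (cell u + \<tau> u) = (LEAST l. P (cell u) (\<tau> u) l)" unfolding G_def by presburger
  qed
  \<comment> \<open>Adjacent vertices of one colour reach the same cells, so the least ones agree.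
    Conversely the common least cell contains a neighbour \<open>z\<close> of \<open>u\<close> and a
    neighbour \<open>z'\<close> of \<open>w\<close>; these are adjacent as members of one cell, and
    transitivity runs along u, z, z', w.\<close>
  have G_iff: "G (cell u + \<tau> u) = G (cell w + \<tau> w) \<longleftrightarrow> A u w"
    if u: "u < n" "B v u" and w: "w < n" "B v w" and eq: "\<tau> u = \<tau> w" for u w
  proof
    assume "A u w"
    then have "P (cell u) (\<tau> u) l \<longleftrightarrow> P (cell w) (\<tau> w) l" for l
      unfolding P_iff[OF u] P_iff[OF w] using tr[of u w] tr[of w u] A(2) eq u w by metis
    then have "P (cell u) (\<tau> u) = P (cell w) (\<tau> w)" by (rule ext)
    then show "G (cell u + \<tau> u) = G (cell w + \<tau> w)" unfolding G_eq[OF u] G_eq[OF w] by simp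
  next
    assume "G (cell u + \<tau> u) = G (cell w + \<tau> w)"
    moreover have "P (cell u) (\<tau> u) (G (cell u + \<tau> u))" "P (cell w) (\<tau> w) (G (cell w + \<tau> w))"
      unfolding G_eq[OF u] G_eq[OF w] using LeastI[of "P (cell u) (\<tau> u)", OF P_cell[OF u]]
        LeastI[of "P (cell w) (\<tau> w)", OF P_cell[OF w]] by simp_all
    ultimately obtain z z' where "z < n" "B v z" "\<tau> z = \<tau> u" "A u z" "z' < n" "B v z'" "\<tau> z' = \<tau> w"
        "A w z'" "cell z = cell z'"
      unfolding P_iff[OF u] P_iff[OF w] by metis
    moreover from this have "A z z'" using clique by blast
    ultimately show "A u w" using tr[of u z z'] tr[of u z' w] A(2) eq u w by metis
  qed
  define gs where "gs = map G [0..<36]"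
  have "G i < 36" for i
  proof (cases "\<exists>l. P (i - i mod 3) (i mod 3) l")
    case True
    then have "P (i - i mod 3) (i mod 3) (G i)" unfolding G_def by (simp add: LeastI_ex)
    then show ?thesis using cell unfolding P_def by metis
  qed (auto simp: G_def)
  then have "set gs \<subseteq> {..<36}" by (auto simp: gs_def)
  moreover have "assigns n B (mismatch A B cell g) v \<tau>" if g: "\<forall>i<36. g i = gs ! i" for g
    unfolding assigns_def
  proof (intro conjI allI impI)
    fix u assume u: "u < n" "B v u"
    show "\<tau> u \<in> {1, 2}" using \<tau>(2) u by blast
    fix w assume w: "w < n" and X: "mismatch A B cell g (\<tau> u) u w"
    then have Bw: "B v w" using u B(3) unfolding mismatch_def by blast
    have idx: "cell z + \<tau> z < 36" if "z < n" "B v z" for z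
      using cell[OF that(2,1)] \<tau>(2)[OF that(1)] by (auto elim!: dvdE)
    show "\<tau> w \<noteq> \<tau> u"
    proof
      assume eq: "\<tau> w = \<tau> u"
      then have "g (cell u + \<tau> u) = G (cell u + \<tau> u)" "g (cell w + \<tau> u) = G (cell w + \<tau> w)"
        using g idx[OF u] idx[OF w Bw] by (auto simp: gs_def)
      then show False using X G_iff[OF u w Bw] eq unfolding mismatch_def by simp
    qed
  qed
  ultimately show ?thesis using that[of gs] by (simp add: gs_def)
qed

text \<open>Cauchy-Schwarz: a class split by \<open>g\<close> into parts of sizes
  \<open>N a i\<close> contributes the square of their sum, which is at most \<open>k\<close> times
  the sum of their squares.\<close>

lemma card_pairs_refinement:
  fixes f :: "'v \<Rightarrow> 'a" and g :: "'v \<Rightarrow> nat"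
  assumes S: "finite S" and g: "\<And>v. v \<in> S \<Longrightarrow> g v < k"
  shows "card {(u, w). u \<in> S \<and> w \<in> S \<and> f u = f w} \<le>
    k * card {(u, w). u \<in> S \<and> w \<in> S \<and> f u = f w \<and> g u = g w}"
proof -
  define N where "N a i = card {v \<in> S. f v = a \<and> g v = i}" for a i
  have total: "card {v \<in> S. f v = a} = (\<Sum>i<k. N a i)" for a
  proof -
    have "{v \<in> S. f v = a} = (\<Union>i<k. {v \<in> S. f v = a \<and> g v = i})" using g by auto
    then show ?thesis unfolding N_def by (simp only:) (rule card_UN_disjoint; use S in auto)
  qed
  have "{(u, w). u \<in> S \<and> w \<in> S \<and> f u = f w} = (\<Union>a\<in>f ` S. {v \<in> S. f v = a} \<times> {v \<in> S. f v = a})"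
    by auto
  then have 1: "card {(u, w). u \<in> S \<and> w \<in> S \<and> f u = f w} = (\<Sum>a\<in>f ` S. (\<Sum>i<k. N a i)\<^sup>2)"
    by (simp only:) (subst card_UN_disjoint; use S in \<open>auto simp: total[symmetric] card_cartesian_product power2_eq_square\<close>)
  have "{(u, w). u \<in> S \<and> w \<in> S \<and> f u = f w \<and> g u = g w} =
      (\<Union>(a, i)\<in>f ` S \<times> {..<k}. {v \<in> S. f v = a \<and> g v = i} \<times> {v \<in> S. f v = a \<and> g v = i})"
    using g by auto
  then have 2: "card {(u, w). u \<in> S \<and> w \<in> S \<and> f u = f w \<and> g u = g w} = (\<Sum>(a, i)\<in>f ` S \<times> {..<k}. (N a i)\<^sup>2)"
    by (simp only:) (subst card_UN_disjoint;
      use S in \<open>auto simp: N_def card_cartesian_product power2_eq_square intro!: sum.cong\<close>)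
  have "(\<Sum>i<k. N a i)\<^sup>2 \<le> k * (\<Sum>i<k. (N a i)\<^sup>2)" for a
  proof -
    have "(\<Sum>i<k. real (N a i))\<^sup>2 \<le> (\<Sum>i<k. (real (N a i))\<^sup>2) * real (card {..<k})"
      by (rule sum_squared_le_sum_of_squares)
    then have "real ((\<Sum>i<k. N a i)\<^sup>2) \<le> real (k * (\<Sum>i<k. (N a i)\<^sup>2))" by (simp add: mult.commute)
    then show ?thesis by (simp only: of_nat_le_iff)
  qed
  then show ?thesis unfolding 1 2 by (simp add: sum.cartesian_product[symmetric] sum_distrib_left sum_mono)
qed

section \<open>Connected components\<close>

definition NEq :: "nexp \<Rightarrow> nexp \<Rightarrow> bexp" where
  "NEq e f = BAnd (BNot (NLess e f)) (BNot (NLess f e))"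

definition BXor :: "bexp \<Rightarrow> bexp \<Rightarrow> bexp" where
  "BXor b d = BAnd (BNot (BAnd b d)) (BNot (BAnd (BNot b) (BNot d)))"

definition Near :: "nexp \<Rightarrow> nexp \<Rightarrow> bexp" where
  "Near e f = BNot (RLess (RLit 1) (RAdd
     (RMul (RSub (RGet ''x'' e) (RGet ''x'' f)) (RSub (RGet ''x'' e) (RGet ''x'' f)))
     (RMul (RSub (RGet ''y'' e) (RGet ''y'' f)) (RSub (RGet ''y'' e) (RGet ''y'' f)))))"

lemma bval_NEq [simp]: "bval (NEq e f) s \<longleftrightarrow> nval e s = nval f s"
  by (auto simp: NEq_def)

lemma bval_BXor [simp]: "bval (BXor b d) s \<longleftrightarrow> bval b s \<noteq> bval d s"
  by (auto simp: BXor_def)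

definition has_input :: "nat \<Rightarrow> (nat \<times> nat) list \<Rightarrow> (nat \<Rightarrow> real \<times> real) \<Rightarrow> state \<Rightarrow> bool" where
  "has_input n es center s \<longleftrightarrow> nats s ''n'' 0 = n \<and> nats s ''m'' 0 = length es \<and>
     (\<forall>i<length es. nats s ''src'' i = fst (es ! i) \<and> nats s ''dst'' i = snd (es ! i)) \<and>
     (\<forall>v<n. reals s ''x'' v = fst (center v) \<and> reals s ''y'' v = snd (center v))"

lemma has_input_frame:
  assumes "has_input n es center s" "frame M s s'" "M \<inter> {''n'', ''m'', ''src'', ''dst'', ''x'', ''y''} = {}"
  shows "has_input n es center s'"
  using assms by (auto simp: has_input_def frame_def)

lemma bval_Near:
  assumes "has_input n es center s" "nval e s < n" "nval f s < n"
  shows "bval (Near e f) s \<longleftrightarrow> near center (nval e s) (nval f s)"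
  using assms by (simp add: Near_def near_iff has_input_def power2_eq_square not_less)

text \<open>Natural numbers cannot be converted to reals on the machine, so a real copy
  \<open>N\<close> of the vertex count is accumulated; it later shifts all offsets into the
  nonnegative range.\<close>

definition init_step :: com where
  "init_step = Seq (NSet ''lab'' (scalar ''v'') (scalar ''v''))
     (RSet ''N'' (NLit 0) (RAdd (RGet ''N'' (NLit 0)) (RLit 1)))"

definition init_labels :: com where
  "init_labels = For ''v'' ''n'' init_step"

lemma runs_init_labels:
  assumes "nats s ''n'' 0 = n" "reals s ''N'' 0 = 0"
  shows "runs init_labels s (9 + n * (12 + max_cost init_step))
    (\<lambda>s'. (\<forall>v<n. nats s' ''lab'' v = v) \<and> reals s' ''N'' 0 = real n)"
  unfolding init_labels_def
proof (rule runs_conseq[OF runs_For[where N = n and T = "\<lambda>_. max_cost init_step"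
      and I = "\<lambda>k s'. (\<forall>v<k. nats s' ''lab'' v = v) \<and> reals s' ''N'' 0 = real k"]])
  fix k and s' :: state
  assume "nats s' ''v'' 0 = k" "(\<forall>v<k. nats s' ''lab'' v = v) \<and> reals s' ''N'' 0 = real k"
  then show "runs init_step s' (max_cost init_step)
      (\<lambda>s'. (\<forall>v<Suc k. nats s' ''lab'' v = v) \<and> reals s' ''N'' 0 = real (Suc k))"
    by (intro runs_loop_freeI) (auto simp: init_step_def update_simps less_Suc_eq)
qed (use assms in \<open>auto simp: frame_def init_step_def\<close>)

text \<open>\<open>k\<close> is the progress of the relabelling loop; \<open>k = n\<close> is the
  complete merge of class \<open>q\<close> into class \<open>p\<close>.\<close>

definition merge_labels :: "nat \<Rightarrow> nat \<Rightarrow> nat \<Rightarrow> (nat \<Rightarrow> nat) \<Rightarrow> nat \<Rightarrow> nat" where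
  "merge_labels k p q lab z = (if z < k \<and> lab z = q then p else lab z)"

text \<open>Idempotence makes each label a member of its class, so it can serve as reference vertex.
  The distance bound by the class size replaces any talk of paths.\<close>

definition component_labels :: "nat \<Rightarrow> (nat \<Rightarrow> real \<times> real) \<Rightarrow> (nat \<Rightarrow> nat) \<Rightarrow> bool" where
  "component_labels n center lab \<longleftrightarrow> (\<forall>v<n. lab v < n \<and> lab (lab v) = lab v) \<and>
     (\<forall>u<n. \<forall>w<n. lab u = lab w \<longrightarrow> dist (center u) (center w) + 1 \<le> card {z. z < n \<and> lab z = lab u})"

lemma component_labels_init:
  assumes "\<And>v. v < n \<Longrightarrow> lab v = v"
  shows "component_labels n center lab"
proof -
  have "{z. z < n \<and> lab z = u} = {u}" if "u < n" for u using that assms by auto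
  then show ?thesis by (auto simp: component_labels_def assms)
qed

lemma component_labels_merge:
  assumes lab: "component_labels n center lab" and ab: "a < n" "b < n" "near center a b"
  shows "component_labels n center (merge_labels n (lab a) (lab b) lab)"
proof (cases "lab a = lab b")
  case True
  then have "merge_labels n (lab a) (lab b) lab = lab" by (auto simp: merge_labels_def)
  then show ?thesis using lab by simp
next
  case False
  let ?l = "merge_labels n (lab a) (lab b) lab" and ?S = "\<lambda>l. {z. z < n \<and> lab z = l}"
  have l: "?l z = (if lab z = lab b then lab a else lab z)" if "z < n" for z
    using that by (simp add: merge_labels_def)
  have idem: "\<And>v. v < n \<Longrightarrow> lab v < n" "\<And>v. v < n \<Longrightarrow> lab (lab v) = lab v"
    and D: "\<And>u w. u < n \<Longrightarrow> w < n \<Longrightarrow> lab u = lab w \<Longrightarrow> dist (center u) (center w) + 1 \<le> card (?S (lab u))"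
    using lab unfolding component_labels_def by blast+
  have class_a: "card {z. z < n \<and> ?l z = lab a} = card (?S (lab a)) + card (?S (lab b))"
  proof -
    have "{z. z < n \<and> ?l z = lab a} = ?S (lab a) \<union> ?S (lab b)"
      unfolding merge_labels_def by auto
    moreover have "card (?S (lab a) \<union> ?S (lab b)) = card (?S (lab a)) + card (?S (lab b))"
      by (rule card_Un_disjoint) (use False in auto)
    ultimately show ?thesis by (rule arg_cong[THEN trans])
  qed
  have other: "{z. z < n \<and> ?l z = l'} = ?S l'" if "l' \<noteq> lab a" "l' \<noteq> lab b" for l'
    using that unfolding merge_labels_def by auto
  \<comment> \<open>The summand 1 pays for the merging edge of length at most 1: from d + 1 \<le> s
    and d' + 1 \<le> s' follows d + 1 + d' + 1 \<le> s + s'.\<close>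
  have cross: "dist (center u) (center w) + 1 \<le> real (card (?S (lab a)) + card (?S (lab b)))"
    if "u < n" "w < n" "lab u = lab a" "lab w = lab b" for u w
  proof -
    have "dist (center u) (center w) \<le> dist (center u) (center a) + dist (center a) (center b) + dist (center b) (center w)"
      using dist_triangle[of "center u" "center w" "center a"] dist_triangle[of "center a" "center w" "center b"]
      by linarith
    moreover have "dist (center a) (center b) \<le> 1" using ab by (simp add: near_def)
    ultimately show ?thesis using D[OF that(1) ab(1) that(3)] D[OF ab(2) that(2)] that by simp
  qed
  show ?thesis unfolding component_labels_def
  proof (intro conjI allI impI)
    fix v assume v: "v < n"
    show *: "?l v < n" unfolding l[OF v] using idem(1)[OF v] idem(1)[OF ab(1)] by simp
    show "?l (?l v) = ?l v"
    proof (cases "lab v = lab b")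
      case True
      then show ?thesis using l[OF v] l[OF *] idem(2)[OF ab(1)] by simp
    next
      case False
      then show ?thesis using l[OF v] l[OF *] idem(2)[OF v] by simp
    qed
  next
    fix u w assume uw: "u < n" "w < n" "?l u = ?l w"
    show "dist (center u) (center w) + 1 \<le> card {z. z < n \<and> ?l z = ?l u}"
    proof (cases "?l u = lab a")
      case True
      then have u: "lab u = lab a \<or> lab u = lab b" and w: "lab w = lab a \<or> lab w = lab b"
        using l[OF uw(1)] l[OF uw(2)] uw(3) by (auto split: if_splits)
      have "dist (center u) (center w) + 1 \<le> real (card (?S (lab a)) + card (?S (lab b)))"
        using u
      proof
        assume u: "lab u = lab a"
        from w show ?thesis
        proof
          assume "lab w = lab a"
          then show ?thesis using D[OF uw(1,2)] u by simp
        qed (rule cross[OF uw(1,2) u])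
      next
        assume u: "lab u = lab b"
        from w show ?thesis
        proof
          assume "lab w = lab a"
          then show ?thesis using cross[OF uw(2,1) _ u] by (simp add: dist_commute)
        next
          assume "lab w = lab b"
          then show ?thesis using D[OF uw(1,2)] u by simp
        qed
      qed
      then show ?thesis unfolding True class_a .
    next
      case False
      then have "lab u \<noteq> lab a" "lab u \<noteq> lab b" "?l u = lab u" "lab w = lab u"
        using l[OF uw(1)] l[OF uw(2)] uw(3) by (auto split: if_splits)
      then show ?thesis using other[of "lab u"] D[OF uw(1,2)] by simp
    qed
  qed
qed

lemma component_labels_dist:
  assumes "component_labels n center lab" "v < n"
  shows "dist (center v) (center (lab v)) \<le> real n"
proof -
  have "dist (center v) (center (lab v)) + 1 \<le> card {z. z < n \<and> lab z = lab v}"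
    using assms unfolding component_labels_def by metis
  also have "card {z. z < n \<and> lab z = lab v} \<le> card {..<n}" by (rule card_mono) auto
  finally show ?thesis by simp
qed

definition relabel :: com where
  "relabel = Cond (NEq (NGet ''lab'' (scalar ''w'')) (scalar ''q'')) (NSet ''lab'' (scalar ''w'') (scalar ''p'')) Skip"

text \<open>The labels are saved in \<open>p\<close> and \<open>q\<close> because the relabelling
  loop overwrites the one at \<open>dst\<close>. One pass over the vertices per edge fits the budget
  n * m, so naive merging suffices.\<close>

definition merge_start :: com where
  "merge_start =
     Seq (set_scalar ''p'' (NGet ''lab'' (NGet ''src'' (scalar ''e''))))
    (Seq (set_scalar ''q'' (NGet ''lab'' (NGet ''dst'' (scalar ''e''))))
    (Seq (NSet ''act'' (NGet ''src'' (scalar ''e'')) (NLit 1))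
         (NSet ''act'' (NGet ''dst'' (scalar ''e'')) (NLit 1))))"

definition find_components :: com where
  "find_components = For ''e'' ''m'' (Seq merge_start (For ''w'' ''n'' relabel))"

lemma runs_relabel_loop:
  assumes "nats s ''n'' 0 = n" "nats s ''p'' 0 = p" "nats s ''q'' 0 = q" "nats s ''lab'' = lab"
  shows "runs (For ''w'' ''n'' relabel) s (9 + n * (12 + max_cost relabel))
    (\<lambda>s'. nats s' ''lab'' = merge_labels n p q lab)"
proof (rule runs_conseq[OF runs_For[where N = n and T = "\<lambda>_. max_cost relabel"
      and I = "\<lambda>k s'. nats s' ''lab'' = merge_labels k p q lab"]])
  fix k and s' :: state assume fr: "frame (insert ''w'' (writes relabel)) s s'" and w: "nats s' ''w'' 0 = k"
    and inv: "nats s' ''lab'' = merge_labels k p q lab"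
  have "nats s' ''p'' 0 = p" "nats s' ''q'' 0 = q" using fr assms by (auto simp: frame_def relabel_def)
  then show "runs relabel s' (max_cost relabel) (\<lambda>s'. nats s' ''lab'' = merge_labels (Suc k) p q lab)"
    using w inv by (intro runs_loop_freeI)
      (auto simp: relabel_def update_simps merge_labels_def less_Suc_eq fun_eq_iff)
qed (use assms in \<open>auto simp: frame_def relabel_def merge_labels_def fun_eq_iff\<close>)

text \<open>With an edge present, n * m absorbs additive terms \<open>n\<close>, \<open>m\<close>
  and constants. Without edges the time bound is a constant and forbids even one pass over the
  vertices, which explains the assumption \<open>es \<noteq> []\<close>.\<close>

locale unit_disk_instance =
  fixes n :: nat and E :: "nat set set" and es :: "(nat \<times> nat) list" and center :: "nat \<Rightarrow> real \<times> real"
  assumes rep: "unit_disk_representation {..<n} E center" and enum: "edge_enumeration E es"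
    and es_nonempty: "es \<noteq> []"
begin

lemma set_es: "e \<in> E \<longleftrightarrow> (\<exists>u w. (u, w) \<in> set es \<and> e = {u, w})"
proof -
  have "E = (\<lambda>(u, v). {u, v}) ` set es" using enum by (simp add: edge_enumeration_def)
  then show ?thesis by auto
qed

lemma edge_bounds:
  assumes "(u, w) \<in> set es"
  shows "u < n" "w < n" "u \<noteq> w" "near center u w"
proof -
  have "{u, w} \<in> E" unfolding set_es using assms by blast
  then show "u < n" "w < n" "u \<noteq> w" "near center u w" using edge_iff_near[OF rep, of u w] by simp_all
qed

lemma near_edge:
  assumes "u < n" "w < n" "u \<noteq> w" "near center u w"
  shows "(u, w) \<in> set es \<or> (w, u) \<in> set es"
proof -
  have "{u, w} \<in> E" using edge_iff_near[OF rep, of u w] assms by simp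
  then show ?thesis unfolding set_es by (auto simp: doubleton_eq_iff)
qed

lemma n_pos: "0 < n"
proof -
  obtain u w where "(u, w) \<in> set es" using es_nonempty by (metis hd_in_set prod.exhaust)
  then show ?thesis using edge_bounds by fastforce
qed

lemma m_pos: "0 < length es"
  using es_nonempty by simp

definition active :: "nat set" where
  "active = fst ` set es \<union> snd ` set es"

lemma active_bound: "v \<in> active \<Longrightarrow> v < n"
  unfolding active_def by (auto dest: edge_bounds)

lemma near_active:
  assumes "u < n" "w < n" "u \<noteq> w" "near center u w"
  shows "u \<in> active" "w \<in> active"
  using near_edge[OF assms] unfolding active_def by (metis UnI1 UnI2 fst_conv image_eqI snd_conv)+

lemma card_active: "card active \<le> 2 * length es"
proof -
  have "card active \<le> card (fst ` set es) + card (snd ` set es)" unfolding active_def by (rule card_Un_le)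
  also have "\<dots> \<le> card (set es) + card (set es)" by (intro add_mono card_image_le) auto
  also have "\<dots> \<le> length es + length es" by (intro add_mono card_length)
  finally show ?thesis by simp
qed

lemma runs_find_components:
  assumes input: "has_input n es center s" and lab: "\<forall>v<n. nats s ''lab'' v = v"
    and act: "nats s ''act'' = (\<lambda>_. 0)"
  shows "runs find_components s (9 + length es * (21 + max_cost merge_start + n * (12 + max_cost relabel)))
    (\<lambda>s'. component_labels n center (nats s' ''lab'') \<and>
      (\<forall>(u, w) \<in> set es. nats s' ''lab'' u = nats s' ''lab'' w) \<and>
      nats s' ''act'' = (\<lambda>v. if v \<in> active then 1 else 0))"
proof -
  define I where "I k s' \<longleftrightarrow> component_labels n center (nats s' ''lab'') \<and>
    (\<forall>i<k. nats s' ''lab'' (fst (es ! i)) = nats s' ''lab'' (snd (es ! i))) \<and>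
    (\<forall>v. nats s' ''act'' v = (if \<exists>i<k. v = fst (es ! i) \<or> v = snd (es ! i) then 1 else 0))" for k and s' :: state
  let ?T = "9 + n * (12 + max_cost relabel)"
  have "runs find_components s (9 + (\<Sum>k<length es. 12 + (max_cost merge_start + ?T))) (I (length es))"
    unfolding find_components_def
  proof (rule runs_For)
    fix k and s' :: state assume k: "k < length es"
      and fr: "frame (insert ''e'' (writes (Seq merge_start (For ''w'' ''n'' relabel)))) s s'"
      and e: "nats s' ''e'' 0 = k" and inv: "I k s'"
    obtain a b where ab: "es ! k = (a, b)" by fastforce
    then have mem: "(a, b) \<in> set es" using k by (metis nth_mem)
    have "has_input n es center s'"
      using input fr by (rule has_input_frame) (auto simp: merge_start_def relabel_def)
    then have src: "nats s' ''src'' k = a" "nats s' ''dst'' k = b" "nats s' ''n'' 0 = n"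
      using k ab by (auto simp: has_input_def)
    let ?s = "effect merge_start s'" and ?lab = "nats s' ''lab''"
    have st: "nats ?s ''lab'' = ?lab" "nats ?s ''p'' 0 = ?lab a" "nats ?s ''q'' 0 = ?lab b"
        "nats ?s ''n'' 0 = n" "nats ?s ''act'' = (nats s' ''act'')(a := 1, b := 1)"
      using src e by (auto simp: merge_start_def update_simps)
    show "runs (Seq merge_start (For ''w'' ''n'' relabel)) s' (max_cost merge_start + ?T) (I (Suc k))"
    proof (rule runs_Seq_loop_free)
      show "loop_free merge_start" by (simp add: merge_start_def)
      show "runs (For ''w'' ''n'' relabel) ?s ?T (I (Suc k))"
      proof (rule runs_conseq[OF runs_relabel_loop[OF st(4,2,3,1)]])
        fix s'' :: state assume fr: "frame (writes (For ''w'' ''n'' relabel)) ?s s''"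
          and l: "nats s'' ''lab'' = merge_labels n (?lab a) (?lab b) ?lab"
        have act: "nats s'' ''act'' = (nats s' ''act'')(a := 1, b := 1)"
          using fr st(5) by (auto simp: frame_def relabel_def)
        have "component_labels n center (nats s'' ''lab'')" unfolding l
          using inv edge_bounds[OF mem] by (intro component_labels_merge) (auto simp: I_def)
        \<comment> \<open>Edges treated before stay consistent because a merge replaces each label
          by a function of the label alone.\<close>
        moreover have "nats s'' ''lab'' (fst (es ! i)) = nats s'' ''lab'' (snd (es ! i))" if i: "i < Suc k" for i
        proof (cases "i = k")
          case True
          then show ?thesis unfolding l using ab edge_bounds[OF mem] by (simp add: merge_labels_def)
        next
          case False
          then have "?lab (fst (es ! i)) = ?lab (snd (es ! i))" using inv i by (auto simp: I_def)
          moreover have "fst (es ! i) < n" "snd (es ! i) < n"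
            using edge_bounds[of "fst (es ! i)" "snd (es ! i)"] i k by auto
          ultimately show ?thesis unfolding l by (simp add: merge_labels_def)
        qed
        moreover have "nats s'' ''act'' v = (if \<exists>i<Suc k. v = fst (es ! i) \<or> v = snd (es ! i) then 1 else 0)" for v
          using inv ab unfolding act I_def by (auto simp: less_Suc_eq)
        ultimately show "I (Suc k) s''" by (simp add: I_def)
      qed simp
    qed
  next
    show "I 0 s" using lab act by (simp add: I_def component_labels_init)
    fix k and s' s'' :: state assume "frame {''e''} s' s''" "I k s'"
    then show "I k s''" by (simp add: I_def frame_def)
  qed (use input in \<open>auto simp: has_input_def merge_start_def relabel_def\<close>)
  then show ?thesis
  proof (rule runs_conseq)
    fix s' :: state assume I: "I (length es) s'"
    have "nats s' ''lab'' u = nats s' ''lab'' w" if "(u, w) \<in> set es" for u w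
      using that I unfolding I_def in_set_conv_nth by fastforce
    moreover have "(\<exists>i<length es. v = fst (es ! i) \<or> v = snd (es ! i)) \<longleftrightarrow> v \<in> active" for v
      unfolding active_def set_conv_nth by (auto simp del: fst_conv snd_conv)
    ultimately show "component_labels n center (nats s' ''lab'') \<and>
      (\<forall>(u, w) \<in> set es. nats s' ''lab'' u = nats s' ''lab'' w) \<and>
      nats s' ''act'' = (\<lambda>v. if v \<in> active then 1 else 0)"
      using I unfolding I_def by (auto simp: fun_eq_iff)
  qed (simp add: algebra_simps)
qed

end

text \<open>A graph is a disjoint union of cliques exactly if the two ends of every edge have the
  same closed neighbourhood, and this takes \<open>n\<close> comparisons per edge.\<close>

definition cluster_check :: com where
  "cluster_check = Cond (BXor (Near (NGet ''src'' (scalar ''e'')) (scalar ''w'')) (Near (NGet ''dst'' (scalar ''e'')) (scalar ''w'')))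
     (set_scalar ''flag'' (NLit 1)) Skip"

definition test_cluster :: com where
  "test_cluster = For ''e'' ''m'' (For ''w'' ''n'' cluster_check)"

lemma (in unit_disk_instance) runs_test_cluster:
  assumes input: "has_input n es center s" and flag: "nats s ''flag'' 0 = 0"
  shows "runs test_cluster s (9 + length es * (21 + n * (12 + max_cost cluster_check)))
    (\<lambda>s'. nats s' ''flag'' 0 = 0 \<longleftrightarrow> (\<forall>(a, b)\<in>set es. \<forall>w<n. near center a w \<longleftrightarrow> near center b w))"
proof -
  define ok where "ok k w \<longleftrightarrow> (near center (fst (es ! k)) w \<longleftrightarrow> near center (snd (es ! k)) w)" for k w
  let ?T = "9 + (\<Sum>j<n. 12 + max_cost cluster_check)"
  have "runs test_cluster s (9 + (\<Sum>k<length es. 12 + ?T))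
      (\<lambda>s'. nats s' ''flag'' 0 = 0 \<longleftrightarrow> (\<forall>k<length es. \<forall>w<n. ok k w))"
    unfolding test_cluster_def
  proof (rule runs_For[where I = "\<lambda>k s'. nats s' ''flag'' 0 = 0 \<longleftrightarrow> (\<forall>i<k. \<forall>w<n. ok i w)"])
    fix k and s' :: state assume k: "k < length es" and fr: "frame (insert ''e'' (writes (For ''w'' ''n'' cluster_check))) s s'"
      and e: "nats s' ''e'' 0 = k" and inv: "nats s' ''flag'' 0 = 0 \<longleftrightarrow> (\<forall>i<k. \<forall>w<n. ok i w)"
    have input': "has_input n es center s'"
      using input fr by (rule has_input_frame) (auto simp: cluster_check_def)
    have "runs (For ''w'' ''n'' cluster_check) s' ?T
        (\<lambda>s'. nats s' ''flag'' 0 = 0 \<longleftrightarrow> (\<forall>i<k. \<forall>w<n. ok i w) \<and> (\<forall>w<n. ok k w))"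
    proof (rule runs_For[where I = "\<lambda>j s'. nats s' ''flag'' 0 = 0 \<longleftrightarrow> (\<forall>i<k. \<forall>w<n. ok i w) \<and> (\<forall>w<j. ok k w)"])
      fix j and s'' :: state assume j: "j < n" and fr: "frame (insert ''w'' (writes cluster_check)) s' s''"
        and w: "nats s'' ''w'' 0 = j"
        and inv: "nats s'' ''flag'' 0 = 0 \<longleftrightarrow> (\<forall>i<k. \<forall>w<n. ok i w) \<and> (\<forall>w<j. ok k w)"
      have input'': "has_input n es center s''"
        using input' fr by (rule has_input_frame) (auto simp: cluster_check_def)
      have "nats s'' ''e'' 0 = k" using fr e by (auto simp: frame_def cluster_check_def)
      then have ev: "nval (NGet ''src'' (scalar ''e'')) s'' = fst (es ! k)" "nval (NGet ''dst'' (scalar ''e'')) s'' = snd (es ! k)"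
        "nval (scalar ''w'') s'' = j"
        using w input'' k by (auto simp: has_input_def)
      have "fst (es ! k) < n" "snd (es ! k) < n" using edge_bounds[of "fst (es ! k)" "snd (es ! k)"] k by auto
      then have "bval (BXor (Near (NGet ''src'' (scalar ''e'')) (scalar ''w'')) (Near (NGet ''dst'' (scalar ''e'')) (scalar ''w''))) s'' \<longleftrightarrow> \<not> ok k j"
        using bval_Near[OF input''] ev j by (simp add: ok_def)
      then show "runs cluster_check s'' (max_cost cluster_check)
        (\<lambda>s'. nats s' ''flag'' 0 = 0 \<longleftrightarrow> (\<forall>i<k. \<forall>w<n. ok i w) \<and> (\<forall>w<Suc j. ok k w))"
        using inv by (intro runs_loop_freeI) (auto simp: cluster_check_def update_simps less_Suc_eq simp del: bval_BXor)
    qed (use input' inv in \<open>auto simp: has_input_def frame_def cluster_check_def\<close>)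
    then show "runs (For ''w'' ''n'' cluster_check) s' ?T (\<lambda>s'. nats s' ''flag'' 0 = 0 \<longleftrightarrow> (\<forall>i<Suc k. \<forall>w<n. ok i w))"
      by (rule runs_conseq) (auto simp: less_Suc_eq)
  qed (use input flag in \<open>auto simp: has_input_def frame_def cluster_check_def\<close>)
  moreover have "(\<forall>k<length es. \<forall>w<n. ok k w) \<longleftrightarrow> (\<forall>(a, b)\<in>set es. \<forall>w<n. near center a w \<longleftrightarrow> near center b w)"
    unfolding all_set_conv_all_nth case_prod_beta ok_def ..
  ultimately show ?thesis by (elim runs_conseq) (simp_all add: algebra_simps)
qed

section \<open>Placing the vertices\<close>

abbreviation real_scalar :: "name \<Rightarrow> rexp" where
  "real_scalar a \<equiv> RGet a (NLit 0)"

text \<open>The machine has neither rounding nor remainders: unit steps reduce \<open>r\<close> to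
  its fractional part, while the integer part is collected in \<open>k\<close> and its residue
  modulo \<open>K\<close> in \<open>c\<close>.\<close>

definition floor_step :: "nat \<Rightarrow> com" where
  "floor_step K = Seq (RSet ''r'' (NLit 0) (RSub (real_scalar ''r'') (RLit 1)))
    (Seq (set_scalar ''k'' (NAdd (scalar ''k'') (NLit 1)))
    (Cond (NLess (NAdd (scalar ''c'') (NLit 1)) (NLit K))
       (set_scalar ''c'' (NAdd (scalar ''c'') (NLit 1))) (set_scalar ''c'' (NLit 0))))"

definition floor_loop :: "nat \<Rightarrow> com" where
  "floor_loop K = While (BNot (RLess (real_scalar ''r'') (RLit 1))) (floor_step K)"

lemma writes_floor_loop: "writes (floor_loop K) = {''r'', ''k'', ''c''}"
  by (auto simp: floor_loop_def floor_step_def)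

lemma runs_floor_loop:
  assumes "0 \<le> reals s ''r'' 0" "reals s ''r'' 0 \<le> real N" "nats s ''k'' 0 = 0" "nats s ''c'' 0 < K"
  shows "runs (floor_loop K) s ((N + 1) * (6 + max_cost (floor_step K)))
    (\<lambda>s'. 0 \<le> reals s' ''r'' 0 \<and> reals s' ''r'' 0 < 1 \<and>
      reals s ''r'' 0 = real (nats s' ''k'' 0) + reals s' ''r'' 0 \<and>
      nats s' ''c'' 0 = (nats s ''c'' 0 + nats s' ''k'' 0) mod K)"
proof -
  let ?b = "BNot (RLess (real_scalar ''r'') (RLit 1))"
  let ?I = "\<lambda>h s'. nats s' ''k'' 0 = h \<and> reals s' ''r'' 0 = reals s ''r'' 0 - real h \<and>
    0 \<le> reals s' ''r'' 0 \<and> nats s' ''c'' 0 = (nats s ''c'' 0 + h) mod K"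
  have "runs (floor_loop K) s (1 + bcost ?b + (\<Sum>h<N. 1 + bcost ?b + max_cost (floor_step K)))
      (\<lambda>s'. (\<exists>h. ?I h s') \<and> \<not> bval ?b s')"
    unfolding floor_loop_def
  proof (rule runs_While)
    show "?I 0 s" using assms by simp
    fix h and s' :: state
    assume inv: "?I h s'"
    show "h \<le> N" using inv assms by linarith
    assume b: "bval ?b s'"
    show "runs (floor_step K) s' (max_cost (floor_step K)) (?I (Suc h))"
    proof (rule runs_loop_freeI)
      show "loop_free (floor_step K)" by (simp add: floor_step_def)
      have "(nats s ''c'' 0 + Suc h) mod K = (if Suc (nats s' ''c'' 0) < K then Suc (nats s' ''c'' 0) else 0)"
      proof -
        have "nats s' ''c'' 0 < K" using inv assms(4) by simp
        then show ?thesis using inv by (auto simp: mod_Suc)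
      qed
      then show "?I (Suc h) (effect (floor_step K) s')" using inv b
        by (simp add: floor_step_def update_simps)
    qed simp
  qed
  then show ?thesis
    by (rule runs_conseq) (auto simp: algebra_simps)
qed

text \<open>Natural numbers cannot be multiplied, so the row inside the brick is stored together
  with its weights: 3 for the fallback colour in \<open>ly\<close>, 12 for the cell code in
  \<open>cy\<close>. The thresholds are thirds of the brick height.\<close>

definition pick_y :: com where
  "pick_y = Cond (RLess (RMul (real_scalar ''r'') (RLit 3)) (RLit 1))
     (Seq (set_scalar ''ly'' (NLit 0)) (set_scalar ''cy'' (NLit 0)))
    (Cond (RLess (RMul (real_scalar ''r'') (RLit 3)) (RLit 2))
       (Seq (set_scalar ''ly'' (NLit 3)) (set_scalar ''cy'' (NLit 12)))
       (Seq (set_scalar ''ly'' (NLit 6)) (set_scalar ''cy'' (NLit 24))))"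

definition pick_x :: com where
  "pick_x = Cond (RLess (RMul (real_scalar ''r'') (RLit 4)) (RLit 1))
     (Seq (set_scalar ''lx'' (NLit 0)) (set_scalar ''cx'' (NLit 0)))
    (Cond (RLess (RMul (real_scalar ''r'') (RLit 4)) (RLit 2))
       (Seq (set_scalar ''lx'' (NLit 1)) (set_scalar ''cx'' (NLit 3)))
    (Cond (RLess (RMul (real_scalar ''r'') (RLit 4)) (RLit 3))
       (Seq (set_scalar ''lx'' (NLit 2)) (set_scalar ''cx'' (NLit 6)))
       (Seq (set_scalar ''lx'' (NLit 3)) (set_scalar ''cx'' (NLit 9)))))"

lemma pick_y_effect:
  assumes "0 \<le> reals s ''r'' 0" "reals s ''r'' 0 < 1"
  obtains d where "d < 3" "real d \<le> 3 * reals s ''r'' 0" "3 * reals s ''r'' 0 < real d + 1"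
    "effect pick_y s = nat_update ''cy'' 0 (12 * d) (nat_update ''ly'' 0 (3 * d) s)"
proof -
  define d :: nat where "d = (if reals s ''r'' 0 * 3 < 1 then 0 else if reals s ''r'' 0 * 3 < 2 then 1 else 2)"
  show ?thesis
    by (rule that[of d]) (use assms in \<open>auto simp: d_def pick_y_def\<close>)
qed

lemma pick_x_effect:
  assumes "0 \<le> reals s ''r'' 0" "reals s ''r'' 0 < 1"
  obtains d where "d < 4" "real d \<le> 4 * reals s ''r'' 0" "4 * reals s ''r'' 0 < real d + 1"
    "effect pick_x s = nat_update ''cx'' 0 (3 * d) (nat_update ''lx'' 0 d s)"
proof -
  define d :: nat where "d = (if reals s ''r'' 0 * 4 < 1 then 0 else if reals s ''r'' 0 * 4 < 2 then 1
    else if reals s ''r'' 0 * 4 < 3 then 2 else 3)"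
  show ?thesis
    by (rule that[of d]) (use assms in \<open>auto simp: d_def pick_x_def\<close>)
qed

text \<open>Coordinates are taken relative to the reference vertex of the class, which is at
  distance at most \<open>n\<close>; adding \<open>N\<close> makes them nonnegative and at most 2
  n.\<close>

definition offset :: "name \<Rightarrow> rexp" where
  "offset a = RAdd (RSub (RGet a (scalar ''v'')) (RGet a (NGet ''lab'' (scalar ''v'')))) (real_scalar ''N'')"

abbreviation xpos :: "nat \<Rightarrow> ('v \<Rightarrow> real \<times> real) \<Rightarrow> 'v \<Rightarrow> 'v \<Rightarrow> real" where
  "xpos n center v l \<equiv> 2 * (fst (center v) - fst (center l) + real n)"

abbreviation ypos :: "nat \<Rightarrow> ('v \<Rightarrow> real \<times> real) \<Rightarrow> 'v \<Rightarrow> 'v \<Rightarrow> real" where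
  "ypos n center v l \<equiv> 2 * (snd (center v) - snd (center l) + real n)"

text \<open>Bricks have width 2 and height 3/2, so their indices are the integer parts of the coordinates
  divided by these numbers; \<open>c\<close> first becomes the parity of the row and then the brick colour.\<close>

definition place_start :: com where
  "place_start = Seq (RSet ''r'' (NLit 0) (RDiv (RMul (offset ''y'') (RLit 2)) (RLit 3)))
    (Seq (set_scalar ''k'' (NLit 0)) (set_scalar ''c'' (NLit 0)))"

text \<open>Horizontally the unit is a brick width, so adding 1/2 shifts odd rows by half a brick.
  \<open>c\<close> is deliberately not reset: it carries the row parity into the count modulo
  3.\<close>

definition place_middle :: com where
  "place_middle = Seq (NSet ''br'' (scalar ''v'') (scalar ''k'')) (Seq pick_y
    (Seq (RSet ''r'' (NLit 0) (RDiv (offset ''x'') (RLit 2)))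
    (Seq (Cond (NLess (NLit 0) (scalar ''c''))
       (RSet ''r'' (NLit 0) (RAdd (real_scalar ''r'') (RDiv (RLit 1) (RLit 2)))) Skip)
    (set_scalar ''k'' (NLit 0)))))"

text \<open>Brick colour plus local column is below 6, so one conditional subtraction of 3 reduces
  it modulo 3.\<close>

definition place_end :: com where
  "place_end = Seq (NSet ''bq'' (scalar ''v'') (scalar ''k'')) (Seq (NSet ''pal'' (scalar ''v'') (scalar ''c''))
    (Seq pick_x (Seq (NSet ''ce'' (scalar ''v'') (NAdd (scalar ''cx'') (scalar ''cy'')))
    (Cond (NLess (NLit 2) (NAdd (scalar ''c'') (scalar ''lx'')))
       (NSet ''fb'' (scalar ''v'') (NAdd (scalar ''ly'') (NSub (NAdd (scalar ''c'') (scalar ''lx'')) (NLit 3))))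
       (NSet ''fb'' (scalar ''v'') (NAdd (scalar ''ly'') (NAdd (scalar ''c'') (scalar ''lx''))))))))"

definition place :: com where
  "place = Seq place_start (Seq (floor_loop 2) (Seq place_middle (Seq (floor_loop 3) place_end)))"

definition place_all :: com where
  "place_all = For ''v'' ''n'' (Cond (NLess (NLit 0) (NGet ''act'' (scalar ''v''))) place Skip)"

definition place_names :: "name set" where
  "place_names = {''r'', ''k'', ''c'', ''br'', ''bq'', ''pal'', ''ce'', ''fb'', ''lx'', ''ly'', ''cx'', ''cy''}"

lemma writes_place: "writes place = place_names"
  by (auto simp: place_def place_start_def place_middle_def place_end_def pick_x_def pick_y_def
      writes_floor_loop place_names_def)

text \<open>Each counting loop makes at most 2 n steps; the factors 3 come from 2 n + 1 \<le> 3
  n.\<close>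

definition place_cost :: nat where
  "place_cost = max_cost place_start + 3 * (6 + max_cost (floor_step 2)) + max_cost place_middle +
     3 * (6 + max_cost (floor_step 3)) + max_cost place_end"

definition place_post :: "nat \<Rightarrow> (nat \<Rightarrow> real \<times> real) \<Rightarrow> nat \<Rightarrow> nat \<Rightarrow> state \<Rightarrow> state \<Rightarrow> bool" where
  "place_post n center v l s s' \<longleftrightarrow> (\<exists>R ly Q lx p.
    brick_position (xpos n center v l) (ypos n center v l) R ly Q lx p \<and>
    nats s' ''br'' = (nats s ''br'')(v := R) \<and> nats s' ''bq'' = (nats s ''bq'')(v := Q) \<and>
    nats s' ''pal'' = (nats s ''pal'')(v := p) \<and> nats s' ''ce'' = (nats s ''ce'')(v := 3 * lx + 12 * ly) \<and>
    nats s' ''fb'' = (nats s ''fb'')(v := 3 * ly + (p + lx) mod 3))"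

lemma runs_place:
  assumes input: "has_input n es center s" and N: "reals s ''N'' 0 = real n"
    and v: "nats s ''v'' 0 = v" "v < n" and lab: "component_labels n center (nats s ''lab'')" "nats s ''lab'' v = l"
  shows "runs place s (place_cost * n) (place_post n center v l s)"
    (is "runs _ _ _ ?Q")
proof -
  define X Y where "X = fst (center v) - fst (center l) + real n"
    and "Y = snd (center v) - snd (center l) + real n"
  have l: "l < n" using lab v by (auto simp: component_labels_def)
  have d: "dist (center v) (center l) \<le> real n" using component_labels_dist[OF lab(1) v(2)] lab(2) by simp
  have "\<bar>fst (center v) - fst (center l)\<bar> \<le> real n" "\<bar>snd (center v) - snd (center l)\<bar> \<le> real n"
    using d dist_fst_le[of "center v" "center l"] dist_snd_le[of "center v" "center l"]
    by (auto simp: dist_real_def)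
  then have XY: "0 \<le> X" "X \<le> 2 * real n" "0 \<le> Y" "Y \<le> 2 * real n" unfolding X_def Y_def by linarith+
  have n: "1 \<le> n" using v by simp
  have coords: "reals s ''x'' v = fst (center v)" "reals s ''x'' l = fst (center l)"
    "reals s ''y'' v = snd (center v)" "reals s ''y'' l = snd (center l)"
    using input v l by (auto simp: has_input_def)
  define s1 where "s1 = effect place_start s"
  have r1: "reals s1 ''r'' 0 = Y * 2 / 3"
    unfolding s1_def place_start_def offset_def by (simp add: update_simps v lab(2) coords N Y_def)
  have st1: "nats s1 ''k'' 0 = 0" "nats s1 ''c'' 0 = 0"
    unfolding s1_def place_start_def by (simp_all add: update_simps)
  have fr1: "frame {''r'', ''k'', ''c''} s s1"
    unfolding s1_def place_start_def by (simp add: frame_def update_simps)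
  have "runs (Seq (floor_loop 2) (Seq place_middle (Seq (floor_loop 3) place_end))) s1
    ((2 * n + 1) * (6 + max_cost (floor_step 2)) + (max_cost place_middle +
      ((2 * n + 1) * (6 + max_cost (floor_step 3)) + max_cost place_end))) ?Q"
  proof (rule runs_Seq[OF runs_floor_loop])
    show "0 \<le> reals s1 ''r'' 0" "reals s1 ''r'' 0 \<le> real (2 * n)" using XY r1 by auto
    fix s2 :: state
    assume fr2: "frame (writes (floor_loop 2)) s1 s2"
      and post2: "0 \<le> reals s2 ''r'' 0 \<and> reals s2 ''r'' 0 < 1 \<and>
        reals s1 ''r'' 0 = real (nats s2 ''k'' 0) + reals s2 ''r'' 0 \<and>
        nats s2 ''c'' 0 = (nats s1 ''c'' 0 + nats s2 ''k'' 0) mod 2"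
    define R where "R = nats s2 ''k'' 0"
    have fr02: "frame {''r'', ''k'', ''c''} s s2"
      using fr1 fr2 by (auto simp: writes_floor_loop intro: frame_trans)
    note keep2 = frame_nats[OF fr02] frame_reals[OF fr02]
    have c2: "nats s2 ''c'' 0 = R mod 2" using post2 st1 by (simp add: R_def)
    let ?t = "nat_update ''br'' v R s2"
    obtain ly where ly: "ly < 3" "real ly \<le> 3 * reals ?t ''r'' 0" "3 * reals ?t ''r'' 0 < real ly + 1"
      "effect pick_y ?t = nat_update ''cy'' 0 (12 * ly) (nat_update ''ly'' 0 (3 * ly) ?t)"
      using pick_y_effect[of ?t] post2 by (auto simp: update_simps)
    define s3 where "s3 = effect place_middle s2"
    have s3: "s3 = effect (Seq (RSet ''r'' (NLit 0) (RDiv (offset ''x'') (RLit 2)))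
      (Seq (Cond (NLess (NLit 0) (scalar ''c''))
         (RSet ''r'' (NLit 0) (RAdd (real_scalar ''r'') (RDiv (RLit 1) (RLit 2)))) Skip)
      (set_scalar ''k'' (NLit 0)))) (nat_update ''cy'' 0 (12 * ly) (nat_update ''ly'' 0 (3 * ly) ?t))"
      using ly(4) v(1) keep2(1)[of "''v''"] unfolding s3_def place_middle_def by (simp add: R_def)
    have r3: "reals s3 ''r'' 0 = X / 2 + real (R mod 2) / 2"
      using c2 unfolding s3 offset_def
      by (cases "even R") (simp_all add: update_simps keep2 v lab(2) coords N X_def mod_2_eq_odd)
    have k3: "nats s3 ''k'' 0 = 0" and c3: "nats s3 ''c'' 0 = R mod 2"
      and ly3: "nats s3 ''ly'' 0 = 3 * ly" "nats s3 ''cy'' 0 = 12 * ly"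
      and br3: "nats s3 ''br'' = (nats s ''br'')(v := R)"
      and keep3: "nats s3 ''v'' = nats s ''v''" "nats s3 ''bq'' = nats s ''bq''" "nats s3 ''pal'' = nats s ''pal''"
        "nats s3 ''ce'' = nats s ''ce''" "nats s3 ''fb'' = nats s ''fb''"
      using c2 unfolding s3 by (simp_all add: update_simps keep2)
    show "runs (Seq place_middle (Seq (floor_loop 3) place_end)) s2 (max_cost place_middle +
      ((2 * n + 1) * (6 + max_cost (floor_step 3)) + max_cost place_end)) ?Q"
    proof (rule runs_Seq_loop_free)
      show "loop_free place_middle" by (simp add: place_middle_def pick_y_def)
      show "runs (Seq (floor_loop 3) place_end) (effect place_middle s2)
        ((2 * n + 1) * (6 + max_cost (floor_step 3)) + max_cost place_end) ?Q"
        unfolding s3_def[symmetric]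
      proof (rule runs_Seq[OF runs_floor_loop])
        \<comment> \<open>The half-brick shift still fits under 2 n because X / 2 \<le> n and 1
          \<le> n.\<close>
        have "real (R mod 2) \<le> 1" by simp
        then have "X / 2 + real (R mod 2) / 2 \<le> 2 * real n" using XY n by linarith
        then show "0 \<le> reals s3 ''r'' 0" "reals s3 ''r'' 0 \<le> real (2 * n)" using XY r3 by auto
        show "nats s3 ''k'' 0 = 0" by (rule k3)
        show "nats s3 ''c'' 0 < 3" unfolding c3 by (rule less_trans[of _ 2]) simp_all
        fix s4 :: state
        assume fr4: "frame (writes (floor_loop 3)) s3 s4"
          and post4: "0 \<le> reals s4 ''r'' 0 \<and> reals s4 ''r'' 0 < 1 \<and>
            reals s3 ''r'' 0 = real (nats s4 ''k'' 0) + reals s4 ''r'' 0 \<and>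
            nats s4 ''c'' 0 = (nats s3 ''c'' 0 + nats s4 ''k'' 0) mod 3"
        define Q where "Q = nats s4 ''k'' 0"
        define p where "p = (Q + R mod 2) mod 3"
        have c4: "nats s4 ''c'' 0 = p" using post4 c3 by (simp add: Q_def p_def add.commute)
        note keep4 = frame_nats[OF fr4[unfolded writes_floor_loop]]
        let ?u = "nat_update ''pal'' v p (nat_update ''bq'' v Q s4)"
        obtain lx where lx: "lx < 4" "real lx \<le> 4 * reals ?u ''r'' 0" "4 * reals ?u ''r'' 0 < real lx + 1"
          "effect pick_x ?u = nat_update ''cx'' 0 (3 * lx) (nat_update ''lx'' 0 lx ?u)"
          using pick_x_effect[of ?u] post4 by (auto simp: update_simps)
        have v4: "nats s4 ''v'' 0 = v" using keep4[of "''v''"] keep3 v by simp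
        have s5: "effect place_end s4 = effect (Seq (NSet ''ce'' (scalar ''v'') (NAdd (scalar ''cx'') (scalar ''cy'')))
            (Cond (NLess (NLit 2) (NAdd (scalar ''c'') (scalar ''lx'')))
             (NSet ''fb'' (scalar ''v'') (NAdd (scalar ''ly'') (NSub (NAdd (scalar ''c'') (scalar ''lx'')) (NLit 3))))
             (NSet ''fb'' (scalar ''v'') (NAdd (scalar ''ly'') (NAdd (scalar ''c'') (scalar ''lx''))))))
            (nat_update ''cx'' 0 (3 * lx) (nat_update ''lx'' 0 lx ?u))"
          using lx(4) c4 v4 unfolding place_end_def by (simp add: Q_def update_simps)
        have pos: "brick_position (2 * X) (2 * Y) R ly Q lx p"
        proof -
          have "2 * Y = 3 * real R + 3 * reals s2 ''r'' 0" using post2 r1 by (simp add: R_def)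
          moreover have "2 * X + 2 * real (R mod 2) = 4 * real Q + 4 * reals s4 ''r'' 0"
            using post4 r3 by (simp add: Q_def)
          ultimately show ?thesis using ly(1-3) lx(1-3)
            unfolding brick_position_def p_def by (simp add: update_simps)
        qed
        have "p < 3" by (simp add: p_def)
        then have "p + lx < 6" using lx(1) by simp
        then have mod: "(p + lx) mod 3 = (if 2 < p + lx then p + lx - 3 else p + lx)"
          by (auto simp: mod_if)
        show "runs place_end s4 (max_cost place_end) ?Q"
        proof (rule runs_loop_freeI)
          show "loop_free place_end" by (simp add: place_end_def pick_x_def)
          have "nats (effect place_end s4) ''br'' = (nats s ''br'')(v := R)"
              "nats (effect place_end s4) ''bq'' = (nats s ''bq'')(v := Q)"
              "nats (effect place_end s4) ''pal'' = (nats s ''pal'')(v := p)"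
              "nats (effect place_end s4) ''ce'' = (nats s ''ce'')(v := 3 * lx + 12 * ly)"
              "nats (effect place_end s4) ''fb'' = (nats s ''fb'')(v := 3 * ly + (p + lx) mod 3)"
            unfolding s5 mod by (simp_all add: update_simps keep4 keep3 br3 ly3 c4 v4 v(1))
          then show "?Q (effect place_end s4)" using pos unfolding X_def Y_def place_post_def by blast
        qed simp
      qed
    qed
  qed (use st1 in auto)
  then have "runs place s (max_cost place_start + ((2 * n + 1) * (6 + max_cost (floor_step 2)) + (max_cost place_middle +
      ((2 * n + 1) * (6 + max_cost (floor_step 3)) + max_cost place_end)))) ?Q"
    unfolding place_def s1_def by (rule runs_Seq_loop_free[rotated]) (simp add: place_start_def)
  moreover have "max_cost place_start + ((2 * n + 1) * (6 + max_cost (floor_step 2)) + (max_cost place_middle +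
      ((2 * n + 1) * (6 + max_cost (floor_step 3)) + max_cost place_end))) \<le> place_cost * n"
  proof -
    have "a + ((2 * n + 1) * b + (c + ((2 * n + 1) * d + e))) \<le> (a + 3 * b + c + 3 * d + e) * n" for a b c d e
    proof -
      obtain k where "n = Suc k" using n by (cases n) auto
      then show ?thesis by (simp add: algebra_simps)
    qed
    then show ?thesis unfolding place_cost_def .
  qed
  ultimately show ?thesis by (rule runs_conseq)
qed

definition placed :: "nat \<Rightarrow> (nat \<Rightarrow> real \<times> real) \<Rightarrow> state \<Rightarrow> nat \<Rightarrow> bool" where
  "placed n center s v \<longleftrightarrow> (\<exists>ly lx. brick_position
     (xpos n center v (nats s ''lab'' v))
     (ypos n center v (nats s ''lab'' v))
     (nats s ''br'' v) ly (nats s ''bq'' v) lx (nats s ''pal'' v) \<and>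
     nats s ''ce'' v = 3 * lx + 12 * ly \<and> nats s ''fb'' v = 3 * ly + (nats s ''pal'' v + lx) mod 3)"

text \<open>A placement costs order \<open>n\<close> and is paid only by the at most 2 m active
  vertices; an isolated one costs the 7 units of a failed test and \<open>Skip\<close>.\<close>

lemma (in unit_disk_instance) runs_place_all:
  assumes input: "has_input n es center s" and N: "reals s ''N'' 0 = real n"
    and lab: "component_labels n center (nats s ''lab'')" and act: "\<forall>v. 0 < nats s ''act'' v \<longleftrightarrow> v \<in> active"
  shows "runs place_all s (9 + n * 19 + 2 * length es * (place_cost * n))
    (\<lambda>s'. \<forall>v\<in>active. placed n center s' v)"
proof -
  let ?b = "NLess (NLit 0) (NGet ''act'' (scalar ''v''))"
  define T where "T v = (if v \<in> active then 7 + place_cost * n else 7)" for v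
  have "runs place_all s (9 + (\<Sum>v<n. 12 + T v)) (\<lambda>s'. \<forall>v<n. v \<in> active \<longrightarrow> placed n center s' v)"
    unfolding place_all_def
  proof (rule runs_For[where I = "\<lambda>k s'. \<forall>v<k. v \<in> active \<longrightarrow> placed n center s' v"])
    fix k and s' :: state
    assume k: "k < n" and fr: "frame (insert ''v'' (writes (Cond ?b place Skip))) s s'"
      and v: "nats s' ''v'' 0 = k" and inv: "\<forall>v<k. v \<in> active \<longrightarrow> placed n center s' v"
    have fr': "frame (insert ''v'' place_names) s s'" using fr by (simp add: writes_place)
    have input': "has_input n es center s'"
      using input fr' by (rule has_input_frame) (simp add: place_names_def)
    have eqs: "nats s' ''lab'' = nats s ''lab''" "nats s' ''act'' = nats s ''act''" "reals s' ''N'' = reals s ''N''"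
      using fr' by (simp_all add: frame_def place_names_def)
    show "runs (Cond ?b place Skip) s' (T k) (\<lambda>s'. \<forall>v<Suc k. v \<in> active \<longrightarrow> placed n center s' v)"
    proof (cases "k \<in> active")
      case False
      have "runs (Cond ?b place Skip) s' (1 + bcost ?b + 1) (\<lambda>s'. \<forall>v<Suc k. v \<in> active \<longrightarrow> placed n center s' v)"
      proof (rule runs_Cond)
        assume "bval ?b s'"
        then show "runs place s' 1 (\<lambda>s'. \<forall>v<Suc k. v \<in> active \<longrightarrow> placed n center s' v)"
          using False v eqs act by simp
      next
        show "runs Skip s' 1 (\<lambda>s'. \<forall>v<Suc k. v \<in> active \<longrightarrow> placed n center s' v)"
          by (rule runs_loop_freeI) (use inv False in \<open>auto simp: less_Suc_eq\<close>)
      qed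
      then show ?thesis using False by (simp add: T_def numeral_eq_Suc)
    next
      case True
      have "runs (Cond ?b place Skip) s' (1 + bcost ?b + place_cost * n) (\<lambda>s'. \<forall>v<Suc k. v \<in> active \<longrightarrow> placed n center s' v)"
      proof (rule runs_Cond)
        assume "bval ?b s'"
        have "component_labels n center (nats s' ''lab'')" using lab eqs by simp
        moreover have "reals s' ''N'' 0 = real n" using N eqs by simp
        ultimately have "runs place s' (place_cost * n) (place_post n center k (nats s' ''lab'' k) s')"
          by (rule runs_place[OF input' _ v k _ refl, rotated])
        then show "runs place s' (place_cost * n) (\<lambda>s'. \<forall>v<Suc k. v \<in> active \<longrightarrow> placed n center s' v)"
        proof (rule runs_conseq)
          fix s'' :: state
          assume fr: "frame (writes place) s' s''"
            and post: "place_post n center k (nats s' ''lab'' k) s' s''"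
          have lab'': "nats s'' ''lab'' = nats s' ''lab''" using fr by (simp add: frame_def writes_place place_names_def)
          from post obtain R ly Q lx p where 1: "brick_position (xpos n center k (nats s' ''lab'' k))
                (ypos n center k (nats s' ''lab'' k)) R ly Q lx p"
              and 2: "nats s'' ''br'' = (nats s' ''br'')(k := R)" "nats s'' ''bq'' = (nats s' ''bq'')(k := Q)"
              "nats s'' ''pal'' = (nats s' ''pal'')(k := p)" "nats s'' ''ce'' = (nats s' ''ce'')(k := 3 * lx + 12 * ly)"
              "nats s'' ''fb'' = (nats s' ''fb'')(k := 3 * ly + (p + lx) mod 3)"
            unfolding place_post_def by metis
          have "placed n center s'' k" unfolding placed_def
            by (rule exI[of _ ly], rule exI[of _ lx]) (use 1 in \<open>simp add: 2 lab''\<close>)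
          moreover have "placed n center s'' v" if "v < k" "v \<in> active" for v
          proof -
            have "placed n center s' v" using inv that by blast
            then show ?thesis using that(1) unfolding placed_def by (simp add: 2 lab'')
          qed
          ultimately show "\<forall>v<Suc k. v \<in> active \<longrightarrow> placed n center s'' v" by (simp add: less_Suc_eq)
        qed simp
      next
        assume "\<not> bval ?b s'"
        then show "runs Skip s' (place_cost * n) (\<lambda>s'. \<forall>v<Suc k. v \<in> active \<longrightarrow> placed n center s' v)"
          using True act eqs v by simp
      qed
      then show ?thesis using True by (elim runs_conseq) (simp_all add: T_def)
    qed
  next
    fix k and s' s'' :: state
    assume "frame {''v''} s' s''" "\<forall>v<k. v \<in> active \<longrightarrow> placed n center s' v"
    then show "\<forall>v<k. v \<in> active \<longrightarrow> placed n center s'' v" by (simp add: placed_def frame_def)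
  qed (use input in \<open>auto simp: has_input_def writes_place place_names_def\<close>)
  moreover have "9 + (\<Sum>v<n. 12 + T v) \<le> 9 + n * 19 + 2 * length es * (place_cost * n)"
  proof -
    have "(\<Sum>v<n. 12 + T v) = (\<Sum>v<n. 19 + (if v \<in> active then place_cost * n else 0))"
      by (intro sum.cong) (auto simp: T_def)
    also have "\<dots> = n * 19 + card {v \<in> {..<n}. v \<in> active} * (place_cost * n)"
      unfolding sum.distrib by (subst sum.inter_filter[symmetric]) simp_all
    also have "{v \<in> {..<n}. v \<in> active} = active" using active_bound by auto
    also have "n * 19 + card active * (place_cost * n) \<le> n * 19 + 2 * length es * (place_cost * n)"
      using card_active by (intro add_left_mono mult_right_mono) auto
    finally show ?thesis by simp
  qed
  ultimately show ?thesis by (elim runs_conseq) (auto dest: active_bound)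
qed

section \<open>Unit propagation on the machine\<close>

text \<open>Comparing \<open>act\<close> as well ensures that the block of an active vertex consists
  of active vertices, for which placement data exist.\<close>

definition same_block :: "nexp \<Rightarrow> nexp \<Rightarrow> bexp" where
  "same_block e f = BAnd (NEq (NGet ''lab'' e) (NGet ''lab'' f)) (BAnd (NEq (NGet ''br'' e) (NGet ''br'' f))
    (BAnd (NEq (NGet ''bq'' e) (NGet ''bq'' f)) (NEq (NGet ''act'' e) (NGet ''act'' f))))"

text \<open>Both table lookups use the colour of \<open>u\<close>: the clause speaks about
  \<open>w\<close> receiving that same colour, whatever its present value.\<close>

definition conflicting :: bexp where
  "conflicting = BAnd (same_block (scalar ''u'') (scalar ''w''))
    (BXor (NEq (NGet ''g'' (NAdd (NGet ''ce'' (scalar ''u'')) (NGet ''val'' (scalar ''u''))))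
               (NGet ''g'' (NAdd (NGet ''ce'' (scalar ''w'')) (NGet ''val'' (scalar ''u'')))))
          (Near (scalar ''u'') (scalar ''w'')))"

definition scan :: com where
  "scan = Cond conflicting
    (Cond (NEq (NGet ''val'' (scalar ''w'')) (NGet ''val'' (scalar ''u''))) (set_scalar ''conf'' (NLit 1))
    (Cond (NEq (NGet ''val'' (scalar ''w'')) (NLit 0))
      (Seq (NSet ''val'' (scalar ''w'') (NSub (NLit 3) (NGet ''val'' (scalar ''u''))))
      (Seq (NSet ''queue'' (scalar ''ql'') (scalar ''w'')) (set_scalar ''ql'' (NAdd (scalar ''ql'') (NLit 1)))))
      Skip)) Skip"

definition dequeue :: com where
  "dequeue = set_scalar ''u'' (NGet ''queue'' (scalar ''hd''))"

definition advance :: com where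
  "advance = set_scalar ''hd'' (NAdd (scalar ''hd'') (NLit 1))"

text \<open>A conflict is merely recorded and the queue is still worked off; this stays within the
  bound by the block size and keeps a single exit.\<close>

definition propagate :: com where
  "propagate = While (NLess (scalar ''hd'') (scalar ''ql'')) (Seq dequeue (Seq (For ''w'' ''n'' scan) advance))"

definition start :: "nat \<Rightarrow> com" where
  "start c = Seq (NSet ''val'' (scalar ''v'') (NLit c)) (Seq (NSet ''queue'' (NLit 0) (scalar ''v''))
    (Seq (set_scalar ''ql'' (NLit 1)) (Seq (set_scalar ''hd'' (NLit 0)) (set_scalar ''conf'' (NLit 0)))))"

text \<open>Exactly the queued vertices were assigned during the attempt, and all had value 0
  before, so clearing them restores the former assignment at the cost of the queue length.\<close>

definition undo :: com where
  "undo = NSet ''val'' (NGet ''queue'' (scalar ''i'')) (NLit 0)"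

definition attempt :: "nat \<Rightarrow> com" where
  "attempt c = Seq (start c) (Seq propagate (Cond (NLess (NLit 0) (scalar ''conf'')) (For ''i'' ''ql'' undo) Skip))"

lemma writes_propagate: "writes propagate = {''u'', ''w'', ''val'', ''conf'', ''queue'', ''ql'', ''hd''}"
  by (auto simp: propagate_def dequeue_def scan_def advance_def)

lemma writes_attempt: "writes (attempt c) = {''u'', ''w'', ''val'', ''conf'', ''queue'', ''ql'', ''hd'', ''i''}"
  by (auto simp: attempt_def start_def undo_def writes_propagate)

text \<open>Failure of one vertex under both colours refutes its entire block, so all members are
  marked.\<close>

definition mark_bad :: com where
  "mark_bad = Cond (same_block (scalar ''v'') (scalar ''w'')) (NSet ''bad'' (scalar ''w'') (NLit 1)) Skip"

definition solve_vertex :: com where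
  "solve_vertex = Cond (BAnd (NLess (NLit 0) (NGet ''act'' (scalar ''v''))) (NEq (NGet ''val'' (scalar ''v'')) (NLit 0)))
    (Seq (attempt 1) (Cond (NLess (NLit 0) (scalar ''conf''))
      (Seq (attempt 2) (Cond (NLess (NLit 0) (scalar ''conf'')) (For ''w'' ''n'' mark_bad) Skip)) Skip)) Skip"

definition propagate_cost :: nat where
  "propagate_cost = 41 + max_cost dequeue + max_cost scan + max_cost advance"

definition attempt_cost :: "nat \<Rightarrow> nat" where
  "attempt_cost c = max_cost (start c) + propagate_cost + 50 + max_cost undo"

locale blocks = unit_disk_instance +
  fixes lab br bq act ce :: "nat \<Rightarrow> nat"
begin

definition block :: "nat \<Rightarrow> nat \<Rightarrow> bool" where
  "block u w \<longleftrightarrow> lab u = lab w \<and> br u = br w \<and> bq u = bq w \<and> act u = act w"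

abbreviation clash :: "(nat \<Rightarrow> nat) \<Rightarrow> nat \<Rightarrow> nat \<Rightarrow> nat \<Rightarrow> bool" where
  "clash g \<equiv> mismatch (near center) block ce g"

definition has_blocks :: "state \<Rightarrow> bool" where
  "has_blocks s \<longleftrightarrow> has_input n es center s \<and> nats s ''lab'' = lab \<and> nats s ''br'' = br \<and>
     nats s ''bq'' = bq \<and> nats s ''act'' = act \<and> nats s ''ce'' = ce"

lemma has_blocks_frame:
  assumes "has_blocks s" "frame M s s'"
    "M \<inter> {''n'', ''m'', ''src'', ''dst'', ''x'', ''y'', ''lab'', ''br'', ''bq'', ''act'', ''ce''} = {}"
  shows "has_blocks s'"
proof -
  have "has_input n es center s" using assms(1) by (simp add: has_blocks_def)
  then have "has_input n es center s'" using assms(2) by (rule has_input_frame) (use assms(3) in blast)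
  moreover have "nats s' a = nats s a" if "a \<in> {''lab'', ''br'', ''bq'', ''act'', ''ce''}" for a
    by (rule frame_nats[OF assms(2)]) (use assms(3) that in auto)
  ultimately show ?thesis using assms(1) by (simp add: has_blocks_def)
qed

sublocale conflict_relation n block "clash g" for g
proof unfold_locales
  show "clash g c u w \<Longrightarrow> clash g c w u" for c u w
    unfolding mismatch_def block_def using near_sym[of center u w] by metis
qed (simp_all add: block_def mismatch_def)

lemma bval_same_block: "has_blocks s \<Longrightarrow> bval (same_block e f) s \<longleftrightarrow> block (nval e s) (nval f s)"
  by (simp add: same_block_def has_blocks_def block_def)

lemma bval_conflicting:
  assumes "has_blocks s" "nats s ''g'' = g" "nats s ''u'' 0 = u" "nats s ''w'' 0 = w" "u < n" "w < n"
  shows "bval conflicting s \<longleftrightarrow> clash g (nats s ''val'' u) u w"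
proof -
  have "has_input n es center s" "nats s ''ce'' = ce" using assms by (auto simp: has_blocks_def)
  then show ?thesis using assms bval_Near[of n es center s "scalar ''u''" "scalar ''w''"]
    by (simp add: conflicting_def bval_same_block mismatch_def)
qed

definition state_inv :: "(nat \<Rightarrow> nat) \<Rightarrow> (nat \<Rightarrow> nat) \<Rightarrow> nat \<Rightarrow> nat \<Rightarrow> nat \<Rightarrow> nat \<Rightarrow> state \<Rightarrow> bool" where
  "state_inv g f0 v c h j s \<longleftrightarrow> propagation n block (clash g) f0 v c h j (nats s ''val'') (nats s ''queue'')
     (nats s ''ql'' 0) (nats s ''conf'' 0)"

lemma state_inv_frame:
  "frame M s s' \<Longrightarrow> M \<inter> {''val'', ''queue'', ''ql'', ''conf''} = {} \<Longrightarrow> state_inv g f0 v c h j s \<Longrightarrow>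
    state_inv g f0 v c h j s'"
proof -
  assume fr: "frame M s s'" and M: "M \<inter> {''val'', ''queue'', ''ql'', ''conf''} = {}"
  have "nats s' a = nats s a" if "a \<in> {''val'', ''queue'', ''ql'', ''conf''}" for a
    using fr M that by (intro frame_nats) blast+
  then show "state_inv g f0 v c h j s \<Longrightarrow> state_inv g f0 v c h j s'" by (simp add: state_inv_def)
qed

lemma scan_step:
  assumes inv: "state_inv g f0 v c h j s" and h: "h < nats s ''ql'' 0" and j: "j < n"
    and f0: "closed_assignment n (clash g) f0" and s: "has_blocks s" "nats s ''g'' = g"
    and u: "nats s ''u'' 0 = nats s ''queue'' h" and w: "nats s ''w'' 0 = j"
  shows "state_inv g f0 v c h (Suc j) (effect scan s)" "h < nats (effect scan s) ''ql'' 0"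
    "nats (effect scan s) ''u'' 0 = nats (effect scan s) ''queue'' h"
proof -
  let ?f = "nats s ''val''" and ?u = "nats s ''queue'' h"
  note inv' = inv[unfolded state_inv_def]
  have un: "?u < n" and fu: "?f ?u \<in> {1, 2}" using propagationD(6)[OF inv' h] by auto
  have b: "bval conflicting s \<longleftrightarrow> clash g (?f ?u) ?u j" by (rule bval_conflicting[OF s u w un j])
  note step = propagation_step[OF inv' h j f0]
  consider "\<not> clash g (?f ?u) ?u j" | "clash g (?f ?u) ?u j" "?f j = ?f ?u"
    | "clash g (?f ?u) ?u j" "?f j \<noteq> ?f ?u" "?f j \<noteq> 0" | "clash g (?f ?u) ?u j" "?f j = 0"
    by blast
  then have "state_inv g f0 v c h (Suc j) (effect scan s) \<and> h < nats (effect scan s) ''ql'' 0 \<and>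
    nats (effect scan s) ''u'' 0 = nats (effect scan s) ''queue'' h"
  proof cases
    case 1
    then have "effect scan s = s" using b by (simp add: scan_def)
    then show ?thesis using step(1)[OF 1] h u by (simp add: state_inv_def)
  next
    case 2
    then have "effect scan s = nat_update ''conf'' 0 1 s" using b u w by (simp add: scan_def)
    then show ?thesis using step(2)[OF 2] h u by (simp add: state_inv_def update_simps)
  next
    case 3
    then have "effect scan s = s" using b u w by (simp add: scan_def)
    then show ?thesis using step(3)[OF 3] h u by (simp add: state_inv_def)
  next
    case 4
    have "nats (effect scan s) ''val'' = ?f(j := 3 - ?f ?u)"
        "nats (effect scan s) ''queue'' = (nats s ''queue'')(nats s ''ql'' 0 := j)"
        "nats (effect scan s) ''ql'' 0 = Suc (nats s ''ql'' 0)"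
        "nats (effect scan s) ''conf'' = nats s ''conf''" "nats (effect scan s) ''u'' = nats s ''u''"
      using 4 b u w fu by (auto simp: scan_def update_simps)
    then show ?thesis using step(4)[OF 4] h u unfolding state_inv_def by simp
  qed
  then show "state_inv g f0 v c h (Suc j) (effect scan s)" "h < nats (effect scan s) ''ql'' 0"
    "nats (effect scan s) ''u'' 0 = nats (effect scan s) ''queue'' h" by simp_all
qed

abbreviation block_size :: "nat \<Rightarrow> nat" where
  "block_size v \<equiv> card {u. u < n \<and> block v u}"

lemma runs_scan_all:
  assumes inv: "state_inv g f0 v c h 0 s" and h: "h < nats s ''ql'' 0"
    and f0: "closed_assignment n (clash g) f0" and s: "has_blocks s" "nats s ''g'' = g"
    and u: "nats s ''u'' 0 = nats s ''queue'' h"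
  shows "runs (For ''w'' ''n'' scan) s (9 + n * (12 + max_cost scan)) (state_inv g f0 v c (Suc h) 0)"
proof -
  let ?I = "\<lambda>j s'. state_inv g f0 v c h j s' \<and> h < nats s' ''ql'' 0 \<and> nats s' ''u'' 0 = nats s' ''queue'' h"
  have "runs (For ''w'' ''n'' scan) s (9 + (\<Sum>j<n. 12 + max_cost scan)) (?I n)"
  proof (rule runs_For[where I = ?I])
    fix j and s' :: state
    assume j: "j < n" and fr: "frame (insert ''w'' (writes scan)) s s'" and w: "nats s' ''w'' 0 = j" and I: "?I j s'"
    have s': "has_blocks s'" by (rule has_blocks_frame[OF s(1) fr]) (simp add: scan_def)
    have g': "nats s' ''g'' = g" using fr s(2) by (simp add: frame_def scan_def)
    have I': "state_inv g f0 v c h j s'" "h < nats s' ''ql'' 0" "nats s' ''u'' 0 = nats s' ''queue'' h"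
      using I by blast+
    show "runs scan s' (max_cost scan) (?I (Suc j))"
    proof (rule runs_loop_freeI)
      show "loop_free scan" by (simp add: scan_def)
      show "?I (Suc j) (effect scan s')" using scan_step[OF I'(1,2) j f0 s' g' I'(3) w] by blast
    qed simp
  next
    fix k and s' s'' :: state
    assume "frame {''w''} s' s''" "?I k s'"
    then show "?I k s''" using state_inv_frame[of "{''w''}" s' s'' g f0 v c h k] by (simp add: frame_def)
  qed (use inv h u s in \<open>auto simp: scan_def has_blocks_def has_input_def\<close>)
  then show ?thesis
    by (rule runs_conseq) (simp_all add: state_inv_def propagation_next)
qed

lemma runs_propagate:
  assumes inv: "state_inv g f0 v c 0 0 s" "nats s ''hd'' 0 = 0"
    and f0: "closed_assignment n (clash g) f0" and s: "has_blocks s" "nats s ''g'' = g" and v: "v < n"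
  shows "runs propagate s (propagate_cost * n * block_size v) (\<lambda>s'. state_inv g f0 v c (nats s' ''ql'' 0) 0 s')"
proof -
  let ?b = "NLess (scalar ''hd'') (scalar ''ql'')"
  let ?I = "\<lambda>h s'. nats s' ''hd'' 0 = h \<and> state_inv g f0 v c h 0 s'"
  let ?T = "max_cost dequeue + (9 + n * (12 + max_cost scan) + max_cost advance)"
  have "runs propagate s (1 + bcost ?b + (\<Sum>h<block_size v. 1 + bcost ?b + ?T)) (\<lambda>s'. (\<exists>h. ?I h s') \<and> \<not> bval ?b s')"
    unfolding propagate_def
  proof (rule runs_While)
    show "?I 0 s" using inv by simp
    fix h and s' :: state
    assume I: "?I h s'"
    have "h \<le> nats s' ''ql'' 0" using I propagationD(1) unfolding state_inv_def by blast
    also have "\<dots> \<le> block_size v" using I propagation_length unfolding state_inv_def by blast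
    finally show "h \<le> block_size v" .
    assume fr: "frame (writes (Seq dequeue (Seq (For ''w'' ''n'' scan) advance))) s s'" and b: "bval ?b s'"
    have s': "has_blocks s'"
      by (rule has_blocks_frame[OF s(1) fr]) (simp add: scan_def dequeue_def advance_def)
    define t where "t = effect dequeue s'"
    have fr_t: "frame {''u''} s' t" by (simp add: t_def dequeue_def frame_def update_simps)
    have t: "has_blocks t" by (rule has_blocks_frame[OF s' fr_t]) simp
    have g': "nats t ''g'' = g"
      using fr fr_t s(2) by (simp add: frame_def scan_def dequeue_def advance_def)
    have inv_t: "state_inv g f0 v c h 0 t" by (rule state_inv_frame[OF fr_t]) (use I in simp_all)
    have u: "nats t ''u'' 0 = nats t ''queue'' h" and h: "h < nats t ''ql'' 0"
      using I b by (simp_all add: t_def dequeue_def update_simps)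
    have hd: "nats t ''hd'' 0 = h" using fr_t I by (simp add: frame_def)
    show "runs (Seq dequeue (Seq (For ''w'' ''n'' scan) advance)) s' ?T (?I (Suc h))"
    proof (rule runs_Seq_loop_free)
      show "loop_free dequeue" by (simp add: dequeue_def)
      show "runs (Seq (For ''w'' ''n'' scan) advance) (effect dequeue s') (9 + n * (12 + max_cost scan) + max_cost advance) (?I (Suc h))"
        unfolding t_def[symmetric]
      proof (rule runs_Seq[OF runs_scan_all[OF inv_t h f0 t g' u]])
        fix r :: state
        assume fr: "frame (writes (For ''w'' ''n'' scan)) t r" and inv_r: "state_inv g f0 v c (Suc h) 0 r"
        have "nats r ''hd'' 0 = h" using fr hd by (simp add: frame_def scan_def)
        then show "runs advance r (max_cost advance) (?I (Suc h))"
          using inv_r by (intro runs_loop_freeI) (simp_all add: advance_def update_simps state_inv_def)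
      qed
    qed
  qed
  moreover have "1 + bcost ?b + (\<Sum>h<block_size v. 1 + bcost ?b + ?T) \<le> propagate_cost * n * block_size v"
  proof -
    have "block_size v \<noteq> 0" using v B_refl by auto
    then obtain k where k: "block_size v = Suc k" using not0_implies_Suc by blast
    obtain l where l: "n = Suc l" using v by (cases n) auto
    show ?thesis unfolding k propagate_cost_def by (simp add: l algebra_simps)
  qed
  ultimately show ?thesis
  proof (rule runs_conseq)
    fix s' :: state
    assume "(\<exists>h. ?I h s') \<and> \<not> bval ?b s'"
    moreover from this have "nats s' ''hd'' 0 \<le> nats s' ''ql'' 0"
      using propagationD(1) unfolding state_inv_def by blast
    ultimately show "state_inv g f0 v c (nats s' ''ql'' 0) 0 s'" by auto
  qed
qed

lemma runs_undo:
  assumes "nats s ''ql'' 0 = l"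
  shows "runs (For ''i'' ''ql'' undo) s (9 + l * (12 + max_cost undo))
    (\<lambda>s'. nats s' ''val'' = (\<lambda>u. if u \<in> nats s ''queue'' ` {..<l} then 0 else nats s ''val'' u))"
proof (rule runs_conseq[OF runs_For[where N = l and T = "\<lambda>_. max_cost undo"
      and I = "\<lambda>k s'. nats s' ''val'' = (\<lambda>u. if u \<in> nats s ''queue'' ` {..<k} then 0 else nats s ''val'' u)"]])
  fix k and s' :: state
  assume fr: "frame (insert ''i'' (writes undo)) s s'" and i: "nats s' ''i'' 0 = k"
    and inv: "nats s' ''val'' = (\<lambda>u. if u \<in> nats s ''queue'' ` {..<k} then 0 else nats s ''val'' u)"
  have q: "nats s' ''queue'' = nats s ''queue''" using fr by (simp add: frame_def undo_def)
  show "runs undo s' (max_cost undo)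
    (\<lambda>s'. nats s' ''val'' = (\<lambda>u. if u \<in> nats s ''queue'' ` {..<Suc k} then 0 else nats s ''val'' u))"
    by (intro runs_loop_freeI) (simp_all add: undo_def update_simps inv q i lessThan_Suc fun_eq_iff)
qed (use assms in \<open>auto simp: undo_def frame_def\<close>)

definition attempt_post :: "(nat \<Rightarrow> nat) \<Rightarrow> (nat \<Rightarrow> nat) \<Rightarrow> nat \<Rightarrow> nat \<Rightarrow> state \<Rightarrow> bool" where
  "attempt_post g f0 v c s' \<longleftrightarrow> (if nats s' ''conf'' 0 = 0
     then closed_assignment n (clash g) (nats s' ''val'') \<and> nats s' ''val'' v = c \<and>
       (\<forall>u. f0 u \<noteq> 0 \<longrightarrow> nats s' ''val'' u = f0 u)
     else nats s' ''val'' = f0 \<and> (\<forall>\<tau>. assigns n block (clash g) v \<tau> \<longrightarrow> \<tau> v \<noteq> c))"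

lemma runs_attempt:
  assumes s: "has_blocks s" "nats s ''g'' = g" and v: "v < n" "nats s ''v'' 0 = v"
    and f0: "closed_assignment n (clash g) (nats s ''val'')" "nats s ''val'' v = 0" and c: "c \<in> {1, 2}"
  shows "runs (attempt c) s (attempt_cost c * n * block_size v) (attempt_post g (nats s ''val'') v c)"
proof -
  let ?f0 = "nats s ''val''" and ?b = "NLess (NLit 0) (scalar ''conf'')"
  define t where "t = effect (start c) s"
  have fr_t: "frame {''val'', ''queue'', ''ql'', ''hd'', ''conf''} s t"
    by (simp add: t_def start_def frame_def update_simps)
  have t: "has_blocks t" by (rule has_blocks_frame[OF s(1) fr_t]) simp
  have gt: "nats t ''g'' = g" using fr_t s(2) by (simp add: frame_def)
  have vals: "nats t ''val'' = ?f0(v := c)" "nats t ''queue'' = (nats s ''queue'')(0 := v)"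
    "nats t ''ql'' 0 = 1" "nats t ''conf'' 0 = 0" "nats t ''hd'' 0 = 0"
    using v by (simp_all add: t_def start_def update_simps)
  have inv: "state_inv g ?f0 v c 0 0 t"
    unfolding state_inv_def vals by (rule propagation_init) (use v f0 c in simp_all)
  let ?T = "9 + block_size v * (12 + max_cost undo)"
  have "runs (attempt c) s (max_cost (start c) + (propagate_cost * n * block_size v + (1 + bcost ?b + ?T)))
    (attempt_post g ?f0 v c)"
    unfolding attempt_def
  proof (rule runs_Seq_loop_free)
    show "loop_free (start c)" by (simp add: start_def)
    show "runs (Seq propagate (Cond ?b (For ''i'' ''ql'' undo) Skip)) (effect (start c) s)
        (propagate_cost * n * block_size v + (1 + bcost ?b + ?T)) (attempt_post g ?f0 v c)"
      unfolding t_def[symmetric]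
    proof (rule runs_Seq[OF runs_propagate[OF inv vals(5) f0(1) t gt v(1)]])
      fix r :: state
      assume inv_r: "state_inv g ?f0 v c (nats r ''ql'' 0) 0 r"
      note P = inv_r[unfolded state_inv_def]
      show "runs (Cond ?b (For ''i'' ''ql'' undo) Skip) r (1 + bcost ?b + ?T) (attempt_post g ?f0 v c)"
      proof (rule runs_Cond)
        assume b: "bval ?b r"
        show "runs (For ''i'' ''ql'' undo) r ?T (attempt_post g ?f0 v c)"
        proof (rule runs_conseq[OF runs_undo[OF refl]])
          show "9 + nats r ''ql'' 0 * (12 + max_cost undo) \<le> ?T"
            by (intro add_left_mono mult_right_mono propagation_length[OF P]) simp
          fix r' :: state
          assume fr: "frame (writes (For ''i'' ''ql'' undo)) r r'"
            and val: "nats r' ''val'' = (\<lambda>u. if u \<in> nats r ''queue'' ` {..<nats r ''ql'' 0} then 0 else nats r ''val'' u)"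
          have "nats r' ''conf'' 0 \<noteq> 0" using fr b by (simp add: frame_def undo_def)
          moreover have "nats r' ''val'' = ?f0" unfolding val by (rule propagation_undo[OF P])
          moreover have "\<tau> v \<noteq> c" if "assigns n block (clash g) v \<tau>" for \<tau>
            using propagation_conflict[OF P _ that] b by simp
          ultimately show "attempt_post g ?f0 v c r'" by (simp add: attempt_post_def)
        qed
      next
        assume "\<not> bval ?b r"
        then have conf: "nats r ''conf'' 0 = 0" by simp
        have "attempt_post g ?f0 v c r"
          using propagation_final[OF P[unfolded conf] f0(1)] conf by (simp add: attempt_post_def)
        then show "runs Skip r ?T (attempt_post g ?f0 v c)" by (intro runs_loop_freeI) simp_all
      qed
    qed
  qed
  moreover have "max_cost (start c) + (propagate_cost * n * block_size v + (1 + bcost ?b + ?T))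
      \<le> attempt_cost c * n * block_size v"
  proof -
    have "a + (p * x * y + (1 + bcost ?b + (9 + y * (12 + e)))) \<le> (a + p + 50 + e) * x * y"
      if "0 < x" "0 < y" for a p e x y :: nat
    proof -
      obtain x' y' where "x = Suc x'" "y = Suc y'" using \<open>0 < x\<close> \<open>0 < y\<close> by (metis gr0_implies_Suc)
      then show ?thesis by (simp add: algebra_simps)
    qed
    moreover have "0 < block_size v" using v B_refl by (auto simp: card_gt_0_iff)
    ultimately show ?thesis using v unfolding attempt_cost_def by simp
  qed
  ultimately show ?thesis by (rule runs_conseq)
qed

end

section \<open>Trying every guess on every block\<close>

definition solve_all :: com where
  "solve_all = For ''v'' ''n'' solve_vertex"

definition clear :: com where
  "clear = Seq (NSet ''val'' (scalar ''v'') (NLit 0)) (NSet ''bad'' (scalar ''v'') (NLit 0))"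

text \<open>A block solved under an earlier guess is left alone, since solutions for different
  guesses must not be mixed within a block.\<close>

definition record_value :: com where
  "record_value = Cond (BAnd (NLess (NLit 0) (NGet ''act'' (scalar ''v'')))
      (BAnd (NEq (NGet ''bad'' (scalar ''v'')) (NLit 0)) (NEq (NGet ''sol'' (scalar ''v'')) (NLit 0))))
    (NSet ''sol'' (scalar ''v'') (NGet ''val'' (scalar ''v''))) Skip"

text \<open>Guesses are unrolled into the program text, so loading one costs a constant independent
  of the input.\<close>

primrec load_from :: "nat \<Rightarrow> nat list \<Rightarrow> com" where
  "load_from i [] = Skip"
| "load_from i (x # xs) = Seq (NSet ''g'' (NLit i) (NLit x)) (load_from (Suc i) xs)"

definition try_guess :: "nat list \<Rightarrow> com" where
  "try_guess gs = Seq (load_from 0 gs) (Seq (For ''v'' ''n'' clear) (Seq solve_all (For ''v'' ''n'' record_value)))"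

primrec try_guesses :: "nat list list \<Rightarrow> com" where
  "try_guesses [] = Skip"
| "try_guesses (gs # gss) = Seq (try_guess gs) (try_guesses gss)"

lemma loop_free_load: "loop_free (load_from i gs)"
  by (induction gs arbitrary: i) auto

lemma writes_load: "writes (load_from i gs) \<subseteq> {''g''}"
  by (induction gs arbitrary: i) auto

lemma effect_load:
  "nats (effect (load_from i gs) s) ''g'' j =
    (if i \<le> j \<and> j < i + length gs then gs ! (j - i) else nats s ''g'' j)"
proof (induction gs arbitrary: i s)
  case (Cons x gs)
  then show ?case by (auto simp: update_simps nth_Cons')
qed simp

lemma writes_solve_all:
  "writes solve_all = {''v'', ''bad'', ''u'', ''w'', ''val'', ''conf'', ''queue'', ''ql'', ''hd'', ''i''}"
  by (auto simp: solve_all_def solve_vertex_def mark_bad_def writes_attempt)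

definition solver_names :: "name set" where
  "solver_names = {''g'', ''v'', ''bad'', ''u'', ''w'', ''val'', ''conf'', ''queue'', ''ql'', ''hd'', ''i'', ''sol''}"

lemma writes_try_guess: "writes (try_guess gs) \<subseteq> solver_names"
  using writes_load[of 0 gs]
  by (auto simp: try_guess_def clear_def record_value_def writes_solve_all solver_names_def)

definition solve_cost :: nat where
  "solve_cost = attempt_cost 1 + attempt_cost 2 + 40 + max_cost mark_bad"

context blocks
begin

text \<open>Marks are constant on blocks: once all vertices have been visited, an active block is
  refuted as a whole or fully assigned. A refuted block may keep partial values, but these are not
  recorded.\<close>

definition vertex_inv :: "(nat \<Rightarrow> nat) \<Rightarrow> nat \<Rightarrow> state \<Rightarrow> bool" where
  "vertex_inv g j s \<longleftrightarrow> closed_assignment n (clash g) (nats s ''val'') \<and>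
     (\<forall>u<n. \<forall>w<n. block u w \<longrightarrow> nats s ''bad'' u = nats s ''bad'' w) \<and>
     (\<forall>u<n. nats s ''bad'' u \<noteq> 0 \<longrightarrow> (\<forall>\<tau>. \<not> assigns n block (clash g) u \<tau>)) \<and>
     (\<forall>u<j. 0 < act u \<longrightarrow> nats s ''val'' u \<noteq> 0 \<or> nats s ''bad'' u \<noteq> 0)"

lemma vertex_inv_frame:
  "frame M s s' \<Longrightarrow> M \<inter> {''val'', ''bad''} = {} \<Longrightarrow> vertex_inv g j s \<Longrightarrow> vertex_inv g j s'"
proof -
  assume fr: "frame M s s'" and M: "M \<inter> {''val'', ''bad''} = {}"
  have "nats s' a = nats s a" if "a \<in> {''val'', ''bad''}" for a
    using fr M that by (intro frame_nats) blast+
  then show "vertex_inv g j s \<Longrightarrow> vertex_inv g j s'" by (simp add: vertex_inv_def)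
qed

lemma runs_mark_bad:
  assumes s: "has_blocks s" and v: "nats s ''v'' 0 = v"
  shows "runs (For ''w'' ''n'' mark_bad) s (9 + n * (12 + max_cost mark_bad))
    (\<lambda>s'. nats s' ''bad'' = (\<lambda>w. if w < n \<and> block v w then 1 else nats s ''bad'' w))"
proof (rule runs_conseq[OF runs_For[where N = n and T = "\<lambda>_. max_cost mark_bad"
      and I = "\<lambda>k s'. nats s' ''bad'' = (\<lambda>w. if w < k \<and> block v w then 1 else nats s ''bad'' w)"]])
  fix k and s' :: state
  assume fr: "frame (insert ''w'' (writes mark_bad)) s s'" and w: "nats s' ''w'' 0 = k"
    and inv: "nats s' ''bad'' = (\<lambda>w. if w < k \<and> block v w then 1 else nats s ''bad'' w)"
  have s': "has_blocks s'" by (rule has_blocks_frame[OF s fr]) (simp add: mark_bad_def)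
  have "nats s' ''v'' 0 = v" using fr v by (simp add: frame_def mark_bad_def)
  then have "bval (same_block (scalar ''v'') (scalar ''w'')) s' \<longleftrightarrow> block v k"
    using bval_same_block[OF s'] w by simp
  then show "runs mark_bad s' (max_cost mark_bad)
      (\<lambda>s'. nats s' ''bad'' = (\<lambda>w. if w < Suc k \<and> block v w then 1 else nats s ''bad'' w))"
    using inv w by (intro runs_loop_freeI) (auto simp: mark_bad_def update_simps less_Suc_eq fun_eq_iff)
qed (use s in \<open>auto simp: mark_bad_def frame_def has_blocks_def has_input_def\<close>)

text \<open>Each vertex is attempted at most once per colour under a guess, whether or not its block
  has been refuted already, so summing block sizes bounds the total.\<close>

lemma runs_solve_vertex:
  assumes s: "has_blocks s" "nats s ''g'' = g" and v: "v < n" "nats s ''v'' 0 = v" and inv: "vertex_inv g v s"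
  shows "runs solve_vertex s (if 0 < act v then 24 + solve_cost * n * block_size v else 24) (vertex_inv g (Suc v))"
proof -
  let ?b = "BAnd (NLess (NLit 0) (NGet ''act'' (scalar ''v''))) (NEq (NGet ''val'' (scalar ''v'')) (NLit 0))"
  let ?f = "nats s ''val''" and ?bad = "nats s ''bad''" and ?c = "NLess (NLit 0) (scalar ''conf'')"
  let ?fail = "Cond ?c (For ''w'' ''n'' mark_bad) Skip"
  have b: "bval ?b s \<longleftrightarrow> 0 < act v \<and> ?f v = 0" using s v by (simp add: has_blocks_def)
  have cost_b: "1 + bcost ?b = 20" by (simp add: NEq_def)
  have closed: "closed_assignment n (clash g) ?f" using inv by (simp add: vertex_inv_def)
  have success: "vertex_inv g (Suc v) s'"
    if post: "attempt_post g ?f v c s'" and conf: "nats s' ''conf'' 0 = 0" and c: "c \<noteq> 0" and bad: "nats s' ''bad'' = ?bad"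
    for c and s' :: state
  proof -
    have *: "closed_assignment n (clash g) (nats s' ''val'')" "nats s' ''val'' v = c"
      "\<And>u. ?f u \<noteq> 0 \<Longrightarrow> nats s' ''val'' u = ?f u"
      using post conf by (auto simp: attempt_post_def)
    have "nats s' ''val'' u \<noteq> 0 \<or> ?bad u \<noteq> 0" if "u < Suc v" "0 < act u" for u
    proof (cases "u = v")
      case False
      then have "?f u \<noteq> 0 \<or> ?bad u \<noteq> 0" using inv that by (simp add: vertex_inv_def)
      then show ?thesis using *(3)[of u] by auto
    qed (use * c in simp)
    then show ?thesis using inv * bad by (simp add: vertex_inv_def)
  qed
  show ?thesis
  proof (cases "bval ?b s")
    case False
    have "runs solve_vertex s (1 + bcost ?b + 1) (vertex_inv g (Suc v))" unfolding solve_vertex_def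
    proof (rule runs_Cond)
      have "?f v \<noteq> 0 \<or> \<not> 0 < act v" using False[unfolded b] by auto
      then have "vertex_inv g (Suc v) s" using inv by (auto simp: vertex_inv_def less_Suc_eq)
      then show "runs Skip s 1 (vertex_inv g (Suc v))" by (intro runs_loop_freeI) simp_all
    qed (use False in simp)
    then show ?thesis by (rule runs_conseq) (use cost_b in simp_all)
  next
    case True
    then have fv: "?f v = 0" and act: "0 < act v" unfolding b by blast+
    let ?k = "block_size v"
    let ?M = "9 + n * (12 + max_cost mark_bad)"
    let ?A = "attempt_cost 2 * n * ?k + (1 + bcost ?c + ?M)"
    have "runs solve_vertex s (1 + bcost ?b + (attempt_cost 1 * n * ?k + (1 + bcost ?c + ?A))) (vertex_inv g (Suc v))"
      unfolding solve_vertex_def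
    proof (rule runs_Cond)
      have "runs (attempt 1) s (attempt_cost 1 * n * ?k) (attempt_post g ?f v 1)"
        by (rule runs_attempt[OF s v closed fv]) simp
      then show "runs (Seq (attempt 1) (Cond ?c (Seq (attempt 2) ?fail) Skip)) s (attempt_cost 1 * n * ?k + (1 + bcost ?c + ?A)) (vertex_inv g (Suc v))"
      proof (rule runs_Seq)
        fix s1 :: state
        assume fr1: "frame (writes (attempt 1)) s s1" and post1: "attempt_post g ?f v 1 s1"
        have s1: "has_blocks s1" by (rule has_blocks_frame[OF s(1) fr1]) (simp add: writes_attempt)
        have keep1: "nats s1 ''g'' = g" "nats s1 ''v'' 0 = v" "nats s1 ''bad'' = ?bad"
          using fr1 s v by (simp_all add: frame_def writes_attempt)
        show "runs (Cond ?c (Seq (attempt 2) ?fail) Skip) s1 (1 + bcost ?c + ?A) (vertex_inv g (Suc v))"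
        proof (rule runs_Cond)
          assume "\<not> bval ?c s1"
          then show "runs Skip s1 ?A (vertex_inv g (Suc v))"
            using success[OF post1 _ _ keep1(3)] by (intro runs_loop_freeI) simp_all
        next
          assume "bval ?c s1"
          then have val1: "nats s1 ''val'' = ?f" and no1: "\<And>\<tau>. assigns n block (clash g) v \<tau> \<Longrightarrow> \<tau> v \<noteq> 1"
            using post1 by (auto simp: attempt_post_def)
          have "runs (attempt 2) s1 (attempt_cost 2 * n * ?k) (attempt_post g (nats s1 ''val'') v 2)"
            by (rule runs_attempt[OF s1 keep1(1) v(1) keep1(2)]) (use closed fv val1 in simp_all)
          then show "runs (Seq (attempt 2) ?fail) s1 ?A (vertex_inv g (Suc v))"
          proof (rule runs_Seq)
            fix s2 :: state
            assume fr2: "frame (writes (attempt 2)) s1 s2" and "attempt_post g (nats s1 ''val'') v 2 s2"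
            then have post2: "attempt_post g ?f v 2 s2" by (simp add: val1)
            have s2: "has_blocks s2" by (rule has_blocks_frame[OF s1 fr2]) (simp add: writes_attempt)
            have keep2: "nats s2 ''g'' = g" "nats s2 ''v'' 0 = v" "nats s2 ''bad'' = ?bad"
              using fr2 keep1 by (simp_all add: frame_def writes_attempt)
            show "runs ?fail s2 (1 + bcost ?c + ?M) (vertex_inv g (Suc v))"
            proof (rule runs_Cond)
              assume "\<not> bval ?c s2"
              then show "runs Skip s2 ?M (vertex_inv g (Suc v))"
                using success[OF post2 _ _ keep2(3)] by (intro runs_loop_freeI) simp_all
            next
              assume "bval ?c s2"
              then have val2: "nats s2 ''val'' = ?f" and no2: "\<And>\<tau>. assigns n block (clash g) v \<tau> \<Longrightarrow> \<tau> v \<noteq> 2"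
                using post2 by (auto simp: attempt_post_def)
              have no: "\<not> assigns n block (clash g) v \<tau>" for \<tau>
              proof
                assume a: "assigns n block (clash g) v \<tau>"
                then have "\<tau> v \<in> {1, 2}" using v(1) B_refl unfolding assigns_def by blast
                then show False using no1[OF a] no2[OF a] by blast
              qed
              show "runs (For ''w'' ''n'' mark_bad) s2 ?M (vertex_inv g (Suc v))"
              proof (rule runs_conseq[OF runs_mark_bad[OF s2 keep2(2)]])
                fix s3 :: state
                assume fr3: "frame (writes (For ''w'' ''n'' mark_bad)) s2 s3"
                  and "nats s3 ''bad'' = (\<lambda>w. if w < n \<and> block v w then 1 else nats s2 ''bad'' w)"
                then have bad3: "nats s3 ''bad'' = (\<lambda>w. if w < n \<and> block v w then 1 else ?bad w)"
                  by (simp only: keep2(3))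
                have val3: "nats s3 ''val'' = ?f" using fr3 val2 by (simp add: frame_def mark_bad_def)
                have 1: "nats s3 ''bad'' u = nats s3 ''bad'' w" if "u < n" "w < n" "block u w" for u w
                proof -
                  have "block v u \<longleftrightarrow> block v w" using that(3) B_sym B_trans by blast
                  moreover have "?bad u = ?bad w" using inv that by (simp add: vertex_inv_def)
                  ultimately show ?thesis using that by (simp add: bad3)
                qed
                have 2: "\<not> assigns n block (clash g) u \<tau>" if "u < n" "nats s3 ''bad'' u \<noteq> 0" for u \<tau>
                proof (cases "block v u")
                  case True
                  then show ?thesis using no assigns_cong[OF True] by blast
                next
                  case False
                  then have "?bad u \<noteq> 0" using that by (simp add: bad3)
                  then show ?thesis using inv that(1) by (simp add: vertex_inv_def)
                qed
                have 3: "nats s3 ''val'' u \<noteq> 0 \<or> nats s3 ''bad'' u \<noteq> 0" if "u < Suc v" "0 < act u" for u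
                proof (cases "u = v")
                  case True
                  then show ?thesis using v(1) B_refl by (simp add: bad3)
                next
                  case False
                  then have "?f u \<noteq> 0 \<or> ?bad u \<noteq> 0" using inv that by (simp add: vertex_inv_def)
                  then show ?thesis by (auto simp: bad3 val3)
                qed
                show "vertex_inv g (Suc v) s3" using 1 2 3 closed unfolding vertex_inv_def val3 by blast
              qed simp
            qed
          qed
        qed
      qed
    qed (use True in simp)
    moreover have "1 + bcost ?b + (attempt_cost 1 * n * ?k + (1 + bcost ?c + ?A)) \<le> 24 + solve_cost * n * ?k"
    proof -
      have "20 + (a * x * y + (1 + bcost ?c + (a' * x * y + (1 + bcost ?c + (9 + x * (12 + m)))))) \<le> 24 + (a + a' + 40 + m) * x * y"
        if "0 < x" "0 < y" for a a' m x y :: nat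
      proof -
        obtain x' y' where "x = Suc x'" "y = Suc y'" using \<open>0 < x\<close> \<open>0 < y\<close> by (metis gr0_implies_Suc)
        then show ?thesis by (simp add: algebra_simps)
      qed
      moreover have "0 < block_size v" using v B_refl by (auto simp: card_gt_0_iff)
      ultimately show ?thesis using v unfolding solve_cost_def cost_b by simp
    qed
    ultimately show ?thesis using act by (auto elim: runs_conseq)
  qed
qed

end

definition guess_cost :: "nat list \<Rightarrow> nat" where
  "guess_cost gs = max_cost (load_from 0 gs) + max_cost clear + 90 + 144 * solve_cost + max_cost record_value"

lemma clustered_cong:
  assumes f: "clustered A V f" and eq: "\<And>u. u \<in> V \<Longrightarrow> f' u = f u"
  shows "clustered A V f'"
  unfolding clustered_def
proof (intro ballI impI)
  fix a b c assume "a \<in> V" "b \<in> V" "c \<in> V" "f' a = f' b" "f' b = f' c" "A a b" "A b c"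
  then show "A a c" using clusteredD[OF f, of a b c] eq by simp
qed

context blocks
begin

text \<open>Here 36 is 12 for a round of the loop plus the constant 24 of a visit; the rest is
  summed over active vertices only, with \<open>P\<close> bounding the pairs in a common
  block.\<close>

lemma runs_solve_all:
  assumes act: "\<And>v. 0 < act v \<longleftrightarrow> v \<in> active" and pairs: "(\<Sum>v\<in>active. block_size v) \<le> P"
    and s: "has_blocks s" "nats s ''g'' = g" and inv: "vertex_inv g 0 s"
  shows "runs solve_all s (9 + n * 36 + solve_cost * n * P) (vertex_inv g n)"
proof -
  define T where "T v = (if 0 < act v then 24 + solve_cost * n * block_size v else 24)" for v
  have "runs solve_all s (9 + (\<Sum>v<n. 12 + T v)) (vertex_inv g n)"
    unfolding solve_all_def
  proof (rule runs_For[where I = "vertex_inv g"])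
    fix k and s' :: state
    assume k: "k < n" and fr: "frame (insert ''v'' (writes solve_vertex)) s s'" and v: "nats s' ''v'' 0 = k"
      and inv: "vertex_inv g k s'"
    have fr': "frame (writes solve_all) s s'" using fr by (simp add: solve_all_def)
    have s': "has_blocks s'" by (rule has_blocks_frame[OF s(1) fr']) (simp add: writes_solve_all)
    have "nats s' ''g'' = g" using fr' s(2) by (simp add: frame_def writes_solve_all)
    from runs_solve_vertex[OF s' this k v inv] show "runs solve_vertex s' (T k) (vertex_inv g (Suc k))"
      unfolding T_def .
  next
    fix k and s' s'' :: state
    assume "frame {''v''} s' s''" "vertex_inv g k s'"
    then show "vertex_inv g k s''" using vertex_inv_frame[of "{''v''}" s' s'' g k] by simp
  qed (use inv s in \<open>auto simp: has_blocks_def has_input_def solve_vertex_def mark_bad_def writes_attempt\<close>)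
  moreover have "9 + (\<Sum>v<n. 12 + T v) \<le> 9 + n * 36 + solve_cost * n * P"
  proof -
    have "(\<Sum>v<n. 12 + T v) = (\<Sum>v<n. 36 + (if v \<in> active then solve_cost * n * block_size v else 0))"
      by (intro sum.cong) (auto simp: T_def act)
    also have "\<dots> = n * 36 + (\<Sum>v\<in>{v \<in> {..<n}. v \<in> active}. solve_cost * n * block_size v)"
      unfolding sum.distrib by (subst sum.inter_filter[symmetric]) simp_all
    also have "{v \<in> {..<n}. v \<in> active} = active" using active_bound by auto
    also have "(\<Sum>v\<in>active. solve_cost * n * block_size v) = solve_cost * n * (\<Sum>v\<in>active. block_size v)"
      by (simp add: sum_distrib_left)
    also have "\<dots> \<le> solve_cost * n * P" using pairs by (rule mult_left_mono) simp
    finally show ?thesis by simp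
  qed
  ultimately show ?thesis by (rule runs_conseq)
qed

lemma runs_clear:
  assumes s: "has_blocks s"
  shows "runs (For ''v'' ''n'' clear) s (9 + n * (12 + max_cost clear)) (vertex_inv g 0)"
proof (rule runs_conseq[OF runs_For[where N = n and T = "\<lambda>_. max_cost clear"
      and I = "\<lambda>k s'. \<forall>v<k. nats s' ''val'' v = 0 \<and> nats s' ''bad'' v = 0"]])
  fix k and s' :: state
  assume "nats s' ''v'' 0 = k" "\<forall>v<k. nats s' ''val'' v = 0 \<and> nats s' ''bad'' v = 0"
  then show "runs clear s' (max_cost clear) (\<lambda>s'. \<forall>v<Suc k. nats s' ''val'' v = 0 \<and> nats s' ''bad'' v = 0)"
    by (intro runs_loop_freeI) (auto simp: clear_def update_simps less_Suc_eq)
next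
  fix s' :: state
  assume "\<forall>v<n. nats s' ''val'' v = 0 \<and> nats s' ''bad'' v = 0"
  then show "vertex_inv g 0 s'" by (simp add: vertex_inv_def closed_assignment_def)
qed (use s in \<open>auto simp: clear_def frame_def has_blocks_def has_input_def\<close>)

lemma runs_record:
  assumes s: "has_blocks s"
  shows "runs (For ''v'' ''n'' record_value) s (9 + n * (12 + max_cost record_value)) (\<lambda>s'. nats s' ''sol'' =
    (\<lambda>v. if v < n \<and> 0 < act v \<and> nats s ''bad'' v = 0 \<and> nats s ''sol'' v = 0 then nats s ''val'' v else nats s ''sol'' v))"
proof -
  define R where "R k = (\<lambda>v. if v < k \<and> 0 < act v \<and> nats s ''bad'' v = 0 \<and> nats s ''sol'' v = 0
    then nats s ''val'' v else nats s ''sol'' v)" for k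
  have "runs (For ''v'' ''n'' record_value) s (9 + (\<Sum>v<n. 12 + max_cost record_value)) (\<lambda>s'. nats s' ''sol'' = R n)"
  proof (rule runs_For[where I = "\<lambda>k s'. nats s' ''sol'' = R k"])
    fix k and s' :: state
    assume fr: "frame (insert ''v'' (writes record_value)) s s'" and v: "nats s' ''v'' 0 = k" and sol: "nats s' ''sol'' = R k"
    have "has_blocks s'" by (rule has_blocks_frame[OF s fr]) (simp add: record_value_def)
    then have "nats s' ''act'' = act" by (simp add: has_blocks_def)
    moreover have "nats s' ''bad'' = nats s ''bad''" "nats s' ''val'' = nats s ''val''"
      using fr by (simp_all add: frame_def record_value_def)
    moreover have "R k k = nats s ''sol'' k" by (simp add: R_def)
    moreover have "R (Suc k) = (R k)(k := if 0 < act k \<and> nats s ''bad'' k = 0 \<and> nats s ''sol'' k = 0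
      then nats s ''val'' k else nats s ''sol'' k)"
      by (auto simp: R_def fun_eq_iff less_Suc_eq)
    ultimately have "nats (effect record_value s') ''sol'' = R (Suc k)"
      using v sol by (auto simp: record_value_def update_simps fun_eq_iff)
    then show "runs record_value s' (max_cost record_value) (\<lambda>s'. nats s' ''sol'' = R (Suc k))"
      by (intro runs_loop_freeI) (simp_all add: record_value_def)
  qed (use s in \<open>auto simp: record_value_def frame_def has_blocks_def has_input_def R_def\<close>)
  then show ?thesis by (rule runs_conseq) (simp_all add: R_def)
qed

text \<open>A block is solved entirely or not at all. The refutation is stated for some
  \<open>g\<close> that extends the guess because loading fixes only the first 36 entries of the
  array.\<close>

definition progress :: "nat list set \<Rightarrow> state \<Rightarrow> bool" where
  "progress D s \<longleftrightarrow> (\<forall>v<n. 0 < act v \<longrightarrow>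
     (\<forall>u<n. block v u \<longrightarrow> nats s ''sol'' u = 0) \<and>
       (\<forall>gs\<in>D. \<exists>g. (\<forall>i<36. g i = gs ! i) \<and> (\<forall>\<tau>. \<not> assigns n block (clash g) v \<tau>)) \<or>
     (\<forall>u<n. block v u \<longrightarrow> nats s ''sol'' u \<in> {1, 2}) \<and>
       clustered (near center) {u. u < n \<and> block v u} (nats s ''sol''))"

text \<open>A clash between two vertices of equal colour would force opposite values. So inside a
  colour adjacency coincides with equality of \<open>g\<close>-values, which is transitive.\<close>

lemma closed_assignment_clustered:
  assumes closed: "closed_assignment n (clash g) f" and pos: "\<And>u. u < n \<Longrightarrow> block v u \<Longrightarrow> f u \<noteq> 0"
  shows "clustered (near center) {u. u < n \<and> block v u} f"
  unfolding clustered_def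
proof (intro ballI impI)
  fix a b c
  assume mem: "a \<in> {u. u < n \<and> block v u}" "b \<in> {u. u < n \<and> block v u}" "c \<in> {u. u < n \<and> block v u}"
    and eq: "f a = f b" "f b = f c" and near: "near center a b" "near center b c"
  have match: "g (ce x + f x) = g (ce y + f x) \<longleftrightarrow> near center x y"
    if "x < n" "y < n" "block v x" "block v y" "f x = f y" for x y
  proof (rule ccontr)
    assume "\<not> ?thesis"
    moreover have "block x y" using that B_sym B_trans by blast
    ultimately have "clash g (f x) x y" by (auto simp: mismatch_def)
    then have "f y = 3 - f x" using closed_assignmentD(2)[OF closed] that pos by blast
    moreover have "f x \<le> 2" "f x \<noteq> 0" using closed_assignmentD(1)[OF closed] that pos by blast+
    ultimately show False using that(5) by presburger
  qed
  have "g (ce a + f a) = g (ce b + f a)" using match[of a b] mem eq near by simp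
  moreover have "g (ce b + f a) = g (ce c + f a)" using match[of b c] mem eq near by simp
  ultimately show "near center a c" using match[of a c] mem eq by simp
qed

lemma runs_try_guess:
  assumes act: "\<And>v. 0 < act v \<longleftrightarrow> v \<in> active"
    and pairs: "(\<Sum>v\<in>active. block_size v) \<le> 144 * length es"
    and s: "has_blocks s" and D: "progress D s" and gs: "length gs = 36"
  shows "runs (try_guess gs) s (guess_cost gs * n * length es) (progress (insert gs D))"
proof -
  define s0 where "s0 = effect (load_from 0 gs) s"
  define g where "g = nats s0 ''g''"
  have g: "\<forall>i<36. g i = gs ! i" unfolding g_def s0_def effect_load using gs by simp
  obtain t0 where "exec (load_from 0 gs) s t0 s0"
    using runs_loop_free[OF loop_free_load] unfolding runs_def s0_def by blast
  then have fr0: "frame {''g''} s s0" by (rule exec_frame[THEN frame_mono]) (rule writes_load)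
  have s0: "has_blocks s0" by (rule has_blocks_frame[OF s fr0]) simp
  let ?C = "9 + n * (12 + max_cost clear)" and ?S = "9 + n * 36 + solve_cost * n * (144 * length es)"
    and ?R = "9 + n * (12 + max_cost record_value)"
  have "runs (try_guess gs) s (max_cost (load_from 0 gs) + (?C + (?S + ?R))) (progress (insert gs D))"
    unfolding try_guess_def
  proof (rule runs_Seq_loop_free[OF loop_free_load])
    show "runs (Seq (For ''v'' ''n'' clear) (Seq solve_all (For ''v'' ''n'' record_value)))
      (effect (load_from 0 gs) s) (?C + (?S + ?R)) (progress (insert gs D))"
      unfolding s0_def[symmetric]
    proof (rule runs_Seq[OF runs_clear[OF s0, of g]])
      fix s1 :: state
      assume fr1: "frame (writes (For ''v'' ''n'' clear)) s0 s1" and inv1: "vertex_inv g 0 s1"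
      have s1: "has_blocks s1" by (rule has_blocks_frame[OF s0 fr1]) (simp add: clear_def)
      have g1: "nats s1 ''g'' = g" using fr1 by (simp add: frame_def clear_def g_def)
      show "runs (Seq solve_all (For ''v'' ''n'' record_value)) s1 (?S + ?R) (progress (insert gs D))"
      proof (rule runs_Seq[OF runs_solve_all[OF act pairs s1 g1 inv1]])
        fix s2 :: state
        assume fr2: "frame (writes solve_all) s1 s2" and inv2: "vertex_inv g n s2"
        have s2: "has_blocks s2" by (rule has_blocks_frame[OF s1 fr2]) (simp add: writes_solve_all)
        have sol2: "nats s2 ''sol'' = nats s ''sol''"
          using fr0 fr1 fr2 by (simp add: frame_def writes_solve_all clear_def)
        let ?f = "nats s2 ''val''" and ?bad = "nats s2 ''bad''" and ?sol = "nats s ''sol''"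
        have closed: "closed_assignment n (clash g) ?f"
          and bad_cong: "\<And>u w. u < n \<Longrightarrow> w < n \<Longrightarrow> block u w \<Longrightarrow> ?bad u = ?bad w"
          and bad_no: "\<And>u \<tau>. u < n \<Longrightarrow> ?bad u \<noteq> 0 \<Longrightarrow> \<not> assigns n block (clash g) u \<tau>"
          and good: "\<And>u. u < n \<Longrightarrow> 0 < act u \<Longrightarrow> ?f u \<noteq> 0 \<or> ?bad u \<noteq> 0"
          using inv2 unfolding vertex_inv_def by blast+
        show "runs (For ''v'' ''n'' record_value) s2 ?R (progress (insert gs D))"
        proof (rule runs_conseq[OF runs_record[OF s2]])
          fix s3 :: state
          assume "nats s3 ''sol'' = (\<lambda>v. if v < n \<and> 0 < act v \<and> ?bad v = 0 \<and> nats s2 ''sol'' v = 0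
            then ?f v else nats s2 ''sol'' v)"
          then have sol3: "nats s3 ''sol'' v = (if v < n \<and> 0 < act v \<and> ?bad v = 0 \<and> ?sol v = 0 then ?f v else ?sol v)" for v
            by (simp add: sol2)
          show "progress (insert gs D) s3" unfolding progress_def
          proof (intro allI impI)
            fix v assume v: "v < n" "0 < act v"
            have act_block: "0 < act u" if "block v u" for u using that v by (simp add: block_def)
            have bad_block: "?bad u = ?bad v" if "block v u" "u < n" for u using bad_cong[OF v(1) that(2,1)] by simp
            consider (zero) "\<forall>u<n. block v u \<longrightarrow> ?sol u = 0"
                "\<forall>gs\<in>D. \<exists>g. (\<forall>i<36. g i = gs ! i) \<and> (\<forall>\<tau>. \<not> assigns n block (clash g) v \<tau>)"
              | (solved) "\<forall>u<n. block v u \<longrightarrow> ?sol u \<in> {1, 2}" "clustered (near center) {u. u < n \<and> block v u} ?sol"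
              using D v unfolding progress_def by blast
            then show "(\<forall>u<n. block v u \<longrightarrow> nats s3 ''sol'' u = 0) \<and>
                (\<forall>gs\<in>insert gs D. \<exists>g. (\<forall>i<36. g i = gs ! i) \<and> (\<forall>\<tau>. \<not> assigns n block (clash g) v \<tau>)) \<or>
              (\<forall>u<n. block v u \<longrightarrow> nats s3 ''sol'' u \<in> {1, 2}) \<and>
                clustered (near center) {u. u < n \<and> block v u} (nats s3 ''sol'')"
            proof cases
              case zero
              show ?thesis
              proof (cases "?bad v = 0")
                case False
                then have "\<forall>u<n. block v u \<longrightarrow> nats s3 ''sol'' u = 0"
                  using zero(1) bad_block by (simp add: sol3)
                moreover have "\<exists>g. (\<forall>i<36. g i = gs ! i) \<and> (\<forall>\<tau>. \<not> assigns n block (clash g) v \<tau>)"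
                  using g bad_no[OF v(1) False] by blast
                ultimately show ?thesis using zero(2) by blast
              next
                \<comment> \<open>The block is not refuted, so all its vertices carry values, and
                  \<open>sol\<close> is still 0 on all of it: the recorded values come from this one
                  guess.\<close>
                case True
                have eq: "nats s3 ''sol'' u = ?f u" if "u < n" "block v u" for u
                  using that zero(1) bad_block True act_block by (simp add: sol3)
                have pos: "?f u \<noteq> 0" if "u < n" "block v u" for u
                  using good[OF that(1) act_block[OF that(2)]] bad_block[OF that(2,1)] True by simp
                have "nats s3 ''sol'' u \<in> {1, 2}" if "u < n" "block v u" for u
                proof -
                  have "?f u \<le> 2" "?f u \<noteq> 0" using closed_assignmentD(1)[OF closed that(1)] pos[OF that] by auto
                  then show ?thesis unfolding eq[OF that] by auto
                qed
                moreover have "clustered (near center) {u. u < n \<and> block v u} (nats s3 ''sol'')"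
                  by (rule clustered_cong[OF closed_assignment_clustered[OF closed pos]]) (simp_all add: eq)
                ultimately show ?thesis by blast
              qed
            next
              case solved
              have eq: "nats s3 ''sol'' u = ?sol u" if "u < n" "block v u" for u
                using that solved(1) by (auto simp: sol3)
              have "clustered (near center) {u. u < n \<and> block v u} (nats s3 ''sol'')"
                by (rule clustered_cong[OF solved(2)]) (simp add: eq)
              then show ?thesis using solved(1) eq by simp
            qed
          qed
        qed simp
      qed
    qed
  qed
  moreover have "max_cost (load_from 0 gs) + (?C + (?S + ?R)) \<le> guess_cost gs * n * length es"
  proof -
    have "a + (9 + x * (12 + b) + (9 + x * 36 + c * x * (144 * y) + (9 + x * (12 + d)))) \<le>
      (a + b + 90 + 144 * c + d) * x * y" if "0 < x" "0 < y" for a b c d x y :: nat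
    proof -
      obtain x' y' where "x = Suc x'" "y = Suc y'" using \<open>0 < x\<close> \<open>0 < y\<close> by (metis gr0_implies_Suc)
      then show ?thesis by (simp add: algebra_simps)
    qed
    then show ?thesis using n_pos m_pos unfolding guess_cost_def by blast
  qed
  ultimately show ?thesis by (rule runs_conseq)
qed

lemma runs_try_guesses:
  assumes act: "\<And>v. 0 < act v \<longleftrightarrow> v \<in> active"
    and pairs: "(\<Sum>v\<in>active. block_size v) \<le> 144 * length es"
    and s: "has_blocks s" and D: "progress D s" and gss: "\<forall>gs\<in>set gss. length gs = 36"
  shows "runs (try_guesses gss) s ((1 + sum_list (map guess_cost gss)) * n * length es) (progress (D \<union> set gss))"
  using s D gss
proof (induction gss arbitrary: s D)
  case Nil
  have "1 \<le> n * length es" using n_pos m_pos by (simp add: Suc_le_eq)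
  then show ?case using Nil by (intro runs_loop_freeI) simp_all
next
  case (Cons gs gss)
  let ?T = "(1 + sum_list (map guess_cost gss)) * n * length es"
  have "runs (try_guesses (gs # gss)) s (guess_cost gs * n * length es + ?T) (progress (insert gs D \<union> set gss))"
    unfolding try_guesses.simps
  proof (rule runs_Seq)
    show "runs (try_guess gs) s (guess_cost gs * n * length es) (progress (insert gs D))"
      by (rule runs_try_guess[OF act pairs]) (use Cons.prems in simp_all)
    fix s' :: state
    assume fr: "frame (writes (try_guess gs)) s s'" and D': "progress (insert gs D) s'"
    have "frame solver_names s s'" using fr writes_try_guess by (rule frame_mono)
    then have "has_blocks s'" by (rule has_blocks_frame[OF Cons.prems(1)]) (simp add: solver_names_def)
    from Cons.IH[OF this D'] show "runs (try_guesses gss) s' ?T (progress (insert gs D \<union> set gss))"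
      using Cons.prems by simp
  qed
  then show ?case by (rule runs_conseq) (simp_all add: algebra_simps)
qed

end

section \<open>The colouring\<close>

definition check_solved :: com where
  "check_solved = Cond (BAnd (NLess (NLit 0) (NGet ''act'' (scalar ''v''))) (NEq (NGet ''sol'' (scalar ''v'')) (NLit 0)))
    (set_scalar ''fail'' (NLit 1)) Skip"

text \<open>Brick colour p owns the colours 2 p and 2 p + 1. Isolated vertices keep the initial
  colour 0, harmless because they have no neighbours.\<close>

definition paint :: com where
  "paint = Cond (NLess (NLit 0) (NGet ''act'' (scalar ''v'')))
    (Cond (NEq (scalar ''fail'') (NLit 0))
      (NSet ''color'' (scalar ''v'') (NAdd (NAdd (NGet ''pal'' (scalar ''v'')) (NGet ''pal'' (scalar ''v'')))
        (NSub (NGet ''sol'' (scalar ''v'')) (NLit 1))))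
      (NSet ''color'' (scalar ''v'') (NGet ''fb'' (scalar ''v''))))
    Skip"

definition finish :: com where
  "finish = Seq (For ''v'' ''n'' check_solved) (For ''v'' ''n'' paint)"

definition final_color :: "nat \<Rightarrow> state \<Rightarrow> nat \<Rightarrow> nat" where
  "final_color n s v = (if v < n \<and> 0 < nats s ''act'' v then
     (if \<forall>u<n. 0 < nats s ''act'' u \<longrightarrow> nats s ''sol'' u \<noteq> 0
      then nats s ''pal'' v + nats s ''pal'' v + (nats s ''sol'' v - 1) else nats s ''fb'' v) else 0)"

lemma runs_finish:
  assumes s: "nats s ''n'' 0 = n" "nats s ''fail'' 0 = 0" "nats s ''color'' = (\<lambda>_. 0)"
  shows "runs finish s (18 + n * (24 + max_cost check_solved + max_cost paint))
    (\<lambda>s'. nats s' ''color'' = final_color n s)"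
proof -
  let ?act = "nats s ''act''" and ?sol = "nats s ''sol''"
  have "runs finish s ((9 + (\<Sum>v<n. 12 + max_cost check_solved)) + (9 + (\<Sum>v<n. 12 + max_cost paint)))
    (\<lambda>s'. nats s' ''color'' = final_color n s)"
    unfolding finish_def
  proof (rule runs_Seq)
    let ?I = "\<lambda>k s'. nats s' ''fail'' 0 = 0 \<longleftrightarrow> (\<forall>u<k. 0 < ?act u \<longrightarrow> ?sol u \<noteq> 0)"
    show "runs (For ''v'' ''n'' check_solved) s (9 + (\<Sum>v<n. 12 + max_cost check_solved)) (?I n)"
    proof (rule runs_For[where I = ?I])
      fix k and s' :: state
      assume fr: "frame (insert ''v'' (writes check_solved)) s s'" and v: "nats s' ''v'' 0 = k" and inv: "?I k s'"
      have "nats s' ''act'' = ?act" "nats s' ''sol'' = ?sol"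
        using fr by (simp_all add: frame_def check_solved_def)
      then show "runs check_solved s' (max_cost check_solved) (?I (Suc k))"
        using v inv by (intro runs_loop_freeI) (auto simp: check_solved_def update_simps less_Suc_eq)
    qed (use s in \<open>auto simp: check_solved_def frame_def\<close>)
    fix s1 :: state
    assume fr: "frame (writes (For ''v'' ''n'' check_solved)) s s1" and fail: "?I n s1"
    have eqs: "nats s1 a = nats s a" if "a \<notin> {''v'', ''fail''}" for a
      using fr that by (simp add: frame_def check_solved_def)
    define F where "F k = (\<lambda>v. if v < k then final_color n s v else 0)" for k
    have "runs (For ''v'' ''n'' paint) s1 (9 + (\<Sum>v<n. 12 + max_cost paint)) (\<lambda>s'. nats s' ''color'' = F n)"
    proof (rule runs_For[where I = "\<lambda>k s'. nats s' ''color'' = F k"])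
      fix k and s' :: state
      assume k: "k < n" and fr: "frame (insert ''v'' (writes paint)) s1 s'" and v: "nats s' ''v'' 0 = k"
        and col: "nats s' ''color'' = F k"
      have "nats s' a = nats s1 a" if "a \<notin> {''v'', ''color''}" for a
        using fr that by (simp add: frame_def paint_def)
      then have eqs': "nats s' ''fail'' = nats s1 ''fail''" "nats s' ''act'' = ?act" "nats s' ''sol'' = ?sol"
        "nats s' ''pal'' = nats s ''pal''" "nats s' ''fb'' = nats s ''fb''"
        by (simp_all add: eqs)
      have "F (Suc k) = (F k)(k := final_color n s k)" by (auto simp: F_def fun_eq_iff less_Suc_eq)
      moreover have "F k k = 0" by (simp add: F_def)
      ultimately have "nats (effect paint s') ''color'' = F (Suc k)"
        using v col fail k by (auto simp: paint_def update_simps eqs' final_color_def fun_eq_iff)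
      then show "runs paint s' (max_cost paint) (\<lambda>s'. nats s' ''color'' = F (Suc k))"
        by (intro runs_loop_freeI) (simp_all add: paint_def)
    qed (use s eqs in \<open>auto simp: paint_def frame_def F_def\<close>)
    moreover have "F n = final_color n s" by (auto simp: F_def final_color_def fun_eq_iff)
    ultimately show "runs (For ''v'' ''n'' paint) s1 (9 + (\<Sum>v<n. 12 + max_cost paint))
      (\<lambda>s'. nats s' ''color'' = final_color n s)" by simp
  qed
  then show ?thesis by (rule runs_conseq) (simp_all add: algebra_simps)
qed

section \<open>The three colourings against the subchromatic number\<close>

lemma (in unit_disk_instance) subchromatic_pos: "0 < subchromatic_number {..<n} E"
proof -
  obtain f where "f ` {..<n} \<subseteq> {..<subchromatic_number {..<n} E}" using optimal_coloring[OF rep] by metis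
  then show ?thesis using n_pos by fastforce
qed

text \<open>One colour makes adjacency transitive on all vertices, so both ends of an edge see the
  same vertices.\<close>

lemma (in unit_disk_instance) cluster_if_one_color:
  assumes "subchromatic_number {..<n} E \<le> 1" "(a, b) \<in> set es" "w < n"
  shows "near center a w \<longleftrightarrow> near center b w"
proof -
  obtain f where f: "clustered (near center) {..<n} f" "f ` {..<n} \<subseteq> {..<subchromatic_number {..<n} E}"
    using optimal_coloring[OF rep] by metis
  have "f v = 0" if "v < n" for v using f(2) assms(1) that by force
  then have tr: "near center x z" if "near center x y" "near center y z" "x < n" "y < n" "z < n" for x y z
    using clusteredD[OF f(1), of x y z] that by simp
  note ab = edge_bounds[OF assms(2)]
  show ?thesis using tr[of b a w] tr[of a b w] ab assms(3) near_sym[of center a b] by blast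
qed

text \<open>Adjacency is already transitive, so every \<open>f\<close> works; the one used is the
  constant 0 left by initialisation.\<close>

lemma (in unit_disk_instance) clustered_if_cluster:
  assumes "\<forall>(a, b)\<in>set es. \<forall>w<n. near center a w \<longleftrightarrow> near center b w"
  shows "clustered (near center) {..<n} f"
  unfolding clustered_def
proof (intro ballI impI)
  fix a b c assume V: "a \<in> {..<n}" "b \<in> {..<n}" "c \<in> {..<n}" and near: "near center a b" "near center b c"
  show "near center a c"
  proof (cases "a = b")
    case False
    then have "(a, b) \<in> set es \<or> (b, a) \<in> set es" using near_edge[of a b] V near by simp
    then have "near center a c \<longleftrightarrow> near center b c" using assms V by fastforce
    then show ?thesis using near by simp
  qed (use near in simp)
qed

lemma scaled_difference: "\<bar>2 * (p - c + d) - 2 * (q - c + d)\<bar> = 2 * \<bar>p - q\<bar>" for p q c d :: real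
proof -
  have "2 * (p - c + d) - 2 * (q - c + d) = 2 * (p - q)" by (simp add: algebra_simps)
  then show ?thesis by (simp only: abs_mult abs_numeral)
qed

text \<open>A table has one entry per sum of a cell code and a colour, and its entries are cell
  codes, so 36 to the power 36 tables exhaust all guesses. The number is huge but constant.\<close>

definition all_guesses :: "nat list list" where
  "all_guesses = List.n_lists 36 [0..<36]"

locale placed_instance = unit_disk_instance +
  fixes lab br bq act ce pal fb :: "nat \<Rightarrow> nat"
  assumes labels: "component_labels n center lab" and lab_edge: "\<forall>(u, w)\<in>set es. lab u = lab w"
    and act_eq: "act = (\<lambda>v. if v \<in> active then 1 else 0)"
    and position: "\<And>v. v \<in> active \<Longrightarrow> \<exists>ly lx. brick_position
      (xpos n center v (lab v)) (ypos n center v (lab v))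
      (br v) ly (bq v) lx (pal v) \<and> ce v = 3 * lx + 12 * ly \<and> fb v = 3 * ly + (pal v + lx) mod 3"

sublocale placed_instance \<subseteq> blocks ..

context placed_instance
begin

lemma act_pos: "0 < act v \<longleftrightarrow> v \<in> active"
  by (simp add: act_eq)

lemma lab_near:
  assumes "u < n" "w < n" "near center u w"
  shows "lab u = lab w"
proof (cases "u = w")
  case False
  then show ?thesis using near_edge[OF assms(1,2) False assms(3)] lab_edge by auto
qed simp

text \<open>Equal labels mean a common reference point, which cancels; doubling turns distance 1
  into 2.\<close>

lemma near_close:
  assumes "near center u w" "lab u = lab w"
  shows "\<bar>xpos n center u (lab u) - xpos n center w (lab w)\<bar> \<le> 2"
    "\<bar>ypos n center u (lab u) - ypos n center w (lab w)\<bar> \<le> 2"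
proof -
  have "dist (fst (center u)) (fst (center w)) \<le> 1" "dist (snd (center u)) (snd (center w)) \<le> 1"
    using assms(1) dist_fst_le[of "center u" "center w"] dist_snd_le[of "center u" "center w"]
    unfolding near_def by linarith+
  then show "\<bar>xpos n center u (lab u) - xpos n center w (lab w)\<bar> \<le> 2"
    "\<bar>ypos n center u (lab u) - ypos n center w (lab w)\<bar> \<le> 2"
    unfolding dist_real_def assms(2) scaled_difference by simp_all
qed

text \<open>In a square of side 1/2 the squared distance is at most 1/4 + 1/4.\<close>

lemma same_cell_near:
  assumes pos: "brick_position (xpos n center u l) (ypos n center u l) R ly Q lx p"
    "brick_position (xpos n center w l) (ypos n center w l) R ly Q lx p'"
  shows "near center u w"
proof -
  have "\<bar>fst (center u) - fst (center w)\<bar> \<le> 1 / 2" "\<bar>snd (center u) - snd (center w)\<bar> \<le> 1 / 2"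
    using brick_position_same_cell[OF pos] unfolding scaled_difference by simp_all
  then have "(fst (center u) - fst (center w))\<^sup>2 \<le> (1 / 2)\<^sup>2" "(snd (center u) - snd (center w))\<^sup>2 \<le> (1 / 2)\<^sup>2"
    by (metis abs_le_square_iff abs_of_pos half_gt_zero_iff zero_less_one)+
  then show ?thesis unfolding near_iff by (simp add: power2_eq_square)
qed

lemma cell_bound:
  assumes "v \<in> active"
  shows "ce v < 36 \<and> 3 dvd ce v"
proof -
  obtain ly lx where "ce v = 3 * lx + 12 * ly" "ly < 3" "lx < 4"
    using position[OF assms] by (auto simp: brick_position_def)
  then show ?thesis by presburger
qed

text \<open>The code 3 * lx + 12 * ly determines both local coordinates because lx < 4.\<close>

lemma same_block_cell_near:
  assumes "u \<in> active" "w \<in> active" "lab u = lab w" "br u = br w" "bq u = bq w" "ce u = ce w"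
  shows "near center u w"
proof -
  obtain ly lx where u: "brick_position
      (xpos n center u (lab u)) (ypos n center u (lab u))
      (br u) ly (bq u) lx (pal u)" "ce u = 3 * lx + 12 * ly" using position[OF assms(1)] by auto
  obtain ly' lx' where w: "brick_position
      (xpos n center w (lab w)) (ypos n center w (lab w))
      (br w) ly' (bq w) lx' (pal w)" "ce w = 3 * lx' + 12 * ly'" using position[OF assms(2)] by auto
  have "lx < 4" "lx' < 4" using u w by (auto simp: brick_position_def)
  then have "lx = lx' \<and> ly = ly'" using u(2) w(2) assms(6) by presburger
  then show ?thesis using u(1) w(1) assms(3-5) by (intro same_cell_near[of u "lab u"]) simp_all
qed

lemma near_same_palette_block:
  assumes "u < n" "w < n" "u \<noteq> w" "near center u w" "pal u = pal w"
  shows "block u w"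
proof -
  have act: "u \<in> active" "w \<in> active" using near_active assms(1-4) by blast+
  have lab: "lab u = lab w" by (rule lab_near[OF assms(1,2,4)])
  obtain ly lx where u: "brick_position
      (xpos n center u (lab u)) (ypos n center u (lab u))
      (br u) ly (bq u) lx (pal u)" using position[OF act(1)] by auto
  obtain ly' lx' where w: "brick_position
      (xpos n center w (lab w)) (ypos n center w (lab w))
      (br w) ly' (bq w) lx' (pal u)" using position[OF act(2)] assms(5) by auto
  have "br u = br w \<and> bq u = bq w"
    by (rule brick_position_same_palette[OF u w near_close[OF assms(4) lab]])
  then show ?thesis unfolding block_def using lab act by (simp add: act_eq)
qed

text \<open>The codes below 36 refine a block into cliques, which costs a factor 36. A pair in a
  common cell is diagonal or an edge: at most 2 m diagonal pairs, since there are at most 2 m active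
  vertices, and at most 2 m ordered edges. Hence 36 * 4 = 144.\<close>

lemma pairs_bound: "(\<Sum>v\<in>active. block_size v) \<le> 144 * length es"
proof -
  define f where "f u = (lab u, br u, bq u)" for u
  have fin: "finite active" by (simp add: active_def)
  have "(\<Sum>v\<in>active. block_size v) \<le> (\<Sum>v\<in>active. card {u \<in> active. f v = f u})"
  proof (rule sum_mono)
    fix v assume v: "v \<in> active"
    have "u \<in> active \<and> f v = f u" if "block v u" for u
      using that v act_pos[of u] act_pos[of v] by (simp add: block_def f_def)
    then show "block_size v \<le> card {u \<in> active. f v = f u}" using fin by (intro card_mono) auto
  qed
  also have "\<dots> = card (SIGMA v:active. {u \<in> active. f v = f u})" using fin by simp
  also have "(SIGMA v:active. {u \<in> active. f v = f u}) = {(u, w). u \<in> active \<and> w \<in> active \<and> f u = f w}" by auto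
  also have "card \<dots> \<le> 36 * card {(u, w). u \<in> active \<and> w \<in> active \<and> f u = f w \<and> ce u = ce w}"
    using fin cell_bound by (intro card_pairs_refinement) auto
  also have "card {(u, w). u \<in> active \<and> w \<in> active \<and> f u = f w \<and> ce u = ce w} \<le> 4 * length es"
  proof -
    let ?D = "(\<lambda>u. (u, u)) ` active" and ?S = "prod.swap ` set es"
    have "(u, w) \<in> ?D \<union> (set es \<union> ?S)" if "u \<in> active" "w \<in> active" "f u = f w" "ce u = ce w" for u w
    proof (cases "u = w")
      case False
      have "near center u w" using that by (intro same_block_cell_near) (simp_all add: f_def)
      then have "(u, w) \<in> set es \<or> (w, u) \<in> set es"
        using near_edge[of u w] active_bound that(1,2) False by blast
      then show ?thesis by (metis UnI1 UnI2 image_eqI swap_simp)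
    qed (use that in simp)
    then have "{(u, w). u \<in> active \<and> w \<in> active \<and> f u = f w \<and> ce u = ce w} \<subseteq> ?D \<union> (set es \<union> ?S)"
      by blast
    then have "card {(u, w). u \<in> active \<and> w \<in> active \<and> f u = f w \<and> ce u = ce w} \<le> card (?D \<union> (set es \<union> ?S))"
      by (rule card_mono[rotated]) (simp add: fin)
    also have "\<dots> \<le> card ?D + card (set es \<union> ?S)" by (rule card_Un_le)
    also have "card (set es \<union> ?S) \<le> card (set es) + card ?S" by (rule card_Un_le)
    finally have "card {(u, w). u \<in> active \<and> w \<in> active \<and> f u = f w \<and> ce u = ce w} \<le>
      card ?D + (card (set es) + card ?S)" by simp
    also have "\<dots> \<le> card active + (card (set es) + card (set es))"
      by (intro add_mono card_image_le order_refl) (simp_all add: fin)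
    also have "\<dots> \<le> 2 * length es + (length es + length es)"
      by (intro add_mono card_active card_length)
    finally show ?thesis by simp
  qed
  finally show ?thesis by simp
qed

lemma progress_init: "nats s ''sol'' = (\<lambda>_. 0) \<Longrightarrow> progress {} s"
  by (simp add: progress_def)

text \<open>A subcoloring with at most two colours, shifted to the values 1 and 2, would satisfy all
  clauses of its own guess on the block of \<open>v\<close>. That guess is among those tried, yet
  \<open>progress\<close> records it as refuted.\<close>

lemma unsolved_needs_three:
  assumes P: "progress (set all_guesses) s" and v: "v \<in> active" "nats s ''sol'' v = 0"
  shows "3 \<le> subchromatic_number {..<n} E"
proof (rule ccontr)
  assume "\<not> ?thesis"
  then have two: "subchromatic_number {..<n} E \<le> 2" by simp
  have vn: "v < n" by (rule active_bound[OF v(1)])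
  obtain f where f: "clustered (near center) {..<n} f" "f ` {..<n} \<subseteq> {..<subchromatic_number {..<n} E}"
    using optimal_coloring[OF rep] by metis
  define \<tau> where "\<tau> u = f u + 1" for u
  have cl: "clustered (near center) {..<n} \<tau>" unfolding clustered_def
  proof (intro ballI impI)
    fix a b c assume "a \<in> {..<n}" "b \<in> {..<n}" "c \<in> {..<n}" "\<tau> a = \<tau> b" "\<tau> b = \<tau> c"
      "near center a b" "near center b c"
    then show "near center a c" using clusteredD[OF f(1), of a b c] by (simp add: \<tau>_def)
  qed
  have \<tau>: "\<tau> u \<in> {1, 2}" if "u < n" for u
  proof -
    have "f u < 2" using f(2) two that by force
    then show ?thesis by (auto simp: \<tau>_def)
  qed
  have act: "u \<in> active" if "block v u" for u
    using that v(1) act_pos[of u] act_pos[of v] by (simp add: block_def)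
  have clique: "near center u w" if "block v u" "block v w" "ce u = ce w" for u w
    using that act by (intro same_block_cell_near) (simp_all add: block_def)
  have "\<exists>gs. length gs = 36 \<and> set gs \<subseteq> {..<36} \<and>
      (\<forall>g. (\<forall>i<36. g i = gs ! i) \<longrightarrow> assigns n block (clash g) v \<tau>)"
  proof (rule guess_exists[of "near center" block v n ce \<tau>])
    show "near center u w \<Longrightarrow> near center w u" for u w using near_sym[of center u w] by simp
    show "clustered (near center) {..<n} \<tau>" by (rule cl)
    show "\<tau> u \<in> {1, 2}" if "u < n" for u by (rule \<tau>[OF that])
    show "ce u < 36 \<and> 3 dvd ce u" if "block v u" for u by (rule cell_bound[OF act[OF that]])
    show "near center u w" if "block v u" "block v w" "ce u = ce w" for u w by (rule clique[OF that])
    show "block u w \<Longrightarrow> block w z \<Longrightarrow> block u z" for u w z by (rule B_trans)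
    fix gs assume "length gs = 36" "set gs \<subseteq> {..<36}"
      "\<And>g. \<forall>i<36. g i = gs ! i \<Longrightarrow> assigns n block (clash g) v \<tau>"
    then show ?thesis by blast
  qed (fact near_refl B_refl B_sym)+
  then obtain gs where gs: "length gs = 36" "set gs \<subseteq> {..<36}"
      "\<And>g. (\<forall>i<36. g i = gs ! i) \<Longrightarrow> assigns n block (clash g) v \<tau>"
    by blast
  have "gs \<in> set all_guesses" using gs(1,2) by (auto simp: all_guesses_def set_n_lists)
  moreover have "\<not> (\<forall>u<n. block v u \<longrightarrow> nats s ''sol'' u \<in> {1, 2})" using vn v(2) B_refl[of v] by auto
  moreover have "0 < act v" using v(1) act_pos by simp
  ultimately obtain g where "\<forall>i<36. g i = gs ! i" "\<forall>\<tau>. \<not> assigns n block (clash g) v \<tau>"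
    using P[unfolded progress_def] vn by blast
  then show False using gs(3) by blast
qed

text \<open>Halving a colour gives the brick colour, its parity the colour inside the brick. So
  adjacent vertices of one colour share a block, and a, b, c all lie in the block of
  \<open>b\<close>, where \<open>sol\<close> is clustered.\<close>

lemma six_coloring:
  assumes P: "progress D s" and solved: "\<And>v. v \<in> active \<Longrightarrow> nats s ''sol'' v \<noteq> 0"
    and col: "\<And>v. v \<in> active \<Longrightarrow> col v = pal v + pal v + (nats s ''sol'' v - 1)" "\<And>v. v \<notin> active \<Longrightarrow> col v = 0"
  shows "clustered (near center) {..<n} col" "col ` {..<n} \<subseteq> {..<6}"
proof -
  have settled: "(\<forall>u<n. block v u \<longrightarrow> nats s ''sol'' u \<in> {1, 2}) \<and>
      clustered (near center) {u. u < n \<and> block v u} (nats s ''sol'')" if "v \<in> active" for v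
  proof -
    have v: "v < n" "0 < act v" using that active_bound act_pos by auto
    have "\<not> (\<forall>u<n. block v u \<longrightarrow> nats s ''sol'' u = 0)" using v B_refl[of v] solved[OF that] by auto
    then show ?thesis using P[unfolded progress_def] v by blast
  qed
  have sol: "nats s ''sol'' v \<in> {1, 2}" if "v \<in> active" for v
    using settled[OF that] active_bound[OF that] B_refl[of v] by blast
  have pal: "pal v < 3" if "v \<in> active" for v
    using position[OF that] by (auto simp: brick_position_def)
  show "col ` {..<n} \<subseteq> {..<6}"
  proof clarsimp
    fix v show "col v < 6"
      using col[of v] sol[of v] pal[of v] by (cases "v \<in> active") auto
  qed
  have split: "pal u = pal w \<and> nats s ''sol'' u = nats s ''sol'' w"
    if "u \<in> active" "w \<in> active" "col u = col w" for u w
  proof -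
    define i j where "i = nats s ''sol'' u - 1" and "j = nats s ''sol'' w - 1"
    have "nats s ''sol'' u = Suc i" "i < 2" "nats s ''sol'' w = Suc j" "j < 2"
      using sol[OF that(1)] sol[OF that(2)] by (auto simp: i_def j_def)
    moreover have "pal u + pal u + i = pal w + pal w + j" using that col(1) by (simp add: i_def j_def)
    ultimately show ?thesis by presburger
  qed
  show "clustered (near center) {..<n} col" unfolding clustered_def
  proof (intro ballI impI)
    fix a b c assume V: "a \<in> {..<n}" "b \<in> {..<n}" "c \<in> {..<n}" and eq: "col a = col b" "col b = col c"
      and near: "near center a b" "near center b c"
    show "near center a c"
    \<comment> \<open>If both steps join distinct vertices, all three are active; isolated vertices,
      which share colour 0, occur only in degenerate triples.\<close>
    proof (cases "a = b \<or> b = c")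
      case False
      then have act: "a \<in> active" "b \<in> active" "c \<in> active"
        using near_active[of a b] near_active[of b c] V near by auto
      note ab = split[OF act(1,2) eq(1)] and bc = split[OF act(2,3) eq(2)]
      have "block a b" "block b c" using near_same_palette_block V near ab bc False by auto
      then have "block b a" "block b b" "block b c" using B_sym B_refl by blast+
      then show ?thesis
        using clusteredD[OF conjunct2[OF settled[OF act(2)]], of a b c] V ab bc near by simp
    qed (use near in auto)
  qed
qed

text \<open>Division by 3 recovers the row residue from a fallback colour, the remainder the column
  residue. Adjacent active vertices of one colour therefore share a cell, and cells are
  cliques.\<close>

lemma nine_coloring:
  assumes col: "\<And>v. v \<in> active \<Longrightarrow> col v = fb v" "\<And>v. v \<notin> active \<Longrightarrow> col v = 0"
  shows "clustered (near center) {..<n} col" "col ` {..<n} \<subseteq> {..<9}"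
proof -
  have "fb v < 9" if act: "v \<in> active" for v
  proof -
    obtain ly lx where "ly < 3" "fb v = 3 * ly + (pal v + lx) mod 3"
      using position[OF act] by (auto simp: brick_position_def)
    moreover have "(pal v + lx) mod 3 < 3" by simp
    ultimately show ?thesis by linarith
  qed
  then show "col ` {..<n} \<subseteq> {..<9}" using col by (metis image_subsetI lessThan_iff zero_less_numeral)
  have same: "lab u = lab w \<and> br u = br w \<and> bq u = bq w \<and> ce u = ce w"
    if uw: "u < n" "w < n" "near center u w" "col u = col w" "u \<in> active" "w \<in> active" for u w
  proof -
    have lab: "lab u = lab w" by (rule lab_near[OF uw(1-3)])
    obtain ly lx where u: "brick_position
        (xpos n center u (lab u)) (ypos n center u (lab u))
        (br u) ly (bq u) lx (pal u)" "ce u = 3 * lx + 12 * ly" "fb u = 3 * ly + (pal u + lx) mod 3"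
      using position[OF uw(5)] by auto
    obtain ly' lx' where w: "brick_position
        (xpos n center w (lab w)) (ypos n center w (lab w))
        (br w) ly' (bq w) lx' (pal w)" "ce w = 3 * lx' + 12 * ly'" "fb w = 3 * ly' + (pal w + lx') mod 3"
      using position[OF uw(6)] by auto
    have sum: "3 * ly + (pal u + lx) mod 3 = 3 * ly' + (pal w + lx') mod 3" using u(3) w(3) uw(4-6) col(1) by simp
    moreover have "(pal u + lx) mod 3 < 3" "(pal w + lx') mod 3 < 3" by simp_all
    ultimately have ly: "ly = ly'" by linarith
    then have fb: "(pal u + lx) mod 3 = (pal w + lx') mod 3" using sum by simp
    have "br u = br w \<and> bq u = bq w \<and> lx = lx'"
      by (rule brick_position_same_fallback[OF u(1) w(1)[folded ly] near_close[OF uw(3) lab] fb])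
    then show ?thesis using lab u(2) w(2) ly by simp
  qed
  show "clustered (near center) {..<n} col" unfolding clustered_def
  proof (intro ballI impI)
    fix a b c assume V: "a \<in> {..<n}" "b \<in> {..<n}" "c \<in> {..<n}" and eq: "col a = col b" "col b = col c"
      and near: "near center a b" "near center b c"
    show "near center a c"
    proof (cases "a = b \<or> b = c")
      case False
      then have act: "a \<in> active" "b \<in> active" "c \<in> active"
        using near_active[of a b] near_active[of b c] V near by auto
      then show ?thesis using same[of a b] same[of b c] V near eq by (intro same_block_cell_near) auto
    qed (use near in auto)
  qed
qed

end

section \<open>The complete program and its running time\<close>

definition algorithm :: com where
  "algorithm = Cond (NLess (NLit 0) (scalar ''m''))
    (Seq init_labels (Seq find_components (Seq test_cluster
      (Cond (NEq (scalar ''flag'') (NLit 0)) Skip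
        (Seq place_all (Seq (try_guesses all_guesses) finish)))))) Skip"

definition algorithm_cost :: nat where
  "algorithm_cost = 300 + max_cost init_step + max_cost merge_start + max_cost relabel + max_cost cluster_check +
     2 * place_cost + sum_list (map guess_cost all_guesses) + max_cost check_solved + max_cost paint"

lemma has_input_input_state: "has_input n es center (input_state n es center)"
  by (simp add: has_input_def input_state_def)

lemma input_state_zero:
  "a \<notin> {''n'', ''m'', ''src'', ''dst''} \<Longrightarrow> nats (input_state n es center) a = (\<lambda>_. 0)"
  by (auto simp: input_state_def)

lemma writes_try_guesses: "writes (try_guesses gss) \<subseteq> solver_names"
  using writes_try_guess by (induction gss) auto

context unit_disk_instance
begin

definition correct :: "state \<Rightarrow> bool" where
  "correct s \<longleftrightarrow> clustered (near center) {..<n} (nats s ''color'') \<and>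
     nats s ''color'' ` {..<n} \<subseteq> {..<3 * subchromatic_number {..<n} E}"

text \<open>Optimum at least 2 justifies six colours. An unsolved active vertex raises the lower
  bound to 3, which justifies nine.\<close>

lemma runs_color:
  assumes input: "has_input n es center s" and N: "reals s ''N'' 0 = real n"
    and labels: "component_labels n center (nats s ''lab'')" "\<forall>(u, w)\<in>set es. nats s ''lab'' u = nats s ''lab'' w"
    and act: "nats s ''act'' = (\<lambda>v. if v \<in> active then 1 else 0)"
    and zero: "nats s ''sol'' = (\<lambda>_. 0)" "nats s ''fail'' = (\<lambda>_. 0)" "nats s ''color'' = (\<lambda>_. 0)"
    and two: "2 \<le> subchromatic_number {..<n} E"
  shows "runs (Seq place_all (Seq (try_guesses all_guesses) finish)) s
    ((9 + n * 19 + 2 * length es * (place_cost * n)) + ((1 + sum_list (map guess_cost all_guesses)) * n * length es +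
      (18 + n * (24 + max_cost check_solved + max_cost paint)))) correct"
proof -
  have "\<forall>v. 0 < nats s ''act'' v \<longleftrightarrow> v \<in> active" by (simp add: act)
  then have place: "runs place_all s (9 + n * 19 + 2 * length es * (place_cost * n)) (\<lambda>s'. \<forall>v\<in>active. placed n center s' v)"
    by (rule runs_place_all[OF input N labels(1)])
  show ?thesis
  proof (rule runs_Seq[OF place])
    fix s1 :: state
    assume "frame (writes place_all) s s1" and pos: "\<forall>v\<in>active. placed n center s1 v"
    then have fr1: "frame (insert ''v'' place_names) s s1" by (simp add: place_all_def writes_place)
    have input1: "has_input n es center s1"
      using input fr1 by (rule has_input_frame) (simp add: place_names_def)
    have keep1: "nats s1 ''lab'' = nats s ''lab''" "nats s1 ''act'' = nats s ''act''" "nats s1 ''sol'' = (\<lambda>_. 0)"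
      "nats s1 ''fail'' = (\<lambda>_. 0)" "nats s1 ''color'' = (\<lambda>_. 0)"
      using fr1 zero by (simp_all add: frame_def place_names_def)
    interpret P: placed_instance n E es center "nats s1 ''lab''" "nats s1 ''br''" "nats s1 ''bq''" "nats s1 ''act''"
      "nats s1 ''ce''" "nats s1 ''pal''" "nats s1 ''fb''"
    proof unfold_locales
      fix v assume "v \<in> active"
      then show "\<exists>ly lx. brick_position (xpos n center v (nats s1 ''lab'' v))
          (ypos n center v (nats s1 ''lab'' v))
          (nats s1 ''br'' v) ly (nats s1 ''bq'' v) lx (nats s1 ''pal'' v) \<and>
        nats s1 ''ce'' v = 3 * lx + 12 * ly \<and> nats s1 ''fb'' v = 3 * ly + (nats s1 ''pal'' v + lx) mod 3"
        using pos unfolding placed_def by blast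
    qed (use labels act keep1 in simp_all)
    have blocks: "P.has_blocks s1" unfolding P.has_blocks_def using input1 by simp
    have len: "\<forall>gs\<in>set all_guesses. length gs = 36" by (auto simp: all_guesses_def set_n_lists)
    show "runs (Seq (try_guesses all_guesses) finish) s1 ((1 + sum_list (map guess_cost all_guesses)) * n * length es +
      (18 + n * (24 + max_cost check_solved + max_cost paint))) correct"
    proof (rule runs_Seq[OF P.runs_try_guesses[OF P.act_pos P.pairs_bound blocks P.progress_init[OF keep1(3)] len]])
      fix s2 :: state
      assume "frame (writes (try_guesses all_guesses)) s1 s2" and "P.progress ({} \<union> set all_guesses) s2"
      then have fr2: "frame solver_names s1 s2" and prog: "P.progress (set all_guesses) s2"
        using frame_mono[OF _ writes_try_guesses] by auto
      have keep2: "nats s2 a = nats s1 a" if "a \<in> {''n'', ''fail'', ''color'', ''act'', ''pal'', ''fb''}" for a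
        by (rule frame_nats[OF fr2]) (use that in \<open>auto simp: solver_names_def\<close>)
      have act2: "0 < nats s2 ''act'' v \<longleftrightarrow> v \<in> active" for v using P.act_pos keep2 by simp
      have "runs finish s2 (18 + n * (24 + max_cost check_solved + max_cost paint)) (\<lambda>s'. nats s' ''color'' = final_color n s2)"
        by (rule runs_finish) (use input1 keep1 keep2 in \<open>simp_all add: has_input_def\<close>)
      then show "runs finish s2 (18 + n * (24 + max_cost check_solved + max_cost paint)) correct"
      proof (rule runs_conseq)
        fix s3 :: state
        assume col: "nats s3 ''color'' = final_color n s2"
        have inactive: "nats s3 ''color'' v = 0" if "v \<notin> active" for v
          using that act2 by (simp add: col final_color_def)
        show "correct s3"
        proof (cases "\<forall>u<n. 0 < nats s2 ''act'' u \<longrightarrow> nats s2 ''sol'' u \<noteq> 0")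
          case True
          have solved: "nats s2 ''sol'' v \<noteq> 0" if "v \<in> active" for v using True that active_bound act2 by simp
          have "nats s3 ''color'' v = nats s1 ''pal'' v + nats s1 ''pal'' v + (nats s2 ''sol'' v - 1)" if "v \<in> active" for v
            using that active_bound act2 True keep2 by (simp add: col final_color_def)
          from P.six_coloring[OF prog solved this inactive] show ?thesis
            unfolding correct_def using two by fastforce
        next
          case False
          then obtain u where "u \<in> active" "nats s2 ''sol'' u = 0" using act2 by blast
          then have three: "3 \<le> subchromatic_number {..<n} E" by (rule P.unsolved_needs_three[OF prog])
          have "nats s3 ''color'' v = nats s1 ''fb'' v" if "v \<in> active" for v
          proof -
            have "final_color n s2 v = nats s2 ''fb'' v"
              unfolding final_color_def using that active_bound act2 False by auto
            then show ?thesis using keep2 by (simp add: col)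
          qed
          from P.nine_coloring[OF this inactive] show ?thesis
            unfolding correct_def using three by fastforce
        qed
      qed simp
    qed
  qed
qed

lemma runs_algorithm: "runs algorithm (input_state n es center) (algorithm_cost * (n * length es)) correct"
proof -
  let ?s = "input_state n es center" and ?b = "NLess (NLit 0) (scalar ''m'')"
  let ?f = "NEq (scalar ''flag'') (NLit 0)"
  let ?T1 = "9 + n * (12 + max_cost init_step)"
  let ?T2 = "9 + length es * (21 + max_cost merge_start + n * (12 + max_cost relabel))"
  let ?T3 = "9 + length es * (21 + n * (12 + max_cost cluster_check))"
  let ?T4 = "(9 + n * 19 + 2 * length es * (place_cost * n)) + ((1 + sum_list (map guess_cost all_guesses)) * n * length es +
      (18 + n * (24 + max_cost check_solved + max_cost paint)))"
  let ?color = "Seq place_all (Seq (try_guesses all_guesses) finish)"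
  have input: "has_input n es center ?s" by (rule has_input_input_state)
  have "runs algorithm ?s (1 + bcost ?b + (?T1 + (?T2 + (?T3 + (1 + bcost ?f + ?T4))))) correct"
    unfolding algorithm_def
  proof (rule runs_Cond)
    assume "\<not> bval ?b ?s"
    then show "runs Skip ?s (?T1 + (?T2 + (?T3 + (1 + bcost ?f + ?T4)))) correct"
      using input m_pos by (simp add: has_input_def)
  next
    have init: "runs init_labels ?s ?T1 (\<lambda>s'. (\<forall>v<n. nats s' ''lab'' v = v) \<and> reals s' ''N'' 0 = real n)"
      by (rule runs_init_labels) (simp_all add: input_state_def)
    show "runs (Seq init_labels (Seq find_components (Seq test_cluster (Cond ?f Skip ?color)))) ?s
      (?T1 + (?T2 + (?T3 + (1 + bcost ?f + ?T4)))) correct"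
    proof (rule runs_Seq[OF init])
      fix s1 :: state
      assume "frame (writes init_labels) ?s s1"
        and post1: "(\<forall>v<n. nats s1 ''lab'' v = v) \<and> reals s1 ''N'' 0 = real n"
      then have fr1: "frame {''v'', ''lab'', ''N''} ?s s1" by (simp add: init_labels_def init_step_def insert_commute)
      have input1: "has_input n es center s1" using input fr1 by (rule has_input_frame) simp
      have zero1: "nats s1 a = (\<lambda>_. 0)" if "a \<in> {''act'', ''flag'', ''sol'', ''fail'', ''color''}" for a
        using frame_nats[OF fr1, of a] input_state_zero[of a n es center] that by auto
      have comps: "runs find_components s1 ?T2 (\<lambda>s'. component_labels n center (nats s' ''lab'') \<and>
          (\<forall>(u, w)\<in>set es. nats s' ''lab'' u = nats s' ''lab'' w) \<and> nats s' ''act'' = (\<lambda>v. if v \<in> active then 1 else 0))"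
        by (rule runs_find_components[OF input1]) (use post1 zero1 in simp_all)
      show "runs (Seq find_components (Seq test_cluster (Cond ?f Skip ?color))) s1 (?T2 + (?T3 + (1 + bcost ?f + ?T4))) correct"
      proof (rule runs_Seq[OF comps])
        fix s2 :: state
        assume "frame (writes find_components) s1 s2"
          and post2: "component_labels n center (nats s2 ''lab'') \<and>
            (\<forall>(u, w)\<in>set es. nats s2 ''lab'' u = nats s2 ''lab'' w) \<and> nats s2 ''act'' = (\<lambda>v. if v \<in> active then 1 else 0)"
        then have fr2: "frame {''e'', ''p'', ''q'', ''act'', ''w'', ''lab''} s1 s2"
          by (simp add: find_components_def merge_start_def relabel_def insert_commute)
        have input2: "has_input n es center s2" using input1 fr2 by (rule has_input_frame) simp
        have zero2: "nats s2 a = (\<lambda>_. 0)" if "a \<in> {''flag'', ''sol'', ''fail'', ''color''}" for a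
          using frame_nats[OF fr2, of a] zero1[of a] that by auto
        have N2: "reals s2 ''N'' 0 = real n" using frame_reals[OF fr2, of "''N''"] post1 by simp
        have test: "runs test_cluster s2 ?T3
          (\<lambda>s'. nats s' ''flag'' 0 = 0 \<longleftrightarrow> (\<forall>(a, b)\<in>set es. \<forall>w<n. near center a w \<longleftrightarrow> near center b w))"
          by (rule runs_test_cluster[OF input2]) (use zero2 in simp)
        show "runs (Seq test_cluster (Cond ?f Skip ?color)) s2 (?T3 + (1 + bcost ?f + ?T4)) correct"
        proof (rule runs_Seq[OF test])
          fix s3 :: state
          assume "frame (writes test_cluster) s2 s3"
            and post3: "nats s3 ''flag'' 0 = 0 \<longleftrightarrow> (\<forall>(a, b)\<in>set es. \<forall>w<n. near center a w \<longleftrightarrow> near center b w)"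
          then have fr3: "frame {''e'', ''w'', ''flag''} s2 s3"
            by (simp add: test_cluster_def cluster_check_def insert_commute)
          have input3: "has_input n es center s3" using input2 fr3 by (rule has_input_frame) simp
          have keep3: "nats s3 a = nats s2 a" if "a \<in> {''lab'', ''act'', ''sol'', ''fail'', ''color''}" for a
            by (rule frame_nats[OF fr3]) (use that in auto)
          have N3: "reals s3 ''N'' 0 = real n" using frame_reals[OF fr3, of "''N''"] N2 by simp
          show "runs (Cond ?f Skip ?color) s3 (1 + bcost ?f + ?T4) correct"
          proof (rule runs_Cond)
            assume "bval ?f s3"
            then have cluster: "\<forall>(a, b)\<in>set es. \<forall>w<n. near center a w \<longleftrightarrow> near center b w"
              using post3 by simp
            have "nats s3 ''color'' = (\<lambda>_. 0)" using keep3 zero2 by simp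
            then have "correct s3"
              unfolding correct_def using clustered_if_cluster[OF cluster] subchromatic_pos by auto
            then show "runs Skip s3 ?T4 correct" by (intro runs_loop_freeI) simp_all
          next
            assume "\<not> bval ?f s3"
            then have "\<not> (\<forall>(a, b)\<in>set es. \<forall>w<n. near center a w \<longleftrightarrow> near center b w)"
              using post3 by simp
            then have two: "2 \<le> subchromatic_number {..<n} E"
              using cluster_if_one_color by fastforce
            show "runs ?color s3 ?T4 correct"
              by (rule runs_color[OF input3 N3 _ _ _ _ _ _ two]) (use post2 zero2 keep3 in simp_all)
          qed
        qed
      qed
    qed
  qed
  moreover have "1 + bcost ?b + (?T1 + (?T2 + (?T3 + (1 + bcost ?f + ?T4)))) \<le> algorithm_cost * (n * length es)"
  proof -
    have "1 + bcost ?b + ((9 + x * (12 + a)) + ((9 + y * (21 + b + x * (12 + c))) + ((9 + y * (21 + x * (12 + d))) +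
        (1 + bcost ?f + ((9 + x * 19 + 2 * y * (e * x)) + ((1 + f) * x * y + (18 + x * (24 + g + h)))))))) \<le>
      (300 + a + b + c + d + 2 * e + f + g + h) * (x * y)"
      if "0 < x" "0 < y" for a b c d e f g h x y :: nat
    proof -
      obtain x' y' where "x = Suc x'" "y = Suc y'" using \<open>0 < x\<close> \<open>0 < y\<close> by (metis gr0_implies_Suc)
      then show ?thesis by (simp add: NEq_def algebra_simps)
    qed
    then show ?thesis using n_pos m_pos unfolding algorithm_cost_def by blast
  qed
  ultimately show ?thesis by (rule runs_conseq)
qed

end

text \<open>The 6 units are 5 for the test of \<open>m\<close> and 1 for \<open>Skip\<close>; the
  answer is the all-zero colouring present from the start.\<close>

lemma algorithm_no_edges:
  assumes rep: "unit_disk_representation {..<n} E center" and E: "E = {}"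
  shows "exec algorithm (input_state n [] center) 6 (input_state n [] center)"
    "clustered (near center) {..<n} (\<lambda>_. 0)"
    "card (color_classes {..<n} (\<lambda>_. 0)) \<le> 3 * subchromatic_number {..<n} E"
proof -
  let ?b = "NLess (NLit 0) (scalar ''m'')"
  have "\<not> bval ?b (input_state n [] center)" by (simp add: input_state_def)
  from exec.Cond_False[OF this exec.Skip] show "exec algorithm (input_state n [] center) 6 (input_state n [] center)"
    unfolding algorithm_def by (simp add: numeral_eq_Suc)
  have eq: "a = b" if "a < n" "b < n" "near center a b" for a b
    using edge_iff_near[OF rep, of a b] that E by auto
  show "clustered (near center) {..<n} (\<lambda>_. 0)" unfolding clustered_def
  proof (intro ballI impI)
    fix a b c assume "a \<in> {..<n}" "b \<in> {..<n}" "c \<in> {..<n}" "near center a b" "near center b c"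
    then show "near center a c" using eq[of a b] by simp
  qed
  show "card (color_classes {..<n} (\<lambda>_. 0)) \<le> 3 * subchromatic_number {..<n} E"
  \<comment> \<open>Positivity of the subchromatic number needs a vertex; without vertices there is
    no colour class to count.\<close>
  proof (cases "n = 0")
    case True
    then show ?thesis by (simp add: color_classes_def)
  next
    case False
    obtain f where "f ` {..<n} \<subseteq> {..<subchromatic_number {..<n} E}" using optimal_coloring[OF rep] by metis
    then have "0 < subchromatic_number {..<n} E" using False by fastforce
    moreover have "card (color_classes {..<n} (\<lambda>_. 0)) \<le> 1" by (rule card_color_classes_le) auto
    ultimately show ?thesis by linarith
  qed
qed

theorem theorem6:
  shows "\<exists>(prog :: com) (C :: nat).
    \<forall>(n :: nat) (E :: nat set set) (es :: (nat \<times> nat) list) (center :: nat \<Rightarrow> real \<times> real).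
      unit_disk_representation {..<n} E center \<longrightarrow>
      edge_enumeration E es \<longrightarrow>
      (\<exists>t s. exec prog (input_state n es center) t s \<and>
             t \<le> C * (n * card E + 1) \<and>
             subcoloring {..<n} E (color_classes {..<n} (output_coloring s)) \<and>
             card (color_classes {..<n} (output_coloring s)) \<le> 3 * subchromatic_number {..<n} E)"
\<comment> \<open>The summand 6 pays for inputs without edges, \<open>algorithm_cost\<close> for all
  others.\<close>
proof (rule exI[of _ algorithm], rule exI[of _ "6 + algorithm_cost"], intro allI impI)
  fix n :: nat and E :: "nat set set" and es :: "(nat \<times> nat) list" and center :: "nat \<Rightarrow> real \<times> real"
  assume rep: "unit_disk_representation {..<n} E center" and enum: "edge_enumeration E es"
  have m: "length es = card E" using enum by (rule edge_enumeration_length)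
  show "\<exists>t s. exec algorithm (input_state n es center) t s \<and> t \<le> (6 + algorithm_cost) * (n * card E + 1) \<and>
      subcoloring {..<n} E (color_classes {..<n} (output_coloring s)) \<and>
      card (color_classes {..<n} (output_coloring s)) \<le> 3 * subchromatic_number {..<n} E"
  proof (cases "es = []")
    case True
    then have E: "E = {}" using enum by (simp add: edge_enumeration_def)
    note alg = algorithm_no_edges[OF rep E]
    have "output_coloring (input_state n [] center) = (\<lambda>_. 0)"
      by (simp add: output_coloring_def input_state_zero)
    then show ?thesis
      using alg(1,3) subcoloring_color_classes[OF rep alg(2)] True by (intro exI conjI) auto
  next
    case False
    interpret unit_disk_instance n E es center by unfold_locales (fact rep enum False)+
    obtain t s where "exec algorithm (input_state n es center) t s" "t \<le> algorithm_cost * (n * length es)" "correct s"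
      using runs_algorithm unfolding runs_def by blast
    moreover have "algorithm_cost * (n * length es) \<le> (6 + algorithm_cost) * (n * card E + 1)"
      unfolding m by (intro mult_mono) auto
    ultimately show ?thesis
      using subcoloring_color_classes[OF rep] card_color_classes_le unfolding correct_def output_coloring_def
      by (meson order_trans)
  qed
qed

end
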